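(* For every $n\in\mathbb N$, the functions $v_n$ and $V_n$ coincide. For every $\varepsilon\ge0$, let for every $n=0,1,\dots$ and $(\phi_0,\phi_1)\in\mathbb R_+^2$, $$r_n^\varepsilon(\phi_0,\phi_1)=\inf\{s\in(0,\infty]:Jv_n(s,\phi_0,\phi_1)\le J_0v_n(\phi_0,\phi_1)+\varepsilon\},$$ $$S_1^\varepsilon=r_0^\varepsilon(\widetilde\Phi_0)\wedge\sigma_1,\qquad S_{n+2}^\varepsilon=\begin{cases}r_{n+1}^{\varepsilon/2}(\widetilde\Phi_0),&\text{if }\sigma_1>r_{n+1}^{\varepsilon/2}(\widetilde\Phi_0),\\ \sigma_1+S_{n+1}^{\varepsilon/2}\circ\theta_{\sigma_1},&\text{if }\sigma_1\le r_{n+1}^{\varepsilon/2}(\widetilde\Phi_0),\end{cases}$$ where $\theta_s$ is the shift-operator on $\Omega$: $N_t\circ\theta_s=N_{s+t}$. Then $$\mathbb E_0^{\phi_0,\phi_1}\Big[\int_0^{S_n^\varepsilon}e^{-\lambda t}g(\widetilde\Phi_t)\,dt\Big]\le v_n(\phi_0,\phi_1)+\varepsilon,\qquad n=1,2,\dots,\ \varepsilon\ge0.$$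
   Context: Fix constants $\lambda>0$, $\mu>1$, $c>0$, $m\in(-1,1)$; $\mathbb R_+=[0,\infty)$, $\mathbb N=\{1,2,\dots\}$, and the infimum of the empty set is $\infty$. On a probability space $(\Omega,\mathcal H,\mathbb P_0)$ let $N$ be a homogeneous Poisson process with rate $\mu$ and jump times $0=\sigma_0<\sigma_1<\sigma_2<\cdots$; $\mathbb F$ is the right-continuous enlargement with $\mathbb P_0$-null sets of its natural filtration, and $\mathcal S$ is the collection of all $\mathbb F$-stopping times. For $\phi_0,\phi_1\in\mathbb R$ let $x(t,\phi_0)$, $y(t,\phi_1)$, $t\in\mathbb R$, be the solutions of $$\frac{d}{dt}x(t,\phi_0)=(\lambda+1)x(t,\phi_0)+\frac{\lambda(1-m)}{\sqrt2},\ x(0,\phi_0)=\phi_0;\qquad \frac{d}{dt}y(t,\phi_1)=(\lambda-1)y(t,\phi_1)+\frac{\lambda(1+m)}{\sqrt2},\ y(0,\phi_1)=\phi_1,$$ and let $S(\phi_0,\phi_1)=\big((1-\frac1\mu)\phi_0,(1+\frac1\mu)\phi_1\big)$. The process $\widetilde\Phi=(\widetilde\Phi^{(0)},\widetilde\Phi^{(1)})$ in $\mathbb R_+^2$ started at $(\phi_0,\phi_1)$ satisfies $\widetilde\Phi_0=(\phi_0,\phi_1)$, $\widetilde\Phi_t=\big(x(t-\sigma_n,\widetilde\Phi^{(0)}_{\sigma_n}),y(t-\sigma_n,\widetilde\Phi^{(1)}_{\sigma_n})\big)$ for $\sigma_n\le t<\sigma_{n+1}$, $n\ge0$, and $\widetilde\Phi_{\sigma_n}=S(\widetilde\Phi_{\sigma_n-})$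 for $n\ge1$. $\mathbb E_0^{\phi_0,\phi_1}$ is the $\mathbb P_0$-expectation when $\widetilde\Phi_0=(\phi_0,\phi_1)$. Let $g(\phi_0,\phi_1)=\phi_0+\phi_1-\frac{\lambda}{c}\sqrt2$ and $$V_n(\phi_0,\phi_1)=\inf_{\tau\in\mathcal S}\mathbb E_0^{\phi_0,\phi_1}\Big[\int_0^{\tau\wedge\sigma_n} e^{-\lambda t}g(\widetilde\Phi_t)\,dt\Big],\qquad n\in\mathbb N,\ (\phi_0,\phi_1)\in\mathbb R_+^2.$$ For bounded Borel $w:\mathbb R_+^2\to\mathbb R$ and $t\in[0,\infty]$ put $$Jw(t,\phi_0,\phi_1)=\mathbb E_0^{\phi_0,\phi_1}\Big[\int_0^{t\wedge\sigma_1}e^{-\lambda u}g(\widetilde\Phi_u)\,du+1_{\{t\ge\sigma_1\}}e^{-\lambda\sigma_1}w(\widetilde\Phi_{\sigma_1})\Big],\qquad J_tw(\phi_0,\phi_1)=\inf_{u\in[t,\infty]}Jw(u,\phi_0,\phi_1),$$ and $v_0\equiv0$, $v_n=J_0v_{n-1}$ for $n\in\mathbb N$. The shift $\theta_{\sigma_1}$ acts on the whole path after time $\sigma_1$: $S_{n+1}^{\varepsilon/2}\circ\theta_{\sigma_1}$ is the time $S_{n+1}^{\varepsilon/2}$ computed for the process $(\widetilde\Phi_{\sigma_1+t})_{t\ge0}$, which starts at $\widetilde\Phi_{\sigma_1}$.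
   Formalization: For ε=0, when the set {s∈(0,∞]: Jv_n(s,φ) ≤ J_0v_n(φ)} is empty, r_n^0(φ) is taken to be 0 instead of inf ∅ = ∞; with ∞ the final inequality fails, e.g. n=1 and φ_0 > λ√2/c. For ε>0, and whenever the set is nonempty, r_n^ε is as stated. *)

theory Defs
  imports "HOL-Probability.Probability"
begin

section \<open>Counting paths and the Poisson process\<close>

text \<open>A nondecreasing right-continuous path from 0 that takes every natural number as a value:
  it is unbounded, all its jumps have size 1, and its jump times are finite and strictly
  increasing.\<close>

definition counting_path :: "(real \<Rightarrow> nat) \<Rightarrow> bool" where
  "counting_path p \<longleftrightarrow>
     p 0 = 0 \<and> mono_on {0..} p \<and> (\<forall>t\<ge>0. continuous (at_right t) p) \<and> p ` {0..} = UNIV"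

text \<open>Jumps are counted relative to \<open>p 0\<close>, so that the shift below is literally
  \<open>N\<^sub>t \<circ> \<theta>\<^sub>s = N\<^sub>s\<^sub>+\<^sub>t\<close>. In particular the 0-th jump time is 0.\<close>

definition jump_time :: "(real \<Rightarrow> nat) \<Rightarrow> nat \<Rightarrow> real" where
  "jump_time p n = Inf {t. 0 \<le> t \<and> p 0 + n \<le> p t}"

definition shift :: "real \<Rightarrow> (real \<Rightarrow> nat) \<Rightarrow> (real \<Rightarrow> nat)" where
  "shift s p = (\<lambda>t. p (s + t))"

locale poisson_process = prob_space M for M :: "'a measure" +
  fixes N :: "real \<Rightarrow> 'a \<Rightarrow> nat" and \<mu> :: real
  assumes rate_pos: "\<mu> > 0"
    and measurable_N: "\<And>t. 0 \<le> t \<Longrightarrow> N t \<in> measurable M (count_space UNIV)"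
    and paths: "\<And>\<omega>. \<omega> \<in> space M \<Longrightarrow> counting_path (\<lambda>t. N t \<omega>)"
    and increments: "\<And>s t. 0 \<le> s \<Longrightarrow> s < t \<Longrightarrow>
      distr M (count_space UNIV) (\<lambda>\<omega>. N t \<omega> - N s \<omega>) = measure_pmf (poisson_pmf (\<mu> * (t - s)))"
    and independent_increments: "\<And>(ts :: nat \<Rightarrow> real) k. 0 \<le> ts 0 \<Longrightarrow> (\<forall>i<k. ts i < ts (Suc i)) \<Longrightarrow>
      indep_vars (\<lambda>_. count_space UNIV) (\<lambda>i \<omega>. N (ts (Suc i)) \<omega> - N (ts i) \<omega>) {..<k}"

text \<open>\<open>\<F>\<^sub>t\<close> is the intersection over \<open>u > t\<close> of the sigma-algebras generated by
  \<open>N\<^sub>s\<close>, \<open>s \<le> u\<close>, and the null sets. The index \<open>t\<close> ranges over \<open>[0,\<infinity>]\<close> so that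
  \<^const>\<open>stopping_time\<close> applies to \<open>[0,\<infinity>]\<close>-valued times; adding the index
  \<open>\<infinity>\<close> changes nothing for finite \<open>t\<close> and gives \<open>\<F>\<^sub>\<infinity>\<close>
  (where \<open>\<tau> \<le> \<infinity>\<close> is no condition).\<close>

definition augmented_filtration :: "'a measure \<Rightarrow> (real \<Rightarrow> 'a \<Rightarrow> nat) \<Rightarrow> ennreal \<Rightarrow> 'a measure" where
  "augmented_filtration M N t = sigma (space M)
     (\<Inter>u\<in>insert \<infinity> {t<..}. sigma_sets (space M)
        ({N s -` A \<inter> space M | s A. 0 \<le> s \<and> ennreal s \<le> u} \<union> null_sets M))"


section \<open>The piecewise deterministic process\<close>

definition ode_solution :: "real \<Rightarrow> real \<Rightarrow> real \<Rightarrow> real \<Rightarrow> real" where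
  "ode_solution a b z =
     (THE f. f 0 = z \<and> (\<forall>t. (f has_real_derivative a * f t + b) (at t)))"

lemma ode_solution_unique_exists:
  fixes a b z :: real
  shows "\<exists>!f. f 0 = z \<and> (\<forall>t. (f has_real_derivative a * f t + b) (at t))"
proof (rule ex_ex1I)
  show "\<exists>f. f 0 = z \<and> (\<forall>t. (f has_real_derivative a * f t + b) (at t))"
  proof (cases "a = 0")
    case True
    then show ?thesis
      by (intro exI[of _ "\<lambda>t. z + b * t"]) (auto intro!: derivative_eq_intros)
  next
    case False
    then show ?thesis
      by (intro exI[of _ "\<lambda>t. (z + b / a) * exp (a * t) - b / a"])
         (auto intro!: derivative_eq_intros simp: field_simps)
  qed
next
  fix f h :: "real \<Rightarrow> real"
  assume f: "f 0 = z \<and> (\<forall>t. (f has_real_derivative a * f t + b) (at t))"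
    and h: "h 0 = z \<and> (\<forall>t. (h has_real_derivative a * h t + b) (at t))"
  define d where "d t = (f t - h t) * exp (- a * t)" for t
  have "(d has_real_derivative 0) (at t)" for t
  proof -
    have "(d has_real_derivative
        ((a * f t + b) - (a * h t + b)) * exp (- a * t) + exp (- a * t) * (- a) * (f t - h t)) (at t)"
      unfolding d_def using f h by (auto intro!: derivative_eq_intros)
    then show ?thesis by (simp add: algebra_simps)
  qed
  then have "d t = d 0" for t
    using DERIV_isconst_all by blast
  then show "f = h" using f h by (auto simp: d_def)
qed

definition flow :: "real \<Rightarrow> real \<Rightarrow> real \<Rightarrow> real \<times> real \<Rightarrow> real \<times> real" where
  "flow lam m t \<phi> =
     (ode_solution (lam + 1) (lam * (1 - m) / sqrt 2) (fst \<phi>) t,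
      ode_solution (lam - 1) (lam * (1 + m) / sqrt 2) (snd \<phi>) t)"

definition jump_map :: "real \<Rightarrow> real \<times> real \<Rightarrow> real \<times> real" where
  "jump_map \<mu> \<phi> = ((1 - 1 / \<mu>) * fst \<phi>, (1 + 1 / \<mu>) * snd \<phi>)"

text \<open>The state at the \<open>n\<close>-th jump time of \<open>p\<close>; the left limit there is the value of
  the continuous flow.\<close>

primrec Phi_jump :: "real \<Rightarrow> real \<Rightarrow> real \<Rightarrow> (real \<Rightarrow> nat) \<Rightarrow> real \<times> real \<Rightarrow> nat \<Rightarrow> real \<times> real" where
  "Phi_jump lam \<mu> m p \<phi> 0 = \<phi>"
| "Phi_jump lam \<mu> m p \<phi> (Suc n) =
     jump_map \<mu> (flow lam m (jump_time p (Suc n) - jump_time p n) (Phi_jump lam \<mu> m p \<phi> n))"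

definition Phi :: "real \<Rightarrow> real \<Rightarrow> real \<Rightarrow> (real \<Rightarrow> nat) \<Rightarrow> real \<times> real \<Rightarrow> real \<Rightarrow> real \<times> real" where
  "Phi lam \<mu> m p \<phi> t =
     (let n = (THE n. jump_time p n \<le> t \<and> t < jump_time p (Suc n))
      in flow lam m (t - jump_time p n) (Phi_jump lam \<mu> m p \<phi> n))"


section \<open>Costs, value functions and the operators J\<close>

definition g :: "real \<Rightarrow> real \<Rightarrow> real \<times> real \<Rightarrow> real" where
  "g lam c \<phi> = fst \<phi> + snd \<phi> - lam / c * sqrt 2"

definition running_cost ::
  "real \<Rightarrow> real \<Rightarrow> real \<Rightarrow> real \<Rightarrow> (real \<Rightarrow> nat) \<Rightarrow> real \<times> real \<Rightarrow> ennreal \<Rightarrow> real" where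
  "running_cost lam \<mu> c m p \<phi> T =
     (LINT t:{t. 0 \<le> t \<and> ennreal t \<le> T}|lborel. exp (- lam * t) * g lam c (Phi lam \<mu> m p \<phi> t))"

definition V :: "'a measure \<Rightarrow> (real \<Rightarrow> 'a \<Rightarrow> nat) \<Rightarrow> real \<Rightarrow> real \<Rightarrow> real \<Rightarrow> real \<Rightarrow>
    nat \<Rightarrow> real \<times> real \<Rightarrow> real" where
  "V M N lam \<mu> c m n \<phi> =
     (INF \<tau> \<in> {\<tau>. stopping_time (augmented_filtration M N) \<tau>}.
        LINT \<omega>|M. running_cost lam \<mu> c m (\<lambda>t. N t \<omega>) \<phi>
                    (min (\<tau> \<omega>) (ennreal (jump_time (\<lambda>t. N t \<omega>) n))))"

definition J :: "'a measure \<Rightarrow> (real \<Rightarrow> 'a \<Rightarrow> nat) \<Rightarrow> real \<Rightarrow> real \<Rightarrow> real \<Rightarrow> real \<Rightarrow>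
    (real \<times> real \<Rightarrow> real) \<Rightarrow> ennreal \<Rightarrow> real \<times> real \<Rightarrow> real" where
  "J M N lam \<mu> c m w t \<phi> =
     (LINT \<omega>|M.
        (let p = (\<lambda>s. N s \<omega>); \<sigma>\<^sub>1 = jump_time p 1 in
           running_cost lam \<mu> c m p \<phi> (min t (ennreal \<sigma>\<^sub>1))
           + of_bool (t \<ge> ennreal \<sigma>\<^sub>1) * exp (- lam * \<sigma>\<^sub>1) * w (Phi lam \<mu> m p \<phi> \<sigma>\<^sub>1)))"

definition J_inf :: "'a measure \<Rightarrow> (real \<Rightarrow> 'a \<Rightarrow> nat) \<Rightarrow> real \<Rightarrow> real \<Rightarrow> real \<Rightarrow> real \<Rightarrow>
    ennreal \<Rightarrow> (real \<times> real \<Rightarrow> real) \<Rightarrow> real \<times> real \<Rightarrow> real" where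
  "J_inf M N lam \<mu> c m t w \<phi> = (INF u\<in>{t..\<infinity>}. J M N lam \<mu> c m w u \<phi>)"

primrec v :: "'a measure \<Rightarrow> (real \<Rightarrow> 'a \<Rightarrow> nat) \<Rightarrow> real \<Rightarrow> real \<Rightarrow> real \<Rightarrow> real \<Rightarrow>
    nat \<Rightarrow> real \<times> real \<Rightarrow> real" where
  "v M N lam \<mu> c m 0 = (\<lambda>\<phi>. 0)"
| "v M N lam \<mu> c m (Suc n) = J_inf M N lam \<mu> c m 0 (v M N lam \<mu> c m n)"


section \<open>The stopping rules\<close>

definition r_set :: "'a measure \<Rightarrow> (real \<Rightarrow> 'a \<Rightarrow> nat) \<Rightarrow> real \<Rightarrow> real \<Rightarrow> real \<Rightarrow> real \<Rightarrow>
    nat \<Rightarrow> real \<Rightarrow> real \<times> real \<Rightarrow> ennreal set" where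
  "r_set M N lam \<mu> c m n \<epsilon> \<phi> =
     {s \<in> {0<..\<infinity>}. J M N lam \<mu> c m (v M N lam \<mu> c m n) s \<phi>
                    \<le> J_inf M N lam \<mu> c m 0 (v M N lam \<mu> c m n) \<phi> + \<epsilon>}"

text \<open>For \<open>\<epsilon> > 0\<close> this is \<open>inf {s \<in> (0,\<infinity>]. \<dots>}\<close> with \<open>inf {} = \<infinity>\<close>.
  For \<open>\<epsilon> = 0\<close> the set is empty exactly when \<open>s = 0\<close> is the only minimizer of
  \<open>s \<mapsto> J v\<^sub>n(s, \<phi>)\<close> over \<open>[0,\<infinity>]\<close>. Then the rule must be to stop at once: with the value
  \<open>\<infinity>\<close> instead, for \<open>\<phi>\<close> so large that \<open>g > 0\<close> along the whole flow line one gets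
  \<open>r\<^sub>0\<^sup>0(\<phi>) = \<infinity>\<close> and \<open>S\<^sub>1\<^sup>0 = \<sigma>\<^sub>1\<close>, whose expected cost is positive although
  \<open>v\<^sub>1(\<phi>) = 0\<close>.\<close>

definition r :: "'a measure \<Rightarrow> (real \<Rightarrow> 'a \<Rightarrow> nat) \<Rightarrow> real \<Rightarrow> real \<Rightarrow> real \<Rightarrow> real \<Rightarrow>
    nat \<Rightarrow> real \<Rightarrow> real \<times> real \<Rightarrow> ennreal" where
  "r M N lam \<mu> c m n \<epsilon> \<phi> =
     (if \<epsilon> = 0 \<and> r_set M N lam \<mu> c m n \<epsilon> \<phi> = {} then 0
      else Inf (r_set M N lam \<mu> c m n \<epsilon> \<phi>))"

text \<open>The time \<open>S\<^sub>n\<^sup>\<epsilon>\<close> as a functional of the path \<open>p\<close> of the Poisson process and of the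
  starting point \<open>\<phi>\<close>, so that composition with the shift is evaluation at the shifted path,
  started at the state at the first jump. Indices start at 1; the value at index 0 is a
  placeholder that the recursion never reaches.\<close>

fun S :: "'a measure \<Rightarrow> (real \<Rightarrow> 'a \<Rightarrow> nat) \<Rightarrow> real \<Rightarrow> real \<Rightarrow> real \<Rightarrow> real \<Rightarrow>
    nat \<Rightarrow> real \<Rightarrow> (real \<Rightarrow> nat) \<Rightarrow> real \<times> real \<Rightarrow> ennreal" where
  "S M N lam \<mu> c m 0 \<epsilon> p \<phi> = 0"
| "S M N lam \<mu> c m (Suc 0) \<epsilon> p \<phi> = min (r M N lam \<mu> c m 0 \<epsilon> \<phi>) (ennreal (jump_time p 1))"
| "S M N lam \<mu> c m (Suc (Suc n)) \<epsilon> p \<phi> =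
     (let \<sigma>\<^sub>1 = jump_time p 1; \<rho> = r M N lam \<mu> c m (Suc n) (\<epsilon> / 2) \<phi> in
        if ennreal \<sigma>\<^sub>1 > \<rho> then \<rho>
        else ennreal \<sigma>\<^sub>1
             + S M N lam \<mu> c m (Suc n) (\<epsilon> / 2) (shift \<sigma>\<^sub>1 p) (Phi lam \<mu> m p \<phi> \<sigma>\<^sub>1))"

end

theory Submission
  imports Defs
begin

text \<open>Since \<open>\<sigma>\<^sub>1\<close> is exponential, \<open>J w(t, \<phi>)\<close> is the integral \<open>H w t \<phi>\<close> of
  \<open>e\<^sup>-\<^sup>(\<^sup>\<lambda>\<^sup>+\<^sup>\<mu>\<^sup>)\<^sup>s (g + \<mu> w \<circ> S)\<close> along the flow up to time \<open>t\<close>. It is continuous in \<open>t\<close> on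
  the compact space \<open>[0,\<infinity>]\<close>, so the infimum is attained and \<open>r\<^sub>n\<^sup>\<epsilon>\<close> itself satisfies the inequality
  that defines it. The gaps between the jumps are independent and exponential, which turns the cost
  bound for \<open>S\<^sub>n\<^sup>\<epsilon>\<close> into an induction on \<open>n\<close> by conditioning on the first gap.

  For \<open>v\<^sub>n \<le> V\<^sub>n\<close>, the cost up to time \<open>t \<and> \<sigma>\<^sub>n\<close> plus \<open>e\<^sup>-\<^sup>\<lambda>\<^sup>t v\<^sub>n\<^sub>-\<^sub>N\<^sub>t(\<Phi>\<^sub>t)\<close> on \<open>{t < \<sigma>\<^sub>n}\<close>
  is a submartingale by dynamic programming. Rounding a stopping time up to dyadic times and sampling there
  needs only the Markov property at deterministic times, and \<open>v \<le> 0\<close> lets one drop the terminal term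
  in the limit. For \<open>V\<^sub>n \<le> v\<^sub>n\<close> it remains to see that \<open>S\<^sub>n\<^sup>\<epsilon>\<close> is a stopping time: whether
  \<open>S\<^sub>n\<^sup>\<epsilon> \<le> t\<close> is decided by the jumps up to time \<open>t\<close>.\<close>

section \<open>The flow\<close>

text \<open>Two obstacles shape the proof. The costs are unbounded: the flow may grow at rate
  \<open>lam + 1\<close>, so the discounted cost rate may grow like exp(t). The integrals converge
  because a gap has the finite exponential moment \<open>\<mu> / (\<mu> - 1)\<close>; all bounds are
  linear in \<open>size\<close>, whose discounted value after one jump again has an expectation
  linear in \<open>size\<close>. Moreover, the hypotheses speak of increments over deterministic
  intervals, while the costs are recursions over random jump times. Hence two descriptions are kept:
  a sequence of gaps, where conditioning on the first entry is a product integral, and a counting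
  path, where shifting by a deterministic time gives the Markov property.
  \<open>pathcost_path\<close> translates between them. Finally, the functions are controlled on the
  quadrant only, and near-optimal times must be Borel in the starting point before the cost of the
  rule can be integrated; \<open>clip\<close> and a countable description of \<open>rset\<close>
  serve this purpose.\<close>

abbreviation expo :: "real \<Rightarrow> real measure" where
  "expo a \<equiv> density lborel (exponential_density a)"

abbreviation borel_seq :: "(nat \<Rightarrow> real) measure" where
  "borel_seq \<equiv> Pi\<^sub>M UNIV (\<lambda>_. borel)"

text \<open>The primitive of exp(a t) that vanishes at 0. The case \<open>a = 0\<close> does occur,
  since \<open>lam - 1\<close> may be 0.\<close>

definition exp_primitive :: "real \<Rightarrow> real \<Rightarrow> real" where
  "exp_primitive a t = (if a = 0 then t else (exp (a * t) - 1) / a)"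

lemma exp_primitive_DERIV: "(exp_primitive a has_real_derivative exp (a * t)) (at t)"
proof (cases "a = 0")
  case True
  then show ?thesis by (simp add: exp_primitive_def[abs_def])
next
  case False
  then show ?thesis
    by (auto simp: exp_primitive_def[abs_def] intro!: derivative_eq_intros)
qed

lemma exp_primitive_measurable [measurable]: "exp_primitive a \<in> borel_measurable borel"
  unfolding exp_primitive_def[abs_def] by (cases "a = 0") auto

lemma ode_solution_eq: "ode_solution a b z t = z * exp (a * t) + b * exp_primitive a t"
proof -
  define f where "f t = z * exp (a * t) + b * exp_primitive a t" for t
  have "f 0 = z" by (simp add: f_def exp_primitive_def)
  moreover have "(f has_real_derivative a * f t + b) (at t)" for t
  proof -
    have "(f has_real_derivative z * (exp (a * t) * a) + b * exp (a * t)) (at t)"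
      unfolding f_def[abs_def]
      by (auto intro!: derivative_eq_intros DERIV_cmult exp_primitive_DERIV)
    \<comment> \<open>This form of the primitive holds for \<open>a = 0\<close> too, so variation of
      constants needs no case distinction.\<close>
    moreover have "exp (a * t) = 1 + a * exp_primitive a t"
      by (simp add: exp_primitive_def)
    then have "z * (exp (a * t) * a) + b * exp (a * t) = a * f t + b"
      by (simp add: f_def algebra_simps)
    ultimately show ?thesis by simp
  qed
  ultimately have "ode_solution a b z = f"
    unfolding ode_solution_def
    by (intro the1_equality ode_solution_unique_exists) auto
  then show ?thesis by (simp add: f_def)
qed

lemma exp_primitive_0 [simp]: "exp_primitive a 0 = 0"
  by (simp add: exp_primitive_def)

lemma exp_primitive_add: "exp_primitive a (s + t) = exp (a * s) * exp_primitive a t + exp_primitive a s"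
  by (simp add: exp_primitive_def field_simps exp_add)

lemma exp_primitive_nonneg: "0 \<le> t \<Longrightarrow> 0 \<le> exp_primitive a t"
proof (cases "a < 0")
  case True
  assume "0 \<le> t"
  with True have "exp (a * t) \<le> 1" by (simp add: mult_nonpos_nonneg)
  with True show ?thesis by (simp add: exp_primitive_def divide_nonpos_neg)
qed (auto simp: exp_primitive_def)

text \<open>Used with \<open>a = lam + 1\<close> and \<open>a = lam - 1\<close> and the common rate
  \<open>B = lam + 1\<close>, so that both coordinates of the flow are bounded by the same
  exponential.\<close>

lemma exp_primitive_growth:
  assumes "a \<le> B" "0 < B"
  shows "\<exists>K\<ge>0. \<forall>t\<ge>0. exp_primitive a t \<le> K * exp (B * t)"
proof (cases "a = 0")
  case True
  have "t \<le> 1 / B * exp (B * t)" for t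
  proof -
    have "B * t \<le> exp (B * t)" using exp_ge_add_one_self[of "B * t"] by linarith
    then show ?thesis using assms by (simp add: field_simps)
  qed
  with True assms show ?thesis
    by (intro exI[of _ "1 / B"]) (auto simp: exp_primitive_def)
next
  case False
  have "exp_primitive a t \<le> 1 / \<bar>a\<bar> * exp (B * t)" if "0 \<le> t" for t
  proof (cases "a > 0")
    case True
    have "exp (a * t) \<le> exp (B * t)" using assms that by (simp add: mult_right_mono)
    then have "exp (a * t) - 1 \<le> exp (B * t)" by linarith
    then have "(exp (a * t) - 1) / a \<le> exp (B * t) / a"
      using True by (intro divide_right_mono) auto
    with True show ?thesis by (simp add: exp_primitive_def)
  next
    case neg: False
    have "1 \<le> exp (B * t)" using assms that by simp
    then have "1 - exp (a * t) \<le> exp (B * t)" using exp_gt_zero[of "a * t"] by linarith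
    then have "(1 - exp (a * t)) / (- a) \<le> exp (B * t) / (- a)"
      using neg False by (intro divide_right_mono) auto
    moreover have "(exp (a * t) - 1) / a = (1 - exp (a * t)) / (- a)" using False by (simp add: field_simps)
    ultimately show ?thesis using neg False by (simp add: exp_primitive_def)
  qed
  then show ?thesis by (intro exI[of _ "1 / \<bar>a\<bar>"]) auto
qed

lemma flow_eq: "flow lam m t \<phi> =
   (fst \<phi> * exp ((lam + 1) * t) + lam * (1 - m) / sqrt 2 * exp_primitive (lam + 1) t,
    snd \<phi> * exp ((lam - 1) * t) + lam * (1 + m) / sqrt 2 * exp_primitive (lam - 1) t)"
  by (simp add: flow_def ode_solution_eq)

lemma flow_0 [simp]: "flow lam m 0 \<phi> = \<phi>"
  by (simp add: flow_eq)

lemma flow_flow: "flow lam m s (flow lam m t \<phi>) = flow lam m (t + s) \<phi>"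
proof -
  have "ode_solution a b (ode_solution a b z t) s = ode_solution a b z (t + s)" for a b z
    using exp_primitive_add[of a s t]
    by (simp add: ode_solution_eq distrib_left exp_add add.commute[of t s]) (simp add: algebra_simps)
  then show ?thesis by (simp add: flow_def)
qed

lemma flow_measurable [measurable]:
  assumes [measurable]: "f \<in> borel_measurable M" "h \<in> borel_measurable M"
  shows "(\<lambda>x. flow lam m (f x) (h x)) \<in> borel_measurable M"
  unfolding flow_eq borel_prod[symmetric]
  using assms(2)[folded borel_prod] by measurable

lemma jump_map_measurable [measurable]: "jump_map \<mu> \<in> borel_measurable borel"
  unfolding jump_map_def[abs_def]
  by (auto simp: borel_prod[symmetric])

lemma g_measurable [measurable]: "g lam c \<in> borel_measurable borel"
  unfolding g_def[abs_def] by (auto simp: borel_prod[symmetric])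

lemma compact_UNIV_ennreal: "compact (UNIV :: ennreal set)"
proof -
  have "seq_compact (UNIV :: ennreal set)"
    unfolding seq_compact_def using compact_complete_linorder by (metis UNIV_I)
  then show ?thesis by (simp add: seq_compact_eq_compact)
qed

section \<open>Growth of the flow, the jump map and the cost rate on the quadrant\<close>

locale pdmp =
  fixes lam \<mu> c m :: real
  assumes lam_pos: "lam > 0" and mu_gt_1: "\<mu> > 1" and c_pos: "c > 0"
    and m_gt: "-1 < m" and m_less: "m < 1"
begin

abbreviation fl :: "real \<Rightarrow> real \<times> real \<Rightarrow> real \<times> real" where "fl \<equiv> flow lam m"
abbreviation jm :: "real \<times> real \<Rightarrow> real \<times> real" where "jm \<equiv> jump_map \<mu>"
abbreviation Quad :: "(real \<times> real) set" where "Quad \<equiv> {0..} \<times> {0..}"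

text \<open>The functions below are controlled on the quadrant only; composing with \<open>clip\<close> makes them
  Borel functions on the whole plane.\<close>

definition clip :: "real \<times> real \<Rightarrow> real \<times> real" where
  "clip \<phi> = (max 0 (fst \<phi>), max 0 (snd \<phi>))"

text \<open>The summand 1 keeps \<open>size\<close> at least 1 on the quadrant, so that additive
  constants are absorbed and every growth estimate becomes linear in \<open>size\<close>.\<close>

definition size :: "real \<times> real \<Rightarrow> real" where
  "size \<phi> = 1 + fst \<phi> + snd \<phi>"

lemma clip_measurable [measurable]: "clip \<in> borel_measurable borel"
  unfolding clip_def[abs_def] by (auto simp: borel_prod[symmetric])

lemma size_measurable [measurable]: "size \<in> borel_measurable borel"
  unfolding size_def[abs_def] by (auto simp: borel_prod[symmetric])

lemma clip_in [simp]: "clip \<phi> \<in> Quad"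
  by (auto simp: clip_def)

lemma clip_id [simp]: "\<phi> \<in> Quad \<Longrightarrow> clip \<phi> = \<phi>"
  by (auto simp: clip_def)

lemma size_ge_1: "\<phi> \<in> Quad \<Longrightarrow> 1 \<le> size \<phi>"
  by (auto simp: size_def)

lemma fl_Quad: "\<phi> \<in> Quad \<Longrightarrow> 0 \<le> t \<Longrightarrow> fl t \<phi> \<in> Quad"
  using lam_pos m_gt m_less by (auto simp: flow_eq exp_primitive_nonneg)

lemma jm_Quad: "\<phi> \<in> Quad \<Longrightarrow> jm \<phi> \<in> Quad"
  using mu_gt_1 by (auto simp: jump_map_def)

lemma size_jm: "\<phi> \<in> Quad \<Longrightarrow> size (jm \<phi>) \<le> 2 * size \<phi>"
proof -
  assume "\<phi> \<in> Quad"
  then have "0 \<le> fst \<phi>" "0 \<le> snd \<phi>" by auto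
  moreover have "(1 - 1 / \<mu>) * fst \<phi> \<le> 1 * fst \<phi>" "(1 + 1 / \<mu>) * snd \<phi> \<le> 2 * snd \<phi>"
    using mu_gt_1 calculation by (intro mult_right_mono; simp)+
  ultimately show ?thesis by (simp add: size_def jump_map_def)
qed

lemma size_fl_ex: "\<exists>K\<ge>0. \<forall>\<phi>\<in>Quad. \<forall>t\<ge>0. size (fl t \<phi>) \<le> K * exp ((lam + 1) * t) * size \<phi>"
proof -
  let ?e = "\<lambda>t. exp ((lam + 1) * t)"
  obtain K1 where K1: "K1 \<ge> 0" "\<And>t. 0 \<le> t \<Longrightarrow> exp_primitive (lam + 1) t \<le> K1 * ?e t"
    using exp_primitive_growth[of "lam + 1" "lam + 1"] lam_pos by auto
  obtain K2 where K2: "K2 \<ge> 0" "\<And>t. 0 \<le> t \<Longrightarrow> exp_primitive (lam - 1) t \<le> K2 * ?e t"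
    using exp_primitive_growth[of "lam - 1" "lam + 1"] lam_pos by auto
  define b1 where "b1 = lam * (1 - m) / sqrt 2"
  define b2 where "b2 = lam * (1 + m) / sqrt 2"
  have b: "0 \<le> b1" "0 \<le> b2" using lam_pos m_gt m_less by (auto simp: b1_def b2_def)
  let ?K = "1 + b1 * K1 + b2 * K2"
  have "size (fl t \<phi>) \<le> ?K * ?e t * size \<phi>" if \<phi>: "\<phi> \<in> Quad" and t: "0 \<le> t" for \<phi> t
  proof -
    have 1: "1 \<le> ?e t" using t lam_pos by simp
    have 2: "fst (fl t \<phi>) \<le> fst \<phi> * ?e t + b1 * (K1 * ?e t)"
      using K1(2)[OF t] b by (simp add: flow_eq b1_def[symmetric] mult_left_mono)
    have "exp ((lam - 1) * t) \<le> ?e t" using t by (simp add: mult_right_mono)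
    then have 3: "snd (fl t \<phi>) \<le> snd \<phi> * ?e t + b2 * (K2 * ?e t)"
      using K2(2)[OF t] b \<phi> by (auto simp: flow_eq b2_def[symmetric] intro!: add_mono mult_left_mono)
    have "size (fl t \<phi>) \<le> ?e t + (fst \<phi> * ?e t + b1 * (K1 * ?e t)) + (snd \<phi> * ?e t + b2 * (K2 * ?e t))"
      unfolding size_def using 1 2 3 by linarith
    also have "\<dots> = ?e t * (size \<phi> + (b1 * K1 + b2 * K2) * 1)"
      by (simp add: size_def algebra_simps)
    also have "\<dots> \<le> ?e t * (size \<phi> + (b1 * K1 + b2 * K2) * size \<phi>)"
      using size_ge_1[OF \<phi>] b K1(1) K2(1) by (intro mult_left_mono add_left_mono) auto
    finally show ?thesis by (simp add: algebra_simps)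
  qed
  moreover have "0 \<le> ?K" using b K1(1) K2(1) by auto
  ultimately show ?thesis by blast
qed

definition "Kfl = (SOME K. K \<ge> 0 \<and> (\<forall>\<phi>\<in>Quad. \<forall>t\<ge>0. size (fl t \<phi>) \<le> K * exp ((lam + 1) * t) * size \<phi>))"

lemma Kfl_nonneg: "0 \<le> Kfl" and size_fl: "\<phi> \<in> Quad \<Longrightarrow> 0 \<le> t \<Longrightarrow> size (fl t \<phi>) \<le> Kfl * exp ((lam + 1) * t) * size \<phi>"
  using someI_ex[OF size_fl_ex[unfolded Bex_def]] unfolding Kfl_def by auto

text \<open>\<open>- Gmin\<close> is the value of \<open>g\<close> at the origin, its minimum on the
  quadrant.\<close>

definition "Gmin = lam / c * sqrt 2"

lemma Gmin_pos: "Gmin > 0" using lam_pos c_pos by (simp add: Gmin_def)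

lemma g_ge: "\<phi> \<in> Quad \<Longrightarrow> - Gmin \<le> g lam c \<phi>"
  by (auto simp: g_def Gmin_def)

lemma g_abs: "\<phi> \<in> Quad \<Longrightarrow> \<bar>g lam c \<phi>\<bar> \<le> (1 + Gmin) * size \<phi>"
proof -
  assume \<phi>: "\<phi> \<in> Quad"
  then have "0 \<le> fst \<phi>" "0 \<le> snd \<phi>" by auto
  then have "\<bar>g lam c \<phi>\<bar> \<le> fst \<phi> + snd \<phi> + Gmin * 1"
    using Gmin_pos unfolding g_def Gmin_def[symmetric] by linarith
  also have "\<dots> \<le> size \<phi> + Gmin * size \<phi>"
    using size_ge_1[OF \<phi>] Gmin_pos by (intro add_mono mult_left_mono) (auto simp: size_def)
  finally show ?thesis by (simp add: algebra_simps)
qed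

definition rate :: "real \<times> real \<Rightarrow> real \<Rightarrow> real" where
  "rate \<phi> t = exp (- lam * t) * g lam c (fl t \<phi>)"

definition "Krate = (1 + Gmin) * Kfl"

lemma Krate_nonneg: "0 \<le> Krate"
  using Kfl_nonneg Gmin_pos by (simp add: Krate_def)

text \<open>The discount exp(- lam t) meets a growth of at most exp((lam + 1) t), which leaves
  exp(t). This exponent 1 is what has to be beaten by \<open>\<mu>\<close>.\<close>

lemma rate_abs: "\<phi> \<in> Quad \<Longrightarrow> 0 \<le> t \<Longrightarrow> \<bar>rate \<phi> t\<bar> \<le> Krate * size \<phi> * exp t"
proof -
  assume \<phi>: "\<phi> \<in> Quad" and t: "0 \<le> t"
  have "\<bar>g lam c (fl t \<phi>)\<bar> \<le> (1 + Gmin) * (Kfl * exp ((lam + 1) * t) * size \<phi>)"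
    using g_abs[OF fl_Quad[OF \<phi> t]] size_fl[OF \<phi> t] Gmin_pos
    by (meson add_nonneg_nonneg less_imp_le mult_left_mono order_trans zero_le_one)
  then have "\<bar>rate \<phi> t\<bar> \<le> exp (- lam * t) * ((1 + Gmin) * (Kfl * exp ((lam + 1) * t) * size \<phi>))"
    unfolding rate_def abs_mult by (intro mult_mono) auto
  also have "\<dots> = Krate * size \<phi> * (exp (- lam * t) * exp ((lam + 1) * t))"
    by (simp add: Krate_def)
  also have "exp (- lam * t) * exp ((lam + 1) * t) = exp t"
    by (simp add: exp_add[symmetric] algebra_simps)
  finally show ?thesis .
qed



lemma rate_measurable [measurable]:
  assumes [measurable]: "f \<in> borel_measurable M" "h \<in> borel_measurable M"
  shows "(\<lambda>x. rate (h x) (f x)) \<in> borel_measurable M"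
  unfolding rate_def by measurable

end

section \<open>The one-stage problem along the flow\<close>

lemma integrable_exp_decay:
  assumes "a > 0"
  shows "integrable lborel (\<lambda>s::real. indicator {0..} s * exp (- a * s))" (is "integrable _ ?f")
    and "(\<integral>s. indicator {0..} s * exp (- a * s) \<partial>lborel) = 1 / a"
proof -
  interpret prob_space "expo a"
    using assms by (rule prob_space_exponential_density)
  have "has_bochner_integral lborel (exponential_density a) 1"
    using emeasure_space_1 assms
    by (intro has_bochner_integral_nn_integral) (auto simp: emeasure_density exponential_density_nonneg)
  then have "has_bochner_integral lborel (\<lambda>s. 1 / a * exponential_density a s) (1 / a * 1)"
    by (rule has_bochner_integral_mult_right)
  moreover have "(\<lambda>s. 1 / a * exponential_density a s) = ?f"
    using assms by (auto simp: exponential_density_def fun_eq_iff mult.commute split: split_indicator)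
  ultimately have "has_bochner_integral lborel ?f (1 / a)" by simp
  then show "integrable lborel ?f" "integral\<^sup>L lborel ?f = 1 / a"
    by (auto simp: has_bochner_integral_iff)
qed

lemma exponential_measure_gt:
  assumes "0 < a" "0 \<le> t"
  shows "measure (expo a) {t<..} = exp (- a * t)"
proof -
  let ?E = "expo a"
  interpret prob_space ?E using assms(1) by (rule prob_space_exponential_density)
  have "distributed ?E lborel (\<lambda>x. x) (exponential_density a)"
    unfolding distributed_def using assms
    by (auto simp: distr_id2 exponential_density_nonneg)
  from exponential_distributedD_gt[OF this assms(2,1)] show ?thesis
    by (simp add: greaterThan_def mult.commute)
qed

text \<open>Turns an infimum over the uncountable set [0,\<infinity>] into one over a countable
  dense set, as the Borel measurability of \<open>Hinf\<close> requires.\<close>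

lemma dense_INF_eq:
  fixes h :: "'a::topological_space \<Rightarrow> real"
  assumes h: "continuous_on UNIV h" and bdd: "bdd_below (range h)"
    and D: "\<And>X. open X \<Longrightarrow> X \<noteq> {} \<Longrightarrow> \<exists>d\<in>D. d \<in> X"
  shows "(INF t\<in>D. h t) = (INF t. h t)"
proof (rule antisym)
  have ne: "D \<noteq> {}" using D[of UNIV] by auto
  have bddD: "bdd_below (h ` D)" using bdd by (rule bdd_below_mono) auto
  show "(INF t. h t) \<le> (INF t\<in>D. h t)"
    using ne bdd by (intro cINF_superset_mono) auto
  show "(INF t\<in>D. h t) \<le> (INF t. h t)"
  proof (rule cINF_greatest)
    fix t
    show "(INF t\<in>D. h t) \<le> h t"
    proof (rule field_le_epsilon)
      fix e :: real assume "0 < e"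
      have "open (h -` {..<h t + e})" using h by (intro open_vimage) auto
      moreover have "t \<in> h -` {..<h t + e}" using \<open>0 < e\<close> by auto
      ultimately obtain d where "d \<in> D" "h d < h t + e" using D by blast
      then show "(INF t\<in>D. h t) \<le> h t + e"
        using cINF_lower[OF bddD, of d] by simp
    qed
  qed simp
qed

context pdmp begin

definition flow_cost :: "real \<times> real \<Rightarrow> real \<Rightarrow> real" where
  "flow_cost \<phi> T = (\<integral>u. indicator {0..T} u * rate \<phi> u \<partial>lborel)"

lemma exp_Icc_integral: "0 \<le> T \<Longrightarrow> integrable lborel (\<lambda>u::real. indicator {0..T} u * exp u)"
  "0 \<le> T \<Longrightarrow> (\<integral>u. indicator {0..T} u * exp u \<partial>lborel) = exp T - 1"
  using has_bochner_integral_FTC_Icc_real[of 0 T exp exp]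
  by (auto simp: has_bochner_integral_iff mult.commute intro!: derivative_eq_intros DERIV_subset[OF DERIV_exp])

lemma rate_integrable:
  assumes \<phi>: "\<phi> \<in> Quad" and "0 \<le> T" "U \<subseteq> {0..T}" and [measurable]: "U \<in> sets borel"
  shows "integrable lborel (\<lambda>u. indicator U u * rate \<phi> u)"
proof (rule Bochner_Integration.integrable_bound)
  show "integrable lborel (\<lambda>u. Krate * size \<phi> * (indicator {0..T} u * exp u))"
    using assms by (intro integrable_mult_right exp_Icc_integral)
  show "AE u in lborel. norm (indicator U u * rate \<phi> u) \<le> norm (Krate * size \<phi> * (indicator {0..T} u * exp u))"
    using assms rate_abs[OF \<phi>] Krate_nonneg size_ge_1[OF \<phi>]
    by (intro AE_I2) (auto simp: abs_mult split: split_indicator)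
qed simp

lemma flow_cost_abs: "\<phi> \<in> Quad \<Longrightarrow> 0 \<le> T \<Longrightarrow> \<bar>flow_cost \<phi> T\<bar> \<le> Krate * size \<phi> * exp T"
proof -
  assume \<phi>: "\<phi> \<in> Quad" and T: "0 \<le> T"
  have "\<bar>flow_cost \<phi> T\<bar> \<le> (\<integral>u. \<bar>indicator {0..T} u * rate \<phi> u\<bar> \<partial>lborel)"
    unfolding flow_cost_def by (rule integral_abs_bound)
  also have "\<dots> \<le> (\<integral>u. Krate * size \<phi> * (indicator {0..T} u * exp u) \<partial>lborel)"
    using T rate_abs[OF \<phi>] rate_integrable[OF \<phi> T, of "{0..T}"]
    by (intro integral_mono integrable_mult_right exp_Icc_integral)
       (auto split: split_indicator)
  also have "\<dots> = Krate * size \<phi> * (exp T - 1)"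
    using T by (simp add: exp_Icc_integral)
  also have "\<dots> \<le> Krate * size \<phi> * exp T"
    using Krate_nonneg size_ge_1[OF \<phi>] by (intro mult_left_mono) auto
  finally show ?thesis .
qed

lemma flow_cost_measurable [measurable]:
  assumes [measurable]: "f \<in> borel_measurable M" "h \<in> borel_measurable M"
  shows "(\<lambda>x. flow_cost (h x) (f x)) \<in> borel_measurable M"
proof -
  have [measurable]: "(\<lambda>q. rate (fst (fst q)) (snd q)) \<in> borel_measurable
      (((borel::(real\<times>real) measure) \<Otimes>\<^sub>M (borel::real measure)) \<Otimes>\<^sub>M lborel)"
    by (intro rate_measurable) simp_all
  have "(\<lambda>p. \<integral>u. (if 0 \<le> u \<and> u \<le> snd p then rate (fst p) u else 0) \<partial>lborel) \<in>
    borel_measurable ((borel::(real\<times>real) measure) \<Otimes>\<^sub>M (borel::real measure))"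
    by measurable
  from measurable_compose[OF _ this, of "\<lambda>x. (h x, f x)"]
  have "(\<lambda>x. \<integral>u. (if 0 \<le> u \<and> u \<le> f x then rate (h x) u else 0) \<partial>lborel) \<in> borel_measurable M"
    by simp
  also have "(\<lambda>x. \<integral>u. (if 0 \<le> u \<and> u \<le> f x then rate (h x) u else 0) \<partial>lborel) = (\<lambda>x. flow_cost (h x) (f x))"
    unfolding flow_cost_def by (intro ext Bochner_Integration.integral_cong) (auto split: split_indicator)
  finally show ?thesis .
qed

lemma flow_cost_0 [simp]: "flow_cost \<phi> 0 = 0"
proof -
  have "(\<lambda>u. indicator {0..0} u * rate \<phi> u) = (\<lambda>u. indicator {0} u * rate \<phi> 0)"
    by (auto split: split_indicator)
  then show ?thesis by (simp add: flow_cost_def)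
qed

text \<open>The loss from paying the least possible rate \<open>- Gmin\<close> for ever, discounted
  at \<open>lam\<close>; hence a universal lower bound for the value functions.\<close>

definition Lmin :: real where "Lmin = Gmin / lam"

text \<open>The invariant class of the value iteration: it contains 0 and is stable under
  \<open>Hinf\<close>. The bounds give integrability, and the upper bound 0 is what later allows the
  terminal payoff to be discarded.\<close>

definition admissible :: "(real \<times> real \<Rightarrow> real) \<Rightarrow> bool" where
  "admissible w \<longleftrightarrow> (\<forall>\<phi>\<in>Quad. - Lmin \<le> w \<phi> \<and> w \<phi> \<le> 0) \<and> (\<lambda>\<phi>. w (clip \<phi>)) \<in> borel_measurable borel"

lemma admissible_measurable: "admissible w \<Longrightarrow> (\<lambda>\<phi>. w (clip \<phi>)) \<in> borel_measurable borel"
  by (simp add: admissible_def)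

lemma admissible_bounds: "admissible w \<Longrightarrow> \<phi> \<in> Quad \<Longrightarrow> - Lmin \<le> w \<phi>" "admissible w \<Longrightarrow> \<phi> \<in> Quad \<Longrightarrow> w \<phi> \<le> 0"
  unfolding admissible_def by blast+

lemma Lmin_pos: "0 < Lmin" using Gmin_pos lam_pos by (simp add: Lmin_def)

text \<open>Being still before the first jump at time s contributes the survival probability exp(-
  \<mu> s) to the running cost. A jump there has density \<mu> exp(- \<mu> s) and pays
  \<open>w\<close> at the state behind the jump.\<close>

definition H_rate :: "(real \<times> real \<Rightarrow> real) \<Rightarrow> real \<times> real \<Rightarrow> real \<Rightarrow> real" where
  "H_rate w \<phi> s = exp (- (lam + \<mu>) * s) * (g lam c (fl s \<phi>) + \<mu> * w (jm (fl s \<phi>)))"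

definition H :: "(real \<times> real \<Rightarrow> real) \<Rightarrow> ennreal \<Rightarrow> real \<times> real \<Rightarrow> real" where
  "H w t \<phi> = (\<integral>s. indicator {s. 0 \<le> s \<and> ennreal s \<le> t} s * H_rate w \<phi> s \<partial>lborel)"

lemma H_rate_eq: "H_rate w \<phi> s = exp (- \<mu> * s) * rate \<phi> s + \<mu> * w (jm (fl s \<phi>)) * exp (- (lam + \<mu>) * s)"
proof -
  have "exp (- (lam + \<mu>) * s) = exp (- \<mu> * s) * exp (- lam * s)"
    by (simp add: exp_add[symmetric] algebra_simps)
  then show ?thesis
    unfolding H_rate_def rate_def by (simp only: distrib_left mult_ac)
qed

lemma H_rate_measurable:
  assumes [measurable]: "w \<in> borel_measurable borel" "f \<in> borel_measurable M" "h \<in> borel_measurable M"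
  shows "(\<lambda>x. H_rate w (h x) (f x)) \<in> borel_measurable M"
  unfolding H_rate_def by measurable

lemma H_rate_clip: "\<phi> \<in> Quad \<Longrightarrow> 0 \<le> s \<Longrightarrow> H_rate (\<lambda>\<psi>. w (clip \<psi>)) \<phi> s = H_rate w \<phi> s"
  by (simp add: H_rate_def jm_Quad fl_Quad)

lemma H_rate_measurable_indicator:
  assumes w: "admissible w" and \<phi>: "\<phi> \<in> Quad" and [measurable]: "U \<in> sets borel" and U: "U \<subseteq> {0..}"
  shows "(\<lambda>s. indicator U s * H_rate w \<phi> s) \<in> borel_measurable lborel"
proof -
  have "(\<lambda>s. indicator U s * H_rate w \<phi> s) = (\<lambda>s. indicator U s * H_rate (\<lambda>\<psi>. w (clip \<psi>)) \<phi> s)"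
    using H_rate_clip[OF \<phi>] U by (auto simp: fun_eq_iff split: split_indicator)
  moreover have "\<dots> \<in> borel_measurable lborel"
    using H_rate_measurable[OF admissible_measurable[OF w], of "\<lambda>s. s" borel "\<lambda>_. \<phi>"] by simp
  ultimately show ?thesis by simp
qed

text \<open>A majorant that does not depend on the time horizon, so that dominated convergence also
  covers the horizon \<infinity>. Its first term decays because \<open>\<mu> > 1\<close>.\<close>

definition H_dom :: "real \<times> real \<Rightarrow> real \<Rightarrow> real" where
  "H_dom \<phi> s = Krate * size \<phi> * (indicator {0..} s * exp (- (\<mu> - 1) * s)) + \<mu> * Lmin * (indicator {0..} s * exp (- (lam + \<mu>) * s))"

lemma H_dom_integrable: "integrable lborel (H_dom \<phi>)"
  unfolding H_dom_def[abs_def] using mu_gt_1 lam_pos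
  by (intro Bochner_Integration.integrable_add integrable_mult_right integrable_exp_decay) auto

lemma H_rate_abs:
  assumes w: "admissible w" and \<phi>: "\<phi> \<in> Quad" and s: "0 \<le> s"
  shows "\<bar>H_rate w \<phi> s\<bar> \<le> H_dom \<phi> s"
proof -
  let ?\<psi> = "jm (fl s \<phi>)"
  have "?\<psi> \<in> Quad" using \<phi> s by (simp add: jm_Quad fl_Quad)
  then have w': "\<bar>w ?\<psi>\<bar> \<le> Lmin" using admissible_bounds[OF w] by fastforce
  have "\<bar>H_rate w \<phi> s\<bar> \<le> exp (- \<mu> * s) * \<bar>rate \<phi> s\<bar> + \<mu> * \<bar>w ?\<psi>\<bar> * exp (- (lam + \<mu>) * s)"
    using mu_gt_1 by (auto simp: H_rate_eq abs_mult intro: order_trans[OF abs_triangle_ineq])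
  also have "\<dots> \<le> exp (- \<mu> * s) * (Krate * size \<phi> * exp s) + \<mu> * Lmin * exp (- (lam + \<mu>) * s)"
    using rate_abs[OF \<phi> s] w' mu_gt_1 by (intro add_mono mult_left_mono mult_right_mono) auto
  also have "exp (- \<mu> * s) * (Krate * size \<phi> * exp s) = Krate * size \<phi> * (exp (- \<mu> * s) * exp s)" by simp
  also have "exp (- \<mu> * s) * exp s = exp (- (\<mu> - 1) * s)"
    by (simp add: exp_add[symmetric] algebra_simps)
  finally show ?thesis using s by (simp add: H_dom_def)
qed

lemma H_rate_integrable:
  assumes w: "admissible w" and \<phi>: "\<phi> \<in> Quad" and U: "U \<in> sets borel" "U \<subseteq> {0..}"
  shows "integrable lborel (\<lambda>s. indicator U s * H_rate w \<phi> s)"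
proof (rule Bochner_Integration.integrable_bound[OF H_dom_integrable[of \<phi>]])
  show "AE s in lborel. norm (indicator U s * H_rate w \<phi> s) \<le> norm (H_dom \<phi> s)"
  proof (intro AE_I2)
    fix s
    show "norm (indicator U s * H_rate w \<phi> s) \<le> norm (H_dom \<phi> s)"
      using H_rate_abs[OF w \<phi>, of s] U(2) by (auto split: split_indicator simp: subset_eq)
  qed
qed (rule H_rate_measurable_indicator[OF assms])

lemma upto_ennreal_borel [measurable]: "{s::real. 0 \<le> s \<and> ennreal s \<le> t} \<in> sets borel"
  by measurable

lemma H_tendsto:
  assumes w: "admissible w" and \<phi>: "\<phi> \<in> Quad" and X: "X \<longlonglongrightarrow> t"
  shows "(\<lambda>n. H w (X n) \<phi>) \<longlonglongrightarrow> H w t \<phi>"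
  unfolding H_def
proof (rule integral_dominated_convergence[where w="H_dom \<phi>"])
  show "AE s in lborel. (\<lambda>n. indicator {s. 0 \<le> s \<and> ennreal s \<le> X n} s * H_rate w \<phi> s)
      \<longlonglongrightarrow> indicator {s. 0 \<le> s \<and> ennreal s \<le> t} s * H_rate w \<phi> s"
    \<comment> \<open>The indicators can fail to converge only at \<open>s = t\<close>. For
      \<open>t = \<infinity>\<close> the excluded point is 0, which does no harm.\<close>
    using AE_lborel_singleton[of "enn2real t"]
  proof eventually_elim
    case (elim s)
    show ?case
    proof (rule tendsto_eventually)
      consider "s < 0" | "0 \<le> s" "ennreal s < t" | "0 \<le> s" "t < ennreal s"
        using elim by (metis enn2real_ennreal linorder_cases not_le)
      then show "\<forall>\<^sub>F n in sequentially. indicator {s. 0 \<le> s \<and> ennreal s \<le> X n} s * H_rate w \<phi> s =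
          indicator {s. 0 \<le> s \<and> ennreal s \<le> t} s * H_rate w \<phi> s"
      proof cases
        case 2
        from order_tendstoD(1)[OF X 2(2)] show ?thesis
          by eventually_elim (use 2 in \<open>auto split: split_indicator\<close>)
      next
        case 3
        from order_tendstoD(2)[OF X 3(2)] show ?thesis
          by eventually_elim (use 3 in \<open>auto split: split_indicator\<close>)
      qed auto
    qed
  qed
  show "AE s in lborel. norm (indicator {s. 0 \<le> s \<and> ennreal s \<le> X n} s * H_rate w \<phi> s) \<le> H_dom \<phi> s" for n
  proof (intro AE_I2)
    fix s
    have "0 \<le> H_dom \<phi> s"
      using Krate_nonneg size_ge_1[OF \<phi>] mu_gt_1 Lmin_pos by (simp add: H_dom_def)
    then show "norm (indicator {s. 0 \<le> s \<and> ennreal s \<le> X n} s * H_rate w \<phi> s) \<le> H_dom \<phi> s"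
      using H_rate_abs[OF w \<phi>, of s] by (auto split: split_indicator)
  qed
  show "(\<lambda>s. indicator {s. 0 \<le> s \<and> ennreal s \<le> u} s * H_rate w \<phi> s) \<in> borel_measurable lborel" for u
    by (rule H_rate_measurable_indicator[OF w \<phi>]) auto
  then show "(\<lambda>s. indicator {s. 0 \<le> s \<and> ennreal s \<le> X n} s * H_rate w \<phi> s) \<in> borel_measurable lborel" for n .
qed (rule H_dom_integrable)

lemma H_continuous:
  assumes w: "admissible w" and \<phi>: "\<phi> \<in> Quad"
  shows "continuous_on UNIV (\<lambda>t. H w t \<phi>)"
  unfolding continuous_on_def tendsto_at_iff_sequentially comp_def
  using H_tendsto[OF w \<phi>] by auto

lemma H_0 [simp]: "H w 0 \<phi> = 0"
proof -
  have "{s. 0 \<le> s \<and> ennreal s \<le> 0} = {0}" by auto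
  moreover have "(\<lambda>u. indicator {0} u * H_rate w \<phi> u) = (\<lambda>u. indicator {0} u * H_rate w \<phi> 0)"
    by (auto split: split_indicator)
  ultimately show ?thesis by (simp add: H_def)
qed

text \<open>After waiting for time h without a jump the problem restarts from
  \<open>fl h \<phi>\<close>, weighted by discount times survival probability. Analytically it is
  the substitution s = h + s' on the part of the integral beyond h.\<close>

lemma H_add:
  assumes w: "admissible w" and \<phi>: "\<phi> \<in> Quad" and h: "0 \<le> h"
  shows "H w (ennreal h + u) \<phi> = H w (ennreal h) \<phi> + exp (- (lam + \<mu>) * h) * H w u (fl h \<phi>)"
proof -
  let ?A = "{s. 0 \<le> s \<and> ennreal s \<le> ennreal h}"
  define B where "B = {s. h < s \<and> ennreal s \<le> ennreal h + u}"
  have B: "B \<in> sets borel" unfolding B_def by measurable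
  have B0: "B \<subseteq> {0..}" using h unfolding B_def by fastforce
  have B_iff: "h + s \<in> B \<longleftrightarrow> 0 < s \<and> ennreal s \<le> u" for s
    unfolding B_def using h by (cases "0 < s") (simp_all add: ennreal_plus)
  have "{s. 0 \<le> s \<and> ennreal s \<le> ennreal h + u} = ?A \<union> B"
    using h unfolding B_def by (auto simp: ennreal_le_iff add_increasing2)
  moreover have "?A \<inter> B = {}" using h unfolding B_def by auto
  ultimately have "H w (ennreal h + u) \<phi> = (\<integral>s. indicator ?A s * H_rate w \<phi> s + indicator B s * H_rate w \<phi> s \<partial>lborel)"
    unfolding H_def by (intro Bochner_Integration.integral_cong) (auto split: split_indicator)
  also have "\<dots> = H w (ennreal h) \<phi> + (\<integral>s. indicator B s * H_rate w \<phi> s \<partial>lborel)"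
    unfolding H_def by (intro Bochner_Integration.integral_add H_rate_integrable w \<phi> B B0) auto
  also have "(\<integral>s. indicator B s * H_rate w \<phi> s \<partial>lborel) = (\<integral>s. indicator B (h + s) * H_rate w \<phi> (h + s) \<partial>lborel)"
    using lborel_integral_real_affine[of 1 "\<lambda>s. indicator B s * H_rate w \<phi> s" h] by simp
  also have "\<dots> = (\<integral>s. exp (- (lam + \<mu>) * h) * (indicator {s. 0 \<le> s \<and> ennreal s \<le> u} s * H_rate w (fl h \<phi>) s) \<partial>lborel)"
  proof (rule integral_cong_AE)
    have "(\<lambda>s. indicator B s * H_rate w \<phi> s) \<in> borel_measurable borel"
      using H_rate_measurable_indicator[OF w \<phi> B B0] by simp
    from measurable_compose[OF _ this, of "\<lambda>s. h + s" lborel]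
    show "(\<lambda>s. indicator B (h + s) * H_rate w \<phi> (h + s)) \<in> borel_measurable lborel" by simp
    show "(\<lambda>s. exp (- (lam + \<mu>) * h) * (indicator {s. 0 \<le> s \<and> ennreal s \<le> u} s * H_rate w (fl h \<phi>) s)) \<in> borel_measurable lborel"
      by (intro borel_measurable_times H_rate_measurable_indicator w fl_Quad \<phi> h) auto
    have hh: "H_rate w \<phi> (h + s) = exp (- (lam + \<mu>) * h) * H_rate w (fl h \<phi>) s" for s
    proof -
      have "exp (- (lam + \<mu>) * (h + s)) = exp (- (lam + \<mu>) * h) * exp (- (lam + \<mu>) * s)"
        by (simp only: exp_add[symmetric] distrib_left)
      then show ?thesis by (simp add: H_rate_def flow_flow)
    qed
    show "AE s in lborel. indicator B (h + s) * H_rate w \<phi> (h + s) =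
       exp (- (lam + \<mu>) * h) * (indicator {s. 0 \<le> s \<and> ennreal s \<le> u} s * H_rate w (fl h \<phi>) s)"
      using AE_lborel_singleton[of "0::real"]
      by eventually_elim (simp add: indicator_def B_iff hh)
  qed
  also have "\<dots> = exp (- (lam + \<mu>) * h) * H w u (fl h \<phi>)"
    unfolding H_def by simp
  finally show ?thesis .
qed

text \<open>The constant \<open>- Lmin\<close> reproduces itself: since
  \<open>Gmin = lam * Lmin\<close>, the integrand is at least \<open>- (lam + \<mu>) * Lmin\<close>
  times exp(- (lam + \<mu>) s), and this integrates to \<open>- Lmin\<close> over the half-line.
  Stopping earlier only drops negative mass of this minorant.\<close>

lemma H_ge:
  assumes w: "admissible w" and \<phi>: "\<phi> \<in> Quad"
  shows "- Lmin \<le> H w t \<phi>"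
proof -
  let ?U = "{s. 0 \<le> s \<and> ennreal s \<le> t}" and ?a = "lam + \<mu>"
  have a: "?a > 0" using lam_pos mu_gt_1 by simp
  have "- Lmin = (\<integral>s. - (?a * Lmin) * (indicator {0..} s * exp (- ?a * s)) \<partial>lborel)"
    using integrable_exp_decay[OF a] a by simp
  also have "\<dots> \<le> H w t \<phi>"
    unfolding H_def
  proof (rule integral_mono)
    show "integrable lborel (\<lambda>s. indicator ?U s * H_rate w \<phi> s)"
      by (intro H_rate_integrable w \<phi>) auto
    show "integrable lborel (\<lambda>s. - (?a * Lmin) * (indicator {0..} s * exp (- ?a * s)))"
      by (intro integrable_mult_right integrable_exp_decay a)
    fix s
    show "- (?a * Lmin) * (indicator {0..} s * exp (- ?a * s)) \<le> indicator ?U s * H_rate w \<phi> s"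
    proof (cases "s \<in> ?U")
      case True
      then have s: "0 \<le> s" by simp
      have "- Lmin \<le> w (jm (fl s \<phi>))" by (intro admissible_bounds(1)[OF w] jm_Quad fl_Quad \<phi> s)
      then have "\<mu> * - Lmin \<le> \<mu> * w (jm (fl s \<phi>))" using mu_gt_1 by (intro mult_left_mono) auto
      then have "- Gmin - \<mu> * Lmin \<le> g lam c (fl s \<phi>) + \<mu> * w (jm (fl s \<phi>))"
        using g_ge[OF fl_Quad[OF \<phi> s]] by simp
      moreover have "- Gmin - \<mu> * Lmin = - (?a * Lmin)" using lam_pos by (simp add: Lmin_def field_simps)
      ultimately have "exp (- ?a * s) * - (?a * Lmin) \<le> H_rate w \<phi> s"
        unfolding H_rate_def by (intro mult_left_mono) auto
      then show ?thesis using True s by (simp add: mult.commute)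
    next
      case False
      then show ?thesis using a Lmin_pos by (auto split: split_indicator)
    qed
  qed
  finally show ?thesis .
qed

section \<open>Optimal waiting time: attainment, near-optimal times, measurability\<close>

definition Hinf :: "(real \<times> real \<Rightarrow> real) \<Rightarrow> real \<times> real \<Rightarrow> real" where
  "Hinf w \<phi> = (INF t. H w t \<phi>)"

lemma bdd_H: "admissible w \<Longrightarrow> \<phi> \<in> Quad \<Longrightarrow> bdd_below (range (\<lambda>t. H w t \<phi>))"
  using H_ge by (intro bdd_belowI2[where m="- Lmin"]) auto

lemma Hinf_le: "admissible w \<Longrightarrow> \<phi> \<in> Quad \<Longrightarrow> Hinf w \<phi> \<le> H w t \<phi>"
  unfolding Hinf_def by (intro cINF_lower bdd_H) auto

lemma Hinf_bounds: "admissible w \<Longrightarrow> \<phi> \<in> Quad \<Longrightarrow> - Lmin \<le> Hinf w \<phi>" "admissible w \<Longrightarrow> \<phi> \<in> Quad \<Longrightarrow> Hinf w \<phi> \<le> 0"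
  using Hinf_le[of w \<phi> 0] H_ge by (auto simp: Hinf_def intro!: cINF_greatest)

lemma Hinf_attained: "admissible w \<Longrightarrow> \<phi> \<in> Quad \<Longrightarrow> \<exists>t. H w t \<phi> = Hinf w \<phi>"
proof -
  assume w: "admissible w" and \<phi>: "\<phi> \<in> Quad"
  obtain t where "\<And>u. H w t \<phi> \<le> H w u \<phi>"
    using continuous_attains_inf[OF compact_UNIV_ennreal _ H_continuous[OF w \<phi>]] by auto
  then have "H w t \<phi> \<le> Hinf w \<phi>" unfolding Hinf_def by (intro cINF_greatest) auto
  with Hinf_le[OF w \<phi>, of t] show ?thesis by (auto intro: antisym)
qed

lemma H_clip_measurable:
  assumes w: "admissible w"
  shows "(\<lambda>\<phi>. H w t (clip \<phi>)) \<in> borel_measurable borel"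
proof -
  note [measurable] = H_rate_measurable[OF admissible_measurable[OF w]]
  have "(\<lambda>\<phi>. \<integral>s. indicator {s. 0 \<le> s \<and> ennreal s \<le> t} s * H_rate (\<lambda>\<psi>. w (clip \<psi>)) (clip \<phi>) s \<partial>lborel) \<in> borel_measurable borel"
    by measurable
  also have "(\<lambda>\<phi>. \<integral>s. indicator {s. 0 \<le> s \<and> ennreal s \<le> t} s * H_rate (\<lambda>\<psi>. w (clip \<psi>)) (clip \<phi>) s \<partial>lborel) = (\<lambda>\<phi>. H w t (clip \<phi>))"
    unfolding H_def
    by (intro ext Bochner_Integration.integral_cong) (auto simp: H_rate_clip split: split_indicator)
  finally show ?thesis .
qed

lemma Hinf_clip_measurable:
  assumes w: "admissible w"
  shows "(\<lambda>\<phi>. Hinf w (clip \<phi>)) \<in> borel_measurable borel"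
proof -
  obtain D :: "ennreal set" where D: "countable D" "\<And>X. open X \<Longrightarrow> X \<noteq> {} \<Longrightarrow> \<exists>d\<in>D. d \<in> X"
    using countable_dense_exists by blast
  have "(\<lambda>\<phi>. INF t\<in>D. H w t (clip \<phi>)) \<in> borel_measurable borel"
    using D(1) H_clip_measurable[OF w] by (intro borel_measurable_cINF_real) auto
  also have "(\<lambda>\<phi>. INF t\<in>D. H w t (clip \<phi>)) = (\<lambda>\<phi>. Hinf w (clip \<phi>))"
    unfolding Hinf_def by (intro ext dense_INF_eq H_continuous bdd_H w D(2)) auto
  finally show ?thesis .
qed

lemma admissible_Hinf: "admissible w \<Longrightarrow> admissible (Hinf w)"
  using Hinf_bounds[of w] Hinf_clip_measurable[of w] by (auto simp: admissible_def)

lemma admissible_0: "admissible (\<lambda>_. 0)"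
  using Lmin_pos by (simp add: admissible_def)

definition rset :: "(real \<times> real \<Rightarrow> real) \<Rightarrow> real \<Rightarrow> real \<times> real \<Rightarrow> ennreal set" where
  "rset w \<epsilon> \<phi> = {s \<in> {0<..\<infinity>}. H w s \<phi> \<le> Hinf w \<phi> + \<epsilon>}"

definition opt_time :: "(real \<times> real \<Rightarrow> real) \<Rightarrow> real \<Rightarrow> real \<times> real \<Rightarrow> ennreal" where
  "opt_time w \<epsilon> \<phi> = (if \<epsilon> = 0 \<and> rset w \<epsilon> \<phi> = {} then 0 else Inf (rset w \<epsilon> \<phi>))"

text \<open>A nonempty \<open>rset\<close> has its infimum as a limit of members, and the inequality
  survives the limit by continuity. An empty one forces the minimizer to be 0; then \<epsilon> > 0
  is excluded, because continuity at 0 would put small positive times into the set, and for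
  \<epsilon> = 0 the convention of \<open>opt_time\<close> returns exactly that minimizer.\<close>

lemma H_opt_time_le:
  assumes w: "admissible w" and \<phi>: "\<phi> \<in> Quad" and \<epsilon>: "0 \<le> \<epsilon>"
  shows "H w (opt_time w \<epsilon> \<phi>) \<phi> \<le> Hinf w \<phi> + \<epsilon>"
proof -
  note cont = H_continuous[OF w \<phi>]
  obtain t where t: "H w t \<phi> = Hinf w \<phi>" using Hinf_attained[OF w \<phi>] ..
  show ?thesis
  proof (cases "rset w \<epsilon> \<phi> = {}")
    case True
    have "\<not> 0 < t"
    proof
      assume "0 < t"
      with t \<epsilon> have "t \<in> rset w \<epsilon> \<phi>" by (simp add: rset_def)
      with True show False by simp
    qed
    then have t0: "t = 0" by (simp add: zero_less_iff_neq_zero)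
    have "\<epsilon> = 0"
    proof (rule ccontr)
      assume "\<epsilon> \<noteq> 0"
      then have *: "open ((\<lambda>t. H w t \<phi>) -` {..<Hinf w \<phi> + \<epsilon>})" "0 \<in> (\<lambda>t. H w t \<phi>) -` {..<Hinf w \<phi> + \<epsilon>}"
        using t t0 \<epsilon> by (auto intro!: open_vimage cont)
      obtain b where b: "0 < b" "{0..<b} \<subseteq> (\<lambda>t. H w t \<phi>) -` {..<Hinf w \<phi> + \<epsilon>}"
        using open_right[OF * zero_less_one] by blast
      obtain d where "0 < d" "d < b" using dense[OF b(1)] by auto
      then have "d \<in> rset w \<epsilon> \<phi>" using b(2) by (auto simp: rset_def intro: less_imp_le)
      with True show False by simp
    qed
    with True t t0 show ?thesis by (simp add: opt_time_def)
  next
    case False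
    then obtain u where u: "\<And>n. u n \<in> rset w \<epsilon> \<phi>" "u \<longlonglongrightarrow> Inf (rset w \<epsilon> \<phi>)"
      using Inf_as_limit by blast
    have "H w (Inf (rset w \<epsilon> \<phi>)) \<phi> \<le> Hinf w \<phi> + \<epsilon>"
      using u(1) by (intro LIMSEQ_le_const2[OF H_tendsto[OF w \<phi> u(2)]]) (auto simp: rset_def)
    with False show ?thesis by (simp add: opt_time_def)
  qed
qed

text \<open>Expresses the condition by countably many inequalities between Borel functions of
  \<phi>. On a compact interval from a to b the continuous \<open>H\<close> attains its minimum, so
  the existence of a point at or below the level is equivalent to the existence of approximate ones
  in the dense set \<open>D\<close>; \<open>a > 0\<close> keeps the point away from the excluded
  time 0.\<close>

lemma rset_less_iff:
  assumes w: "admissible w" and \<phi>: "\<phi> \<in> Quad"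
    and D: "\<And>X. open X \<Longrightarrow> X \<noteq> {} \<Longrightarrow> \<exists>d\<in>D. d \<in> (X::ennreal set)"
  shows "(\<exists>s\<in>rset w \<epsilon> \<phi>. s < y) \<longleftrightarrow>
    (\<exists>a\<in>D. \<exists>b\<in>D. 0 < a \<and> b < y \<and> (\<forall>k::nat. \<exists>d\<in>D. a \<le> d \<and> d \<le> b \<and> H w d \<phi> < Hinf w \<phi> + \<epsilon> + 1 / Suc k))"
    (is "?L \<longleftrightarrow> ?R")
proof
  note cont = H_continuous[OF w \<phi>]
  {
    assume ?L
    then obtain s where s: "0 < s" "s < y" "H w s \<phi> \<le> Hinf w \<phi> + \<epsilon>" by (auto simp: rset_def)
    have "{0<..<s} \<noteq> {}" "{s<..<y} \<noteq> {}" using s dense by fastforce+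
    then obtain a b where ab: "a \<in> D" "b \<in> D" "0 < a" "a < s" "s < b" "b < y"
      using D[of "{0<..<s}"] D[of "{s<..<y}"] by auto
    have "\<exists>d\<in>D. a \<le> d \<and> d \<le> b \<and> H w d \<phi> < Hinf w \<phi> + \<epsilon> + 1 / Suc k" for k :: nat
    proof -
      let ?X = "{a<..<b} \<inter> (\<lambda>t. H w t \<phi>) -` {..<Hinf w \<phi> + \<epsilon> + 1 / Suc k}"
      have "open ?X" by (intro open_Int open_vimage cont) auto
      moreover have "s \<in> ?X" using s ab by (auto intro: le_less_trans)
      ultimately obtain d where "d \<in> D" "d \<in> ?X" using D[of ?X] by blast
      then show ?thesis by (intro bexI[of _ d]) auto
    qed
    with ab show ?R by blast
  next
    assume ?R
    then obtain a b where ab: "0 < a" "b < y"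
      and *: "\<And>k::nat. \<exists>d\<in>D. a \<le> d \<and> d \<le> b \<and> H w d \<phi> < Hinf w \<phi> + \<epsilon> + 1 / Suc k" by blast
    have "a \<le> b" using *[of 0] by auto
    have "compact {a..b}"
      using compact_UNIV_ennreal by (metis closed_atLeastAtMost compact_Int_closed Int_UNIV_left)
    then obtain s where s: "s \<in> {a..b}" "\<And>t. t \<in> {a..b} \<Longrightarrow> H w s \<phi> \<le> H w t \<phi>"
      using continuous_attains_inf[of "{a..b}" "\<lambda>t. H w t \<phi>"] \<open>a \<le> b\<close> continuous_on_subset[OF cont] by auto
    have "H w s \<phi> \<le> Hinf w \<phi> + \<epsilon>"
    proof (rule field_le_epsilon)
      fix e :: real assume "0 < e"
      then obtain k where "1 / Suc k < e" using nat_approx_posE by blast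
      with *[of k] s(2) show "H w s \<phi> \<le> Hinf w \<phi> + \<epsilon> + e" by fastforce
    qed
    with s(1) ab show ?L
      by (intro bexI[of _ s]) (auto simp: rset_def)
  }
qed

lemma opt_time_clip_measurable:
  assumes w: "admissible w"
  shows "(\<lambda>\<phi>. opt_time w \<epsilon> (clip \<phi>)) \<in> borel_measurable borel"
proof -
  obtain D :: "ennreal set" where D: "countable D" "\<And>X. open X \<Longrightarrow> X \<noteq> {} \<Longrightarrow> \<exists>d\<in>D. d \<in> X"
    using countable_dense_exists by blast
  note [measurable] = H_clip_measurable[OF w] Hinf_clip_measurable[OF w]
  define d where "d = from_nat_into D"
  have "D \<noteq> {}" using D(2)[of UNIV] by auto
  then have D_eq: "D = range d"
    using D(1) by (simp add: d_def range_from_nat_into)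
  have [measurable]: "(\<lambda>\<phi>. Inf (rset w \<epsilon> (clip \<phi>))) \<in> borel_measurable borel"
  proof (rule borel_measurableI_less)
    fix y
    have "{\<phi> \<in> space borel. Inf (rset w \<epsilon> (clip \<phi>)) < y} = {\<phi> \<in> space borel. \<exists>a\<in>D. \<exists>b\<in>D. 0 < a \<and> b < y \<and>
       (\<forall>k::nat. \<exists>d\<in>D. a \<le> d \<and> d \<le> b \<and> H w d (clip \<phi>) < Hinf w (clip \<phi>) + \<epsilon> + 1 / Suc k)}"
      unfolding Inf_less_iff by (subst rset_less_iff[OF w _ D(2)]) auto
    also have "\<dots> \<in> sets borel"
      unfolding D_eq bex_simps by measurable
    finally show "{\<phi> \<in> space borel. Inf (rset w \<epsilon> (clip \<phi>)) < y} \<in> sets borel" .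
  qed
  \<comment> \<open>The infimum is \<infinity> both for the empty set and for the set that contains
    only \<infinity>; evaluating \<open>H\<close> at \<infinity> tells the two apart, so that
    emptiness becomes a measurable condition.\<close>
  have "rset w \<epsilon> \<phi> = {} \<longleftrightarrow> Inf (rset w \<epsilon> \<phi>) = \<infinity> \<and> \<not> H w \<infinity> \<phi> \<le> Hinf w \<phi> + \<epsilon>" if "\<phi> \<in> Quad" for \<phi>
  proof
    assume "Inf (rset w \<epsilon> \<phi>) = \<infinity> \<and> \<not> H w \<infinity> \<phi> \<le> Hinf w \<phi> + \<epsilon>"
    moreover have "s = \<infinity>" if "s \<in> rset w \<epsilon> \<phi>" "Inf (rset w \<epsilon> \<phi>) = \<infinity>" for s
      using that Inf_lower[of s "rset w \<epsilon> \<phi>"] by (simp add: top_unique infinity_ennreal_def)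
    moreover have "H w s \<phi> \<le> Hinf w \<phi> + \<epsilon>" if "s \<in> rset w \<epsilon> \<phi>" for s
      using that by (simp add: rset_def)
    ultimately show "rset w \<epsilon> \<phi> = {}" by (metis ex_in_conv)
  next
    assume e: "rset w \<epsilon> \<phi> = {}"
    have "\<infinity> \<notin> rset w \<epsilon> \<phi>" by (simp only: e empty_iff simp_thms)
    then have "\<not> H w \<infinity> \<phi> \<le> Hinf w \<phi> + \<epsilon>" by (auto simp: rset_def)
    moreover have "Inf (rset w \<epsilon> \<phi>) = \<infinity>" by (simp only: e Inf_empty infinity_ennreal_def)
    ultimately show "Inf (rset w \<epsilon> \<phi>) = \<infinity> \<and> \<not> H w \<infinity> \<phi> \<le> Hinf w \<phi> + \<epsilon>" by blast
  qed
  then have "(\<lambda>\<phi>. opt_time w \<epsilon> (clip \<phi>)) = (\<lambda>\<phi>. if \<epsilon> = 0 \<and> Inf (rset w \<epsilon> (clip \<phi>)) = \<infinity> \<and>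
      \<not> H w \<infinity> (clip \<phi>) \<le> Hinf w (clip \<phi>) + \<epsilon> then 0 else Inf (rset w \<epsilon> (clip \<phi>)))"
    by (auto simp: fun_eq_iff opt_time_def)
  also have "\<dots> \<in> borel_measurable borel" by measurable
  finally show ?thesis .
qed

end

section \<open>Costs as functions of the gaps between jumps\<close>

definition tail :: "(nat \<Rightarrow> 'a) \<Rightarrow> nat \<Rightarrow> 'a" where
  "tail x = (\<lambda>n. x (Suc n))"

lemma tail_case_nat [simp]: "tail (case_nat s x) = x"
  by (simp add: tail_def)

lemma component_measurable:
  assumes "f \<in> measurable N borel_seq"
  shows "(\<lambda>x. f x i) \<in> measurable N borel"
  using measurable_compose[OF assms measurable_component_singleton] by auto

lemma tail_measurable:
  assumes "f \<in> measurable N borel_seq"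
  shows "(\<lambda>x. tail (f x)) \<in> measurable N borel_seq"
  unfolding tail_def
  by (rule measurable_PiM_single') (use component_measurable[OF assms] in auto)

context pdmp begin

definition Expo :: "real measure" where "Expo = expo \<mu>"

definition Seq :: "(nat \<Rightarrow> real) measure" where "Seq = Pi\<^sub>M UNIV (\<lambda>_. Expo)"

lemma sets_Expo [simp, measurable_cong]: "sets Expo = sets borel" by (simp add: Expo_def)
lemma space_Expo [simp]: "space Expo = UNIV" by (simp add: Expo_def)
lemma sets_Seq [simp, measurable_cong]: "sets Seq = sets borel_seq"
  unfolding Seq_def by (rule sets_PiM_cong) simp_all

lemma space_Seq [simp]: "space Seq = UNIV"
  by (simp add: Seq_def space_PiM)

lemma prob_space_Expo: "prob_space Expo"
  unfolding Expo_def using mu_gt_1 by (intro prob_space_exponential_density) simp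

lemma prob_space_Seq: "prob_space Seq"
  unfolding Seq_def by (intro prob_space_PiM prob_space_Expo)

sublocale Expo: prob_space Expo by (rule prob_space_Expo)
sublocale Seq: prob_space Seq by (rule prob_space_Seq)
sublocale seq: sequence_space Expo by unfold_locales
sublocale ES: pair_prob_space Expo Seq by unfold_locales
sublocale LE: pair_sigma_finite lborel Expo by unfold_locales

lemma Expo_gt: "0 \<le> u \<Longrightarrow> Expo.prob {u<..} = exp (- \<mu> * u)"
  using exponential_measure_gt[of \<mu> u] mu_gt_1 by (simp add: Expo_def)

lemma AE_Expo_pos: "AE s in Expo. 0 < s"
  unfolding Expo_def
  by (subst AE_density, simp) (use AE_lborel_singleton[of "0::real"] in eventually_elim, auto simp: exponential_density_def)

lemma AE_Seq_pos: "AE x in Seq. \<forall>i. 0 < x i"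
  unfolding AE_all_countable Seq_def
  by (intro allI AE_PiM_component prob_space_Expo AE_Expo_pos UNIV_I)

lemma Expo_integral: "f \<in> borel_measurable borel \<Longrightarrow> (\<integral>s. f s \<partial>Expo) = (\<integral>s. indicator {0..} s * (\<mu> * exp (- \<mu> * s) * f s) \<partial>lborel)"
  for f :: "real \<Rightarrow> real"
proof -
  assume [measurable]: "f \<in> borel_measurable borel"
  have "(\<integral>s. f s \<partial>Expo) = (\<integral>s. exponential_density \<mu> s * f s \<partial>lborel)"
    unfolding Expo_def using mu_gt_1 by (subst integral_density) (auto simp: exponential_density_nonneg)
  also have "\<dots> = (\<integral>s. indicator {0..} s * (\<mu> * exp (- \<mu> * s) * f s) \<partial>lborel)"
    by (rule Bochner_Integration.integral_cong)
       (auto simp: exponential_density_def mult_ac split: split_indicator)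
  finally show ?thesis .
qed

text \<open>The moment that pays for the growth exp(t) in \<open>rate_abs\<close>; it is finite
  because \<open>\<mu> > 1\<close>.\<close>

lemma Expo_exp: "integrable Expo exp" "(\<integral>\<^sup>+s. ennreal (exp s) \<partial>Expo) = ennreal (\<mu> / (\<mu> - 1))"
proof -
  have *: "exponential_density \<mu> s * exp s = \<mu> * (indicator {0..} s * exp (- (\<mu> - 1) * s))" for s
    by (auto simp: exponential_density_def exp_add[symmetric] algebra_simps split: split_indicator)
  have "has_bochner_integral lborel (\<lambda>s. exponential_density \<mu> s * exp s) (\<mu> * (1 / (\<mu> - 1)))"
    unfolding * using integrable_exp_decay[of "\<mu> - 1"] mu_gt_1
    by (intro has_bochner_integral_mult_right) (simp add: has_bochner_integral_iff)
  then have "has_bochner_integral Expo exp (\<mu> * (1 / (\<mu> - 1)))"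
    unfolding Expo_def using mu_gt_1
    by (intro has_bochner_integral_density) (auto simp: exponential_density_nonneg)
  then show "integrable Expo exp" "(\<integral>\<^sup>+s. ennreal (exp s) \<partial>Expo) = ennreal (\<mu> / (\<mu> - 1))"
    by (auto simp: has_bochner_integral_iff nn_integral_eq_integral)
qed

lemma case_nat_measurable [measurable]:
  "(\<lambda>(s, x). case_nat s x) \<in> measurable (Expo \<Otimes>\<^sub>M Seq) borel_seq"
proof (rule measurable_PiM_single')
  fix i :: nat
  show "(\<lambda>p. (case p of (s, x) \<Rightarrow> case_nat s x) i) \<in> borel_measurable (Expo \<Otimes>\<^sub>M Seq)"
    by (cases i) (auto simp: split_beta')
qed auto

text \<open>An i.i.d. sequence is its first entry followed by an independent copy of itself.
  Conditioning on the first gap, in \<open>Seq_nn_first\<close> and \<open>Seq_first\<close>, is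
  Fubini after this change of variables.\<close>

lemma Seq_distr: "distr (Expo \<Otimes>\<^sub>M Seq) borel_seq (\<lambda>(s, x). case_nat s x) = Seq"
proof -
  have "distr (Expo \<Otimes>\<^sub>M Seq) borel_seq (\<lambda>(s, x). case_nat s x) =
      distr (Expo \<Otimes>\<^sub>M Seq) Seq (\<lambda>(s, x). case_nat s x)"
    by (rule distr_cong) simp_all
  then show ?thesis using seq.PiM_iter by (simp add: Seq_def[symmetric])
qed

lemma Seq_nn_first:
  assumes [measurable]: "f \<in> borel_measurable borel_seq"
  shows "(\<integral>\<^sup>+x. f x \<partial>Seq) = (\<integral>\<^sup>+s. (\<integral>\<^sup>+x. f (case_nat s x) \<partial>Seq) \<partial>Expo)"
proof -
  have "(\<integral>\<^sup>+x. f x \<partial>Seq) = (\<integral>\<^sup>+p. f (case p of (s, x) \<Rightarrow> case_nat s x) \<partial>(Expo \<Otimes>\<^sub>M Seq))"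
    by (subst Seq_distr[symmetric]) (rule nn_integral_distr; measurable)
  also have "\<dots> = (\<integral>\<^sup>+s. (\<integral>\<^sup>+x. f (case_nat s x) \<partial>Seq) \<partial>Expo)"
    by (subst Seq.nn_integral_fst[symmetric]) (auto simp: split_beta')
  finally show ?thesis .
qed

lemma Seq_first:
  fixes f :: "_ \<Rightarrow> real"
  assumes [measurable]: "f \<in> borel_measurable borel_seq" and f: "integrable Seq f"
  shows "(\<integral>x. f x \<partial>Seq) = (\<integral>s. (\<integral>x. f (case_nat s x) \<partial>Seq) \<partial>Expo)"
    and "integrable Expo (\<lambda>s. \<integral>x. f (case_nat s x) \<partial>Seq)"
proof -
  have i: "integrable (Expo \<Otimes>\<^sub>M Seq) (\<lambda>p. f (case p of (s, x) \<Rightarrow> case_nat s x))"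
    using f by (subst (asm) Seq_distr[symmetric]) (erule integrable_distr[rotated], measurable)
  then have i': "integrable (Expo \<Otimes>\<^sub>M Seq) (\<lambda>(s, x). f (case_nat s x))" by (simp add: split_beta')
  have "(\<integral>x. f x \<partial>Seq) = (\<integral>p. f (case p of (s, x) \<Rightarrow> case_nat s x) \<partial>(Expo \<Otimes>\<^sub>M Seq))"
    by (subst Seq_distr[symmetric]) (rule integral_distr; measurable)
  also have "\<dots> = (\<integral>(s, x). f (case_nat s x) \<partial>(Expo \<Otimes>\<^sub>M Seq))" by (simp add: split_beta')
  also have "\<dots> = (\<integral>s. (\<integral>x. f (case_nat s x) \<partial>Seq) \<partial>Expo)"
    using ES.integral_fst[OF i'] by simp
  finally show "(\<integral>x. f x \<partial>Seq) = (\<integral>s. (\<integral>x. f (case_nat s x) \<partial>Seq) \<partial>Expo)" .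
  show "integrable Expo (\<lambda>s. \<integral>x. f (case_nat s x) \<partial>Seq)"
    using ES.integrable_fst[OF i'] .
qed

abbreviation nxt :: "real \<times> real \<Rightarrow> real \<Rightarrow> real \<times> real" where "nxt \<phi> s \<equiv> jm (fl s \<phi>)"

lemma nxt_Quad: "\<phi> \<in> Quad \<Longrightarrow> 0 \<le> s \<Longrightarrow> nxt \<phi> s \<in> Quad"
  by (intro jm_Quad fl_Quad)

text \<open>One stage multiplies the discounted size by at most a constant times exp(s), which has
  finite expectation; iterating this controls any fixed number of stages.\<close>

lemma size_nxt: "\<phi> \<in> Quad \<Longrightarrow> 0 \<le> s \<Longrightarrow> exp (- lam * s) * size (nxt \<phi> s) \<le> 2 * Kfl * size \<phi> * exp s"
proof -
  assume \<phi>: "\<phi> \<in> Quad" and s: "0 \<le> s"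
  have "size (nxt \<phi> s) \<le> 2 * (Kfl * exp ((lam + 1) * s) * size \<phi>)"
    using size_jm[OF fl_Quad[OF \<phi> s]] size_fl[OF \<phi> s] by linarith
  then have "exp (- lam * s) * size (nxt \<phi> s) \<le> exp (- lam * s) * (2 * (Kfl * exp ((lam + 1) * s) * size \<phi>))"
    by (intro mult_left_mono) auto
  also have "\<dots> = 2 * Kfl * size \<phi> * (exp (- lam * s) * exp ((lam + 1) * s))" by simp
  also have "exp (- lam * s) * exp ((lam + 1) * s) = exp s"
    by (simp add: exp_add[symmetric] algebra_simps)
  finally show ?thesis .
qed

text \<open>The random variable inside \<open>J w t\<close>, as a function of the value s of the
  first gap. A tie \<open>t = s\<close> pays \<open>w\<close>, as in \<open>J\<close>.
  \<open>clip\<close> keeps the function Borel on the whole line, since for negative s the flow may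
  leave the quadrant.\<close>

definition first_cost :: "(real \<times> real \<Rightarrow> real) \<Rightarrow> ennreal \<Rightarrow> real \<times> real \<Rightarrow> real \<Rightarrow> real" where
  "first_cost w t \<phi> s = (if t < ennreal s then flow_cost \<phi> (enn2real t)
     else flow_cost \<phi> s + exp (- lam * s) * w (clip (nxt \<phi> s)))"

text \<open>Fubini: the cost up to the minimum of t and s is the integral over u \<le> t of the rate
  times the indicator of u < s, and the probability of u < s under \<open>Expo\<close> is exp(-
  \<mu> u). The absolute version of the same computation supplies the integrability.\<close>

lemma first_cost_integral_cost:
  fixes t :: ennreal
  assumes \<phi>: "\<phi> \<in> Quad"
  defines "a \<equiv> \<lambda>s. flow_cost \<phi> (if t < ennreal s then enn2real t else s)"
  shows "has_bochner_integral Expo a (\<integral>u. indicator {u. 0 \<le> u \<and> ennreal u \<le> t} u * (exp (- \<mu> * u) * rate \<phi> u) \<partial>lborel)"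
proof -
  define U where "U = {u. 0 \<le> u \<and> ennreal u \<le> t}"
  have U [measurable]: "U \<in> sets borel" unfolding U_def by measurable
  define F where "F u s = indicator U u * rate \<phi> u * indicator {u<..} s" for u s :: real
  have F_meas [measurable]: "(\<lambda>(u, s). F u s) \<in> borel_measurable (lborel \<Otimes>\<^sub>M Expo)"
    unfolding F_def indicator_def[of "{_<..}"] greaterThan_iff by measurable
  have aF: "a s = (\<integral>u. F u s \<partial>lborel)" if s: "0 < s" for s
  proof -
    let ?T = "if t < ennreal s then enn2real t else s"
    have T: "0 \<le> ?T" using s by simp
    show ?thesis unfolding a_def flow_cost_def
    proof (rule integral_cong_AE)
      show "AE u in lborel. indicator {0..?T} u * rate \<phi> u = F u s"
        using AE_lborel_singleton[of s]
      proof eventually_elim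
        case (elim u)
        \<comment> \<open>When s \<le> t the left side contains \<open>u = s\<close> and the right
          side does not; this point was excluded just above.\<close>
        have iff: "u \<in> {0..?T} \<longleftrightarrow> u \<in> U \<and> u < s"
        proof (cases "t < ennreal s")
          case True
          then obtain t' where t': "t = ennreal t'" "0 \<le> t'" by (cases t) auto
          with True s show ?thesis by (auto simp: U_def ennreal_less_iff)
        next
          case False
          with elim s show ?thesis by (auto simp: U_def intro: order_trans[OF ennreal_leI])
        qed
        have "indicator {0..?T} u = (indicator U u * indicator {u<..} s :: real)"
          unfolding indicator_def[of "{0..?T}"] iff by (simp add: indicator_def)
        then show ?case by (simp only: F_def mult_ac)
      qed
      show "(\<lambda>u. F u s) \<in> borel_measurable lborel"
        unfolding F_def indicator_def[of "{_<..}"] greaterThan_iff by measurable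
    qed simp
  qed
  have int_a: "integrable Expo a"
  proof (rule Bochner_Integration.integrable_bound)
    show "integrable Expo (\<lambda>s. Krate * size \<phi> * exp s)"
      by (intro integrable_mult_right Expo_exp)
    show "AE s in Expo. norm (a s) \<le> norm (Krate * size \<phi> * exp s)"
      using AE_Expo_pos
    proof eventually_elim
      case (elim s)
      let ?T = "if t < ennreal s then enn2real t else s"
      have T: "0 \<le> ?T" "?T \<le> s" using elim by (auto simp: enn2real_leI)
      have "\<bar>a s\<bar> \<le> Krate * size \<phi> * exp ?T" unfolding a_def using flow_cost_abs[OF \<phi> T(1)] by simp
      also have "\<dots> \<le> Krate * size \<phi> * exp s"
        using T Krate_nonneg size_ge_1[OF \<phi>] by (intro mult_left_mono) auto
      finally show ?case using Krate_nonneg size_ge_1[OF \<phi>] by simp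
    qed
  qed (simp add: a_def)
  have inner: "(\<integral>s. F u s \<partial>Expo) = indicator U u * rate \<phi> u * exp (- \<mu> * u)" for u
    using Expo_gt[of u] by (auto simp: F_def U_def split: split_indicator)
  have inner_abs: "(\<integral>s. norm (F u s) \<partial>Expo) = indicator U u * \<bar>rate \<phi> u\<bar> * exp (- \<mu> * u)" for u
    using Expo_gt[of u] by (auto simp: F_def U_def abs_mult split: split_indicator)
  have int_F: "integrable (lborel \<Otimes>\<^sub>M Expo) (\<lambda>(u, s). F u s)"
  proof (rule LE.Fubini_integrable)
    show "AE u in lborel. integrable Expo (\<lambda>s. case (u, s) of (u, s) \<Rightarrow> F u s)"
    proof (rule AE_I2)
      fix u
      have "integrable Expo (indicator {u<..} :: real \<Rightarrow> real)"
        by (rule integrable_real_indicator) (simp_all add: Expo.emeasure_eq_measure)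
      then show "integrable Expo (\<lambda>s. case (u, s) of (u, s) \<Rightarrow> F u s)" by (simp add: F_def)
    qed
    show "integrable lborel (\<lambda>u. \<integral>s. norm (case (u, s) of (u, s) \<Rightarrow> F u s) \<partial>Expo)"
      unfolding prod.case inner_abs
    proof (rule Bochner_Integration.integrable_bound)
      show "integrable lborel (\<lambda>u. Krate * size \<phi> * (indicator {0..} u * exp (- (\<mu> - 1) * u)))"
        using mu_gt_1 by (intro integrable_mult_right integrable_exp_decay) auto
      show "AE u in lborel. norm (indicator U u * \<bar>rate \<phi> u\<bar> * exp (- \<mu> * u)) \<le>
          norm (Krate * size \<phi> * (indicator {0..} u * exp (- (\<mu> - 1) * u)))"
      proof (rule AE_I2)
        fix u
        show "norm (indicator U u * \<bar>rate \<phi> u\<bar> * exp (- \<mu> * u)) \<le>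
          norm (Krate * size \<phi> * (indicator {0..} u * exp (- (\<mu> - 1) * u)))"
        proof (cases "u \<in> U")
          case True
          then have u: "0 \<le> u" by (simp add: U_def)
          have "\<bar>rate \<phi> u\<bar> * exp (- \<mu> * u) \<le> Krate * size \<phi> * exp u * exp (- \<mu> * u)"
            using rate_abs[OF \<phi> u] by (intro mult_right_mono) auto
          also have "\<dots> = Krate * size \<phi> * (exp u * exp (- \<mu> * u))" by simp
          also have "exp u * exp (- \<mu> * u) = exp (- (\<mu> - 1) * u)"
            by (simp add: exp_add[symmetric] algebra_simps)
          finally show ?thesis using True u Krate_nonneg size_ge_1[OF \<phi>] by (simp add: abs_mult)
        qed simp
      qed
    qed simp
  qed (use F_meas in simp)
  have "(\<integral>s. a s \<partial>Expo) = (\<integral>s. (\<integral>u. F u s \<partial>lborel) \<partial>Expo)"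
  proof (rule integral_cong_AE)
    show "AE s in Expo. a s = (\<integral>u. F u s \<partial>lborel)"
      using AE_Expo_pos by eventually_elim (rule aF)
    show "(\<lambda>s. \<integral>u. F u s \<partial>lborel) \<in> borel_measurable Expo"
      using LE.integrable_snd[OF int_F] by (rule borel_measurable_integrable)
  qed (simp add: a_def)
  also have "\<dots> = (\<integral>u. (\<integral>s. F u s \<partial>Expo) \<partial>lborel)"
    by (rule LE.Fubini_integral[OF int_F])
  also have "\<dots> = (\<integral>u. indicator U u * (exp (- \<mu> * u) * rate \<phi> u) \<partial>lborel)"
    unfolding inner by (simp add: mult_ac)
  finally show ?thesis using int_a by (simp add: has_bochner_integral_iff U_def)
qed

lemma first_cost_integral:
  assumes w: "admissible w" and \<phi>: "\<phi> \<in> Quad"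
  shows "has_bochner_integral Expo (first_cost w t \<phi>) (H w t \<phi>)"
proof -
  have [measurable]: "(\<lambda>s. w (clip (nxt \<phi> s))) \<in> borel_measurable borel"
    by (rule measurable_compose[OF _ admissible_measurable[OF w], of "\<lambda>s. nxt \<phi> s"]) measurable
  let ?U = "{u. 0 \<le> u \<and> ennreal u \<le> t}"
  let ?a = "\<lambda>s. flow_cost \<phi> (if t < ennreal s then enn2real t else s)"
  let ?b = "\<lambda>s. if t < ennreal s then 0 else exp (- lam * s) * w (clip (nxt \<phi> s))"
  let ?h = "\<lambda>s. indicator ?U s * (\<mu> * w (nxt \<phi> s) * exp (- (lam + \<mu>) * s))"
  have "integrable Expo ?b"
  proof (rule Expo.integrable_const_bound)
    show "AE s in Expo. norm (?b s) \<le> Lmin"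
      using AE_Expo_pos
    proof eventually_elim
      case (elim s)
      have "\<bar>w (clip (nxt \<phi> s))\<bar> \<le> Lmin"
        using admissible_bounds[OF w clip_in[of "nxt \<phi> s"]] Lmin_pos by simp
      moreover have "exp (- lam * s) \<le> 1" using lam_pos elim by simp
      ultimately have "exp (- lam * s) * \<bar>w (clip (nxt \<phi> s))\<bar> \<le> 1 * Lmin" by (intro mult_mono) auto
      then show ?case using Lmin_pos by (auto simp: abs_mult)
    qed
  qed measurable
  moreover have "(\<integral>s. ?b s \<partial>Expo) = (\<integral>s. ?h s \<partial>lborel)"
  proof -
    have "\<mu> * exp (- \<mu> * s) * (exp (- lam * s) * x) = \<mu> * x * exp (- (lam + \<mu>) * s)" for s x
    proof -
      have "exp (- (lam + \<mu>) * s) = exp (- \<mu> * s) * exp (- lam * s)"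
        by (simp add: exp_add[symmetric] algebra_simps)
      then show ?thesis by (simp only: mult_ac)
    qed
    then show ?thesis
      by (subst Expo_integral, measurable)
         (intro Bochner_Integration.integral_cong refl, auto simp: nxt_Quad[OF \<phi>] split: split_indicator)
  qed
  ultimately have b: "has_bochner_integral Expo ?b (\<integral>s. ?h s \<partial>lborel)" by (simp add: has_bochner_integral_iff)
  note a = first_cost_integral_cost[OF \<phi>, of t]
  have "integrable lborel (\<lambda>s. indicator ?U s * H_rate w \<phi> s)" by (intro H_rate_integrable w \<phi>) auto
  \<comment> \<open>With payoff 0 the integrand of \<open>H\<close> reduces to its cost part. The
    payoff part is then integrable as a difference.\<close>
  moreover have h_int: "integrable lborel (\<lambda>s. indicator ?U s * (exp (- \<mu> * s) * rate \<phi> s))"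
    using H_rate_integrable[OF admissible_0 \<phi>, of ?U] by (auto simp: H_rate_eq subset_eq)
  ultimately have "integrable lborel (\<lambda>s. indicator ?U s * H_rate w \<phi> s - indicator ?U s * (exp (- \<mu> * s) * rate \<phi> s))"
    by (rule Bochner_Integration.integrable_diff)
  then have h_int2: "integrable lborel ?h"
    by (simp add: H_rate_eq algebra_simps)
  have "H w t \<phi> = (\<integral>s. indicator ?U s * (exp (- \<mu> * s) * rate \<phi> s) + ?h s \<partial>lborel)"
    unfolding H_def H_rate_eq by (simp add: distrib_left)
  also have "\<dots> = (\<integral>s. indicator ?U s * (exp (- \<mu> * s) * rate \<phi> s) \<partial>lborel) + (\<integral>s. ?h s \<partial>lborel)"
    by (rule Bochner_Integration.integral_add[OF h_int h_int2])
  finally have "has_bochner_integral Expo (\<lambda>s. ?a s + ?b s) (H w t \<phi>)"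
    using has_bochner_integral_add[OF a b] by simp
  moreover have "(\<lambda>s. ?a s + ?b s) = first_cost w t \<phi>" by (auto simp: first_cost_def fun_eq_iff)
  ultimately show ?thesis by simp
qed

end

section \<open>Value iteration and finite-stage costs in gap coordinates\<close>

context pdmp begin

primrec val :: "nat \<Rightarrow> real \<times> real \<Rightarrow> real" where
  "val 0 = (\<lambda>_. 0)"
| "val (Suc n) = Hinf (val n)"

lemma admissible_val: "admissible (val n)"
  by (induction n) (auto intro: admissible_0 admissible_Hinf)

text \<open>Along the sequence \<open>x\<close> of gaps between jumps: the cost up to the minimum of \<open>T\<close> and the
  \<open>n\<close>-th jump time, plus the terminal payoff \<open>e k\<close> if \<open>T\<close> comes first, with \<open>k\<close> jumps to go.\<close>

primrec pathcost :: "(nat \<Rightarrow> real \<times> real \<Rightarrow> real) \<Rightarrow> nat \<Rightarrow> (nat \<Rightarrow> real) \<Rightarrow> real \<times> real \<Rightarrow> ennreal \<Rightarrow> real" where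
  "pathcost e 0 x \<phi> T = 0"
| "pathcost e (Suc n) x \<phi> T =
    (if T < ennreal (x 0) then flow_cost \<phi> (enn2real T) + exp (- lam * enn2real T) * e (Suc n) (clip (fl (enn2real T) \<phi>))
     else flow_cost \<phi> (x 0) + exp (- lam * x 0) * pathcost e n (tail x) (nxt \<phi> (x 0)) (T - ennreal (x 0)))"

primrec rule_time :: "nat \<Rightarrow> real \<Rightarrow> (nat \<Rightarrow> real) \<Rightarrow> real \<times> real \<Rightarrow> ennreal" where
  "rule_time 0 \<epsilon> x \<phi> = 0"
| "rule_time (Suc n) \<epsilon> x \<phi> = (let \<rho> = opt_time (val n) (if n = 0 then \<epsilon> else \<epsilon> / 2) (clip \<phi>) in
     if \<rho> < ennreal (x 0) then \<rho> else ennreal (x 0) + rule_time n (\<epsilon> / 2) (tail x) (nxt \<phi> (x 0)))"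

text \<open>A majorant of \<open>pathcost\<close> that is independent of the stopping time: each
  stage is charged its full flow cost and a terminal payoff of modulus at most
  \<open>Lmin\<close>.\<close>

primrec gap_bound :: "nat \<Rightarrow> (nat \<Rightarrow> real) \<Rightarrow> real \<times> real \<Rightarrow> real" where
  "gap_bound 0 x \<phi> = 0"
| "gap_bound (Suc n) x \<phi> = Krate * size \<phi> * exp (x 0) + Lmin + exp (- lam * x 0) * gap_bound n (tail x) (nxt \<phi> (x 0))"

lemma gap_bound_measurable:
  assumes "f \<in> measurable N borel_seq" "h \<in> borel_measurable N"
  shows "(\<lambda>y. gap_bound n (f y) (h y)) \<in> borel_measurable N"
  using assms
proof (induction n arbitrary: f h)
  case (Suc n)
  note [measurable] = component_measurable[OF Suc.prems(1)] Suc.prems(2)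
  have [measurable]: "(\<lambda>y. gap_bound n (tail (f y)) (nxt (h y) (f y 0))) \<in> borel_measurable N"
    by (intro Suc.IH tail_measurable Suc.prems(1)) measurable
  show ?case unfolding gap_bound.simps by measurable
qed simp

lemma pathcost_measurable:
  assumes "\<And>k. (\<lambda>\<phi>. e k (clip \<phi>)) \<in> borel_measurable borel"
    and "f \<in> measurable N borel_seq" "h \<in> borel_measurable N" "T \<in> borel_measurable N"
  shows "(\<lambda>y. pathcost e n (f y) (h y) (T y)) \<in> borel_measurable N"
  using assms(2-)
proof (induction n arbitrary: f h T)
  case (Suc n)
  note [measurable] = component_measurable[OF Suc.prems(1)] Suc.prems(2,3)
  have [measurable]: "(\<lambda>y. pathcost e n (tail (f y)) (nxt (h y) (f y 0)) (T y - ennreal (f y 0))) \<in> borel_measurable N"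
    by (intro Suc.IH tail_measurable Suc.prems(1)) measurable
  have [measurable]: "(\<lambda>y. e (Suc n) (clip (fl (enn2real (T y)) (h y)))) \<in> borel_measurable N"
    by (rule measurable_compose[OF _ assms(1)]) measurable
  show ?case unfolding pathcost.simps by measurable
qed simp

lemma rule_time_measurable:
  assumes "f \<in> measurable N borel_seq" "h \<in> borel_measurable N"
  shows "(\<lambda>y. rule_time n \<epsilon> (f y) (h y)) \<in> borel_measurable N"
  using assms
proof (induction n arbitrary: f h \<epsilon>)
  case (Suc n)
  note [measurable] = component_measurable[OF Suc.prems(1)] Suc.prems(2)
  have [measurable]: "(\<lambda>y. rule_time n (\<epsilon> / 2) (tail (f y)) (nxt (h y) (f y 0))) \<in> borel_measurable N"
    by (intro Suc.IH tail_measurable Suc.prems(1)) measurable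
  have [measurable]: "(\<lambda>y. opt_time (val n) \<delta> (clip (h y))) \<in> borel_measurable N" for \<delta>
    by (rule measurable_compose[OF _ opt_time_clip_measurable[OF admissible_val]]) measurable
  show ?case unfolding rule_time.simps Let_def by measurable
qed simp

lemma gap_bound_nonneg: "\<phi> \<in> Quad \<Longrightarrow> (\<And>i. 0 < x i) \<Longrightarrow> 0 \<le> gap_bound n x \<phi>"
proof (induction n arbitrary: x \<phi>)
  case (Suc n)
  have "0 \<le> gap_bound n (tail x) (nxt \<phi> (x 0))"
    using Suc.prems by (intro Suc.IH nxt_Quad) (auto simp: tail_def less_imp_le)
  then show ?case
    using Krate_nonneg size_ge_1[OF Suc.prems(1)] Lmin_pos by simp
qed simp

lemma pathcost_abs:
  assumes e: "\<And>k \<phi>. \<phi> \<in> Quad \<Longrightarrow> \<bar>e k \<phi>\<bar> \<le> Lmin"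
  shows "\<phi> \<in> Quad \<Longrightarrow> (\<And>i. 0 < x i) \<Longrightarrow> \<bar>pathcost e n x \<phi> T\<bar> \<le> gap_bound n x \<phi>"
proof (induction n arbitrary: x \<phi> T)
  case (Suc n)
  note \<phi> = Suc.prems(1) and x = Suc.prems(2)
  have x': "0 < tail x i" for i using x by (simp add: tail_def)
  have \<phi>': "nxt \<phi> (x 0) \<in> Quad" using \<phi> x by (intro nxt_Quad) (auto simp: less_imp_le)
  have K: "0 \<le> Krate * size \<phi>" using Krate_nonneg size_ge_1[OF \<phi>] by simp
  show ?case
  proof (cases "T < ennreal (x 0)")
    case True
    let ?T = "enn2real T"
    have T: "0 \<le> ?T" "?T \<le> x 0" using True x[of 0] by (auto intro!: enn2real_leI)
    have "\<bar>flow_cost \<phi> ?T\<bar> \<le> Krate * size \<phi> * exp ?T" by (rule flow_cost_abs[OF \<phi> T(1)])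
    also have "\<dots> \<le> Krate * size \<phi> * exp (x 0)" using K T by (intro mult_left_mono) auto
    finally have 1: "\<bar>flow_cost \<phi> ?T\<bar> \<le> Krate * size \<phi> * exp (x 0)" .
    have "exp (- lam * ?T) * \<bar>e (Suc n) (clip (fl ?T \<phi>))\<bar> \<le> 1 * Lmin"
      using e T lam_pos by (intro mult_mono) auto
    with 1 have "\<bar>pathcost e (Suc n) x \<phi> T\<bar> \<le> Krate * size \<phi> * exp (x 0) + Lmin"
      using True by (auto simp: abs_mult intro!: order_trans[OF abs_triangle_ineq])
    also have "\<dots> \<le> gap_bound (Suc n) x \<phi>"
      using gap_bound_nonneg[OF \<phi>' x', of n] by simp
    finally show ?thesis .
  next
    case False
    have "\<bar>pathcost e n (tail x) (nxt \<phi> (x 0)) (T - ennreal (x 0))\<bar> \<le> gap_bound n (tail x) (nxt \<phi> (x 0))"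
      by (rule Suc.IH[OF \<phi>' x'])
    then have "\<bar>exp (- lam * x 0) * pathcost e n (tail x) (nxt \<phi> (x 0)) (T - ennreal (x 0))\<bar>
        \<le> exp (- lam * x 0) * gap_bound n (tail x) (nxt \<phi> (x 0))"
      unfolding abs_mult by (intro mult_mono) auto
    moreover have "\<bar>flow_cost \<phi> (x 0)\<bar> \<le> Krate * size \<phi> * exp (x 0)"
      using x[of 0] by (intro flow_cost_abs[OF \<phi>]) auto
    ultimately show ?thesis using False Lmin_pos by simp
  qed
qed simp

text \<open>Linearity in \<open>size\<close> is what makes the induction close: the bound for the
  remaining stages is evaluated at the state after the jump, and \<open>size_nxt\<close> turns it
  into a multiple of \<open>size \<phi>\<close> times exp(s). Nonnegative integrals are used since
  integrability is the outcome.\<close>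

lemma gap_bound_nn_integral:
  "\<exists>B\<ge>0. \<forall>\<phi>\<in>Quad. (\<integral>\<^sup>+x. ennreal (gap_bound n x \<phi>) \<partial>Seq) \<le> ennreal (B * size \<phi>)"
proof (induction n)
  case 0
  then show ?case by (intro exI[of _ 0]) auto
next
  case (Suc n)
  then obtain B where B: "0 \<le> B" "\<And>\<phi>. \<phi> \<in> Quad \<Longrightarrow> (\<integral>\<^sup>+x. ennreal (gap_bound n x \<phi>) \<partial>Seq) \<le> ennreal (B * size \<phi>)" by blast
  \<comment> \<open>The factor \<open>\<mu> / (\<mu> - 1)\<close> is the expectation of exp of the
    first gap; \<open>Lmin\<close> is absorbed into \<open>Lmin * size \<phi>\<close>.\<close>
  define B' where "B' = (Krate + 2 * Kfl * B) * (\<mu> / (\<mu> - 1)) + Lmin"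
  have "(\<integral>\<^sup>+x. ennreal (gap_bound (Suc n) x \<phi>) \<partial>Seq) \<le> ennreal (B' * size \<phi>)" if \<phi>: "\<phi> \<in> Quad" for \<phi>
  proof -
    have K: "0 \<le> Krate * size \<phi>" using Krate_nonneg size_ge_1[OF \<phi>] by simp
    have inner: "(\<integral>\<^sup>+x. ennreal (gap_bound (Suc n) (case_nat s x) \<phi>) \<partial>Seq)
        \<le> ennreal (Krate * size \<phi> + 2 * Kfl * B * size \<phi>) * ennreal (exp s) + ennreal Lmin" if s: "0 < s" for s
    proof -
      have nx: "nxt \<phi> s \<in> Quad" using \<phi> s by (intro nxt_Quad) auto
      have [measurable]: "(\<lambda>x. gap_bound n x (nxt \<phi> s)) \<in> borel_measurable Seq"
        by (rule gap_bound_measurable) (auto intro!: measurable_ident_sets)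
      have "(\<integral>\<^sup>+x. ennreal (gap_bound (Suc n) (case_nat s x) \<phi>) \<partial>Seq)
          = (\<integral>\<^sup>+x. ennreal (Krate * size \<phi> * exp s + Lmin) + ennreal (exp (- lam * s)) * ennreal (gap_bound n x (nxt \<phi> s)) \<partial>Seq)"
        by (rule nn_integral_cong_AE, use AE_Seq_pos in eventually_elim)
           (use K Lmin_pos in \<open>simp add: gap_bound_nonneg[OF nx] ennreal_mult[symmetric] flip: ennreal_plus\<close>)
      also have "\<dots> = ennreal (Krate * size \<phi> * exp s + Lmin) + ennreal (exp (- lam * s)) * (\<integral>\<^sup>+x. ennreal (gap_bound n x (nxt \<phi> s)) \<partial>Seq)"
        by (subst nn_integral_add, measurable) (simp add: nn_integral_cmult Seq.emeasure_space_1[simplified])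
      also have "\<dots> \<le> ennreal (Krate * size \<phi> * exp s + Lmin) + ennreal (exp (- lam * s)) * ennreal (B * size (nxt \<phi> s))"
        by (intro add_left_mono mult_left_mono B(2) nx) simp
      also have "\<dots> = ennreal (Krate * size \<phi> * exp s + Lmin + B * (exp (- lam * s) * size (nxt \<phi> s)))"
        using K Lmin_pos B(1) size_ge_1[OF nx]
        by (subst ennreal_mult[symmetric]) (simp_all add: mult.left_commute flip: ennreal_plus)
      also have "\<dots> \<le> ennreal ((Krate * size \<phi> + 2 * Kfl * B * size \<phi>) * exp s + Lmin)"
        using mult_left_mono[OF size_nxt[OF \<phi>, of s] B(1)] s by (intro ennreal_leI) (simp add: algebra_simps)
      also have "\<dots> = ennreal (Krate * size \<phi> + 2 * Kfl * B * size \<phi>) * ennreal (exp s) + ennreal Lmin"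
        using K Lmin_pos B(1) Kfl_nonneg size_ge_1[OF \<phi>] by (simp add: ennreal_mult)
      finally show ?thesis .
    qed
    have "(\<integral>\<^sup>+x. ennreal (gap_bound (Suc n) x \<phi>) \<partial>Seq) = (\<integral>\<^sup>+s. (\<integral>\<^sup>+x. ennreal (gap_bound (Suc n) (case_nat s x) \<phi>) \<partial>Seq) \<partial>Expo)"
      by (intro Seq_nn_first measurable_compose[OF _ measurable_ennreal] gap_bound_measurable) (auto intro!: measurable_ident_sets)
    also have "\<dots> \<le> (\<integral>\<^sup>+s. ennreal (Krate * size \<phi> + 2 * Kfl * B * size \<phi>) * ennreal (exp s) + ennreal Lmin \<partial>Expo)"
      by (rule nn_integral_mono_AE, use AE_Expo_pos in eventually_elim) (rule inner)
    also have "\<dots> = ennreal (Krate * size \<phi> + 2 * Kfl * B * size \<phi>) * ennreal (\<mu> / (\<mu> - 1)) + ennreal Lmin"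
      by (subst nn_integral_add, measurable) (simp add: nn_integral_cmult Expo_exp Expo.emeasure_space_1[simplified])
    also have "\<dots> = ennreal ((Krate * size \<phi> + 2 * Kfl * B * size \<phi>) * (\<mu> / (\<mu> - 1)) + Lmin * 1)"
      using K Lmin_pos B(1) Kfl_nonneg size_ge_1[OF \<phi>] mu_gt_1
      by (subst ennreal_mult[symmetric]) (simp_all flip: ennreal_plus)
    also have "\<dots> \<le> ennreal ((Krate * size \<phi> + 2 * Kfl * B * size \<phi>) * (\<mu> / (\<mu> - 1)) + Lmin * size \<phi>)"
      using size_ge_1[OF \<phi>] Lmin_pos by (intro ennreal_leI add_left_mono mult_left_mono) auto
    also have "(Krate * size \<phi> + 2 * Kfl * B * size \<phi>) * (\<mu> / (\<mu> - 1)) + Lmin * size \<phi> = B' * size \<phi>"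
      unfolding B'_def by (simp add: field_simps)
    finally show ?thesis .
  qed
  moreover have "0 \<le> B'" using B(1) Krate_nonneg Kfl_nonneg Lmin_pos mu_gt_1 by (simp add: B'_def)
  ultimately show ?case by blast
qed

lemma gap_bound_integrable: "\<phi> \<in> Quad \<Longrightarrow> integrable Seq (\<lambda>x. gap_bound n x \<phi>)"
proof -
  assume \<phi>: "\<phi> \<in> Quad"
  obtain B where "(\<integral>\<^sup>+x. ennreal (gap_bound n x \<phi>) \<partial>Seq) \<le> ennreal (B * size \<phi>)"
    using gap_bound_nn_integral[of n] \<phi> by blast
  then have "(\<integral>\<^sup>+x. ennreal (gap_bound n x \<phi>) \<partial>Seq) < \<infinity>"
    by (rule le_less_trans) simp
  moreover have "AE x in Seq. 0 \<le> gap_bound n x \<phi>"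
    using AE_Seq_pos by eventually_elim (rule gap_bound_nonneg[OF \<phi>], blast)
  ultimately show ?thesis
    by (intro integrableI_nonneg gap_bound_measurable) (auto intro!: measurable_ident_sets)
qed

lemma pathcost_integrable:
  assumes e: "\<And>k \<phi>. \<phi> \<in> Quad \<Longrightarrow> \<bar>e k \<phi>\<bar> \<le> Lmin" "\<And>k. (\<lambda>\<phi>. e k (clip \<phi>)) \<in> borel_measurable borel"
    and \<phi>: "\<phi> \<in> Quad" and T: "T \<in> borel_measurable borel_seq"
  shows "integrable Seq (\<lambda>x. pathcost e n x \<phi> (T x))"
proof (rule Bochner_Integration.integrable_bound[OF gap_bound_integrable[OF \<phi>, of n]])
  show "(\<lambda>x. pathcost e n x \<phi> (T x)) \<in> borel_measurable Seq"
    using T by (intro pathcost_measurable e) (auto intro!: measurable_ident_sets)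
  show "AE x in Seq. norm (pathcost e n x \<phi> (T x)) \<le> norm (gap_bound n x \<phi>)"
    using AE_Seq_pos
  proof eventually_elim
    case (elim x)
    then have "\<bar>pathcost e n x \<phi> (T x)\<bar> \<le> gap_bound n x \<phi>" by (intro pathcost_abs e(1) \<phi>) auto
    then show ?case by simp
  qed
qed

abbreviation "zero_payoff \<equiv> (\<lambda>(_::nat) (_::real\<times>real). 0::real)"

text \<open>Conditioning on the first gap leaves the one-stage problem with payoff
  \<open>val n\<close> at a \<delta>-optimal time, plus the error of the later stages, which the
  induction hypothesis bounds at the state behind the jump.\<close>

lemma rule_time_cost_le:
  "\<phi> \<in> Quad \<Longrightarrow> 0 \<le> \<epsilon> \<Longrightarrow> (\<integral>x. pathcost zero_payoff n x \<phi> (rule_time n \<epsilon> x \<phi>) \<partial>Seq) \<le> val n \<phi> + \<epsilon>"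
proof (induction n arbitrary: \<phi> \<epsilon>)
  case (Suc n)
  note \<phi> = Suc.prems(1)
  \<comment> \<open>The error is shared out: \<delta> is spent on the waiting time of this stage and
    \<delta>' on all later ones. The last stage keeps everything for itself.\<close>
  define \<delta> where "\<delta> = (if n = 0 then \<epsilon> else \<epsilon> / 2)"
  define \<delta>' where "\<delta>' = (if n = 0 then 0 else \<epsilon> / 2)"
  have \<delta>: "0 \<le> \<delta>" "0 \<le> \<delta>'" "\<delta> + \<delta>' = \<epsilon>" using Suc.prems by (auto simp: \<delta>_def \<delta>'_def)
  define \<rho> where "\<rho> = opt_time (val n) \<delta> \<phi>"
  let ?f = "\<lambda>x. pathcost zero_payoff (Suc n) x \<phi> (rule_time (Suc n) \<epsilon> x \<phi>)"
  let ?I = "\<lambda>s. \<integral>x. pathcost zero_payoff n x (nxt \<phi> s) (rule_time n (\<epsilon> / 2) x (nxt \<phi> s)) \<partial>Seq"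

  have meas_rule_time: "(\<lambda>x. rule_time k \<eta> x \<psi>) \<in> borel_measurable borel_seq" for k \<eta> \<psi>
    by (rule rule_time_measurable) auto
  have fm: "?f \<in> borel_measurable borel_seq"
    by (intro pathcost_measurable meas_rule_time) auto
  have fi: "integrable Seq ?f"
    by (intro pathcost_integrable meas_rule_time \<phi>) (use Lmin_pos in auto)
  have IH: "?I s \<le> val n (nxt \<phi> s) + \<delta>'" if "0 < s" for s
  proof (cases "n = 0")
    case False
    with Suc.IH[of "nxt \<phi> s" "\<epsilon> / 2"] Suc.prems that show ?thesis
      by (simp add: \<delta>'_def nxt_Quad)
  qed (simp add: \<delta>'_def)
  have inner: "(\<integral>x. ?f (case_nat s x) \<partial>Seq) \<le> first_cost (val n) \<rho> \<phi> s + \<delta>'" if s: "0 < s" for s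
  proof (cases "\<rho> < ennreal s")
    case True
    then have "?f (case_nat s x) = flow_cost \<phi> (enn2real \<rho>)" for x
      using \<phi> by (simp add: \<rho>_def \<delta>_def Let_def)
    then have "(\<integral>x. ?f (case_nat s x) \<partial>Seq) = flow_cost \<phi> (enn2real \<rho>)"
      by (simp add: Seq.prob_space[simplified])
    with True \<delta> show ?thesis by (simp add: first_cost_def)
  next
    case False
    then have "rule_time (Suc n) \<epsilon> (case_nat s x) \<phi> = ennreal s + rule_time n (\<epsilon> / 2) x (nxt \<phi> s)" for x
      using \<phi> by (simp add: \<rho>_def \<delta>_def Let_def)
    then have "?f (case_nat s x) = flow_cost \<phi> s + exp (- lam * s) * pathcost zero_payoff n x (nxt \<phi> s) (rule_time n (\<epsilon> / 2) x (nxt \<phi> s))" for x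
      by (simp add: not_less)
    then have "(\<integral>x. ?f (case_nat s x) \<partial>Seq) = (\<integral>x. flow_cost \<phi> s + exp (- lam * s) * pathcost zero_payoff n x (nxt \<phi> s) (rule_time n (\<epsilon> / 2) x (nxt \<phi> s)) \<partial>Seq)"
      by (simp only:)
    also have "\<dots> = flow_cost \<phi> s + exp (- lam * s) * ?I s"
      using s Lmin_pos by (subst Bochner_Integration.integral_add)
        (auto intro!: integrable_mult_right pathcost_integrable meas_rule_time nxt_Quad \<phi> simp: Seq.prob_space[simplified])
    also have "\<dots> \<le> flow_cost \<phi> s + exp (- lam * s) * (val n (nxt \<phi> s) + \<delta>')"
      using IH[OF s] by simp
    also have "\<dots> \<le> first_cost (val n) \<rho> \<phi> s + \<delta>'"
    proof -
      \<comment> \<open>Discounting only shrinks the error that is passed on.\<close>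
      have "exp (- lam * s) * \<delta>' \<le> 1 * \<delta>'" using \<delta> s lam_pos by (intro mult_right_mono) auto
      with False s show ?thesis by (simp add: first_cost_def nxt_Quad[OF \<phi>] distrib_left)
    qed
    finally show ?thesis .
  qed
  have first_cost: "integrable Expo (first_cost (val n) \<rho> \<phi>)" "(\<integral>s. first_cost (val n) \<rho> \<phi> s \<partial>Expo) = H (val n) \<rho> \<phi>"
    using first_cost_integral[OF admissible_val \<phi>] by (auto simp: has_bochner_integral_iff)
  have "(\<integral>x. ?f x \<partial>Seq) = (\<integral>s. (\<integral>x. ?f (case_nat s x) \<partial>Seq) \<partial>Expo)"
    by (rule Seq_first(1)[OF fm fi])
  also have "\<dots> \<le> (\<integral>s. first_cost (val n) \<rho> \<phi> s + \<delta>' \<partial>Expo)"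
  proof (rule integral_mono_AE[OF Seq_first(2)[OF fm fi]])
    show "integrable Expo (\<lambda>s. first_cost (val n) \<rho> \<phi> s + \<delta>')"
      by (intro Bochner_Integration.integrable_add first_cost(1)) simp
    show "AE s in Expo. (\<integral>x. ?f (case_nat s x) \<partial>Seq) \<le> first_cost (val n) \<rho> \<phi> s + \<delta>'"
      using AE_Expo_pos by eventually_elim (rule inner)
  qed
  also have "\<dots> = H (val n) \<rho> \<phi> + \<delta>'"
    using first_cost by (simp add: Expo.prob_space[simplified])
  also have "\<dots> \<le> Hinf (val n) \<phi> + \<delta> + \<delta>'"
    using H_opt_time_le[OF admissible_val \<phi> \<delta>(1)] by (simp add: \<rho>_def)
  also have "\<dots> = val (Suc n) \<phi> + \<epsilon>" using \<delta> by simp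
  finally show ?case .
qed simp

lemma val_abs: "\<phi> \<in> Quad \<Longrightarrow> \<bar>val n \<phi>\<bar> \<le> Lmin"
  using admissible_bounds[OF admissible_val, of \<phi> n] Lmin_pos by auto

text \<open>Waiting until h and then following a minimizer u for \<open>fl h \<phi>\<close> amounts
  to the single choice h + u, which competes in the infimum at \<phi>.\<close>

lemma val_dynamic:
  assumes \<phi>: "\<phi> \<in> Quad" and h: "0 \<le> h"
  shows "val (Suc n) \<phi> \<le> H (val n) (ennreal h) \<phi> + exp (- (lam + \<mu>) * h) * val (Suc n) (fl h \<phi>)"
proof -
  obtain u where u: "H (val n) u (fl h \<phi>) = Hinf (val n) (fl h \<phi>)"
    using Hinf_attained[OF admissible_val fl_Quad[OF \<phi> h]] ..
  have "val (Suc n) \<phi> \<le> H (val n) (ennreal h + u) \<phi>"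
    using Hinf_le[OF admissible_val \<phi>] by simp
  also have "\<dots> = H (val n) (ennreal h) \<phi> + exp (- (lam + \<mu>) * h) * H (val n) u (fl h \<phi>)"
    by (rule H_add[OF admissible_val \<phi> h])
  finally show ?thesis using u by simp
qed

text \<open>The submartingale inequality between time 0 and a deterministic time h. If the first gap
  is longer than h, the continuation value at \<open>fl h \<phi>\<close> is collected; otherwise the
  induction hypothesis applies behind the jump with h - s time left. Averaging the two cases gives
  the right side of \<open>val_dynamic\<close>.\<close>

lemma val_le_pathcost:
  "\<phi> \<in> Quad \<Longrightarrow> 0 \<le> h \<Longrightarrow> val n \<phi> \<le> (\<integral>x. pathcost val n x \<phi> (ennreal h) \<partial>Seq)"
proof (induction n arbitrary: \<phi> h)
  case (Suc n)
  note \<phi> = Suc.prems(1) and h = Suc.prems(2)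
  let ?f = "\<lambda>x. pathcost val (Suc n) x \<phi> (ennreal h)"
  let ?v = "exp (- lam * h) * val (Suc n) (fl h \<phi>)"
  note vm = admissible_measurable[OF admissible_val]
  have fm: "?f \<in> borel_measurable borel_seq"
    by (intro pathcost_measurable vm) auto
  have fi: "integrable Seq ?f"
    by (intro pathcost_integrable vm val_abs \<phi>) auto
  have inner: "first_cost (val n) (ennreal h) \<phi> s + ?v * indicator {h<..} s \<le> (\<integral>x. ?f (case_nat s x) \<partial>Seq)" if s: "0 < s" for s
  proof (cases "h < s")
    case True
    then have "?f (case_nat s x) = flow_cost \<phi> h + ?v" for x
      using h by (simp add: ennreal_less_iff fl_Quad[OF \<phi>])
    then have "(\<integral>x. ?f (case_nat s x) \<partial>Seq) = flow_cost \<phi> h + ?v"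
      by (simp only: lebesgue_integral_const Seq.prob_space[simplified] scaleR_one space_Seq)
    with True h show ?thesis by (simp add: first_cost_def ennreal_less_iff)
  next
    case False
    then have "?f (case_nat s x) = flow_cost \<phi> s + exp (- lam * s) * pathcost val n x (nxt \<phi> s) (ennreal (h - s))" for x
      using s h by (simp add: ennreal_less_iff ennreal_minus)
    then have "(\<integral>x. ?f (case_nat s x) \<partial>Seq) = (\<integral>x. flow_cost \<phi> s + exp (- lam * s) * pathcost val n x (nxt \<phi> s) (ennreal (h - s)) \<partial>Seq)"
      by (simp only:)
    also have "\<dots> = flow_cost \<phi> s + exp (- lam * s) * (\<integral>x. pathcost val n x (nxt \<phi> s) (ennreal (h - s)) \<partial>Seq)"
      using s by (subst Bochner_Integration.integral_add)
        (auto intro!: integrable_mult_right pathcost_integrable vm val_abs nxt_Quad \<phi> simp: Seq.prob_space[simplified])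
    also have "\<dots> \<ge> flow_cost \<phi> s + exp (- lam * s) * val n (nxt \<phi> s)"
      using Suc.IH[of "nxt \<phi> s" "h - s"] False s \<phi> by (simp add: nxt_Quad)
    finally show ?thesis using False s h by (simp add: first_cost_def ennreal_less_iff nxt_Quad[OF \<phi>])
  qed
  have first_cost: "has_bochner_integral Expo (first_cost (val n) (ennreal h) \<phi>) (H (val n) (ennreal h) \<phi>)"
    by (rule first_cost_integral[OF admissible_val \<phi>])
  have ind: "has_bochner_integral Expo (\<lambda>s. ?v * indicator {h<..} s) (?v * exp (- \<mu> * h))"
    using Expo_gt[OF h] by (intro has_bochner_integral_mult_right)
      (auto simp: has_bochner_integral_iff Expo.emeasure_eq_measure)
  have sum: "has_bochner_integral Expo (\<lambda>s. first_cost (val n) (ennreal h) \<phi> s + ?v * indicator {h<..} s)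
      (H (val n) (ennreal h) \<phi> + ?v * exp (- \<mu> * h))"
    by (rule has_bochner_integral_add[OF first_cost ind])
  have "val (Suc n) \<phi> \<le> H (val n) (ennreal h) \<phi> + exp (- (lam + \<mu>) * h) * val (Suc n) (fl h \<phi>)"
    by (rule val_dynamic[OF \<phi> h])
  also have "exp (- (lam + \<mu>) * h) * val (Suc n) (fl h \<phi>) = ?v * exp (- \<mu> * h)"
  proof -
    have "exp (- (lam + \<mu>) * h) = exp (- lam * h) * exp (- \<mu> * h)"
      by (simp add: exp_add[symmetric] algebra_simps)
    then show ?thesis by (simp only: mult_ac)
  qed
  also have "H (val n) (ennreal h) \<phi> + ?v * exp (- \<mu> * h) = (\<integral>s. first_cost (val n) (ennreal h) \<phi> s + ?v * indicator {h<..} s \<partial>Expo)"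
    using sum by (simp only: has_bochner_integral_iff)
  also have "\<dots> \<le> (\<integral>s. (\<integral>x. ?f (case_nat s x) \<partial>Seq) \<partial>Expo)"
  proof (rule integral_mono_AE[OF _ Seq_first(2)[OF fm fi]])
    show "integrable Expo (\<lambda>s. first_cost (val n) (ennreal h) \<phi> s + ?v * indicator {h<..} s)"
      using sum by (simp only: has_bochner_integral_iff)
    show "AE s in Expo. first_cost (val n) (ennreal h) \<phi> s + ?v * indicator {h<..} s \<le> (\<integral>x. ?f (case_nat s x) \<partial>Seq)"
      using AE_Expo_pos by eventually_elim (rule inner)
  qed
  also have "\<dots> = (\<integral>x. ?f x \<partial>Seq)"
    by (rule Seq_first(1)[OF fm fi, symmetric])
  finally show ?case .
qed simp

end

section \<open>Counting paths\<close>

text \<open>Counting paths up to their initial value; unlike \<^const>\<open>counting_path\<close> this is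
  stable under \<^const>\<open>shift\<close>.\<close>

definition cpath :: "(real \<Rightarrow> nat) \<Rightarrow> bool" where
  "cpath p \<longleftrightarrow> counting_path (\<lambda>t. p t - p 0) \<and> (\<forall>t\<ge>0. p 0 \<le> p t)"

definition gaps :: "(real \<Rightarrow> nat) \<Rightarrow> nat \<Rightarrow> real" where
  "gaps p n = jump_time p (Suc n) - jump_time p n"

lemma counting_path_cpath: "counting_path p \<Longrightarrow> cpath p"
  by (auto simp: counting_path_def cpath_def mono_on_def)

context
  fixes p :: "real \<Rightarrow> nat"
  assumes p: "cpath p"
begin

lemma cpath_mono: "0 \<le> s \<Longrightarrow> s \<le> t \<Longrightarrow> p s \<le> p t"
proof -
  assume st: "0 \<le> s" "s \<le> t"
  then have "p s - p 0 \<le> p t - p 0" "p 0 \<le> p s" "p 0 \<le> p t"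
    using p by (auto simp: cpath_def counting_path_def mono_on_def)
  then show ?thesis by linarith
qed

lemma cpath_attains: "\<exists>t\<ge>0. p t = p 0 + n"
proof -
  have "n \<in> (\<lambda>t. p t - p 0) ` {0..}" using p by (auto simp: cpath_def counting_path_def)
  then obtain t where "0 \<le> t" "n = p t - p 0" by auto
  then show ?thesis using cpath_mono[of 0 t] by (intro exI[of _ t]) auto
qed

text \<open>A right limit of an integer-valued path is reached, so right-continuity means being
  constant for a while.\<close>

lemma cpath_right_const:
  assumes "0 \<le> t"
  shows "\<exists>b>t. \<forall>y. t \<le> y \<longrightarrow> y < b \<longrightarrow> p y = p t"
proof -
  let ?q = "\<lambda>t. p t - p 0"
  have "(?q \<longlongrightarrow> ?q t) (at_right t)"
    using p assms by (auto simp: cpath_def counting_path_def continuous_within)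
  then have "\<forall>\<^sub>F y in at_right t. ?q y = ?q t"
    by (simp only: tendsto_discrete)
  then obtain b where b: "b > t" "\<And>y. t < y \<Longrightarrow> y < b \<Longrightarrow> ?q y = ?q t"
    unfolding eventually_at_right_field by auto
  have "p y = p t" if "t \<le> y" "y < b" for y
    using b(2)[of y] that cpath_mono[of 0 y] cpath_mono[of 0 t] assms by (cases "y = t") auto
  with b(1) show ?thesis by blast
qed

text \<open>By right-continuity the infimum that defines the jump time belongs to the set. Every
  statement on jump times becomes one on values of the path through this equivalence.\<close>

lemma jump_time_le_iff:
  assumes "0 \<le> t"
  shows "jump_time p n \<le> t \<longleftrightarrow> p 0 + n \<le> p t"
proof -
  define A where "A = {t. 0 \<le> t \<and> p 0 + n \<le> p t}"
  have ne: "A \<noteq> {}" using cpath_attains[of n] by (auto simp: A_def)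
  have bdd: "bdd_below A" by (auto simp: A_def)
  have a0: "0 \<le> Inf A" using ne by (intro cInf_greatest) (auto simp: A_def)
  have "Inf A \<in> A"
  proof -
    obtain b where b: "b > Inf A" "\<And>y. Inf A \<le> y \<Longrightarrow> y < b \<Longrightarrow> p y = p (Inf A)"
      using cpath_right_const[OF a0] by blast
    obtain y where "y \<in> A" "y < b" using b(1) ne bdd by (auto simp: cInf_less_iff)
    then show ?thesis
      using b(2)[of y] cInf_lower[OF \<open>y \<in> A\<close> bdd] a0 by (auto simp: A_def)
  qed
  then have "Inf A \<le> t \<longleftrightarrow> p 0 + n \<le> p t"
    using assms cpath_mono[of "Inf A" t] cInf_lower[OF _ bdd, of t] by (auto simp: A_def)
  then show ?thesis by (simp add: jump_time_def A_def)
qed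

lemma jump_time_nonneg [simp]: "0 \<le> jump_time p n"
  unfolding jump_time_def using cpath_attains[of n] by (intro cInf_greatest) auto

lemma jump_time_0 [simp]: "jump_time p 0 = 0"
  using jump_time_le_iff[of 0 0] jump_time_nonneg[of 0] by simp

lemma jump_time_less_Suc: "jump_time p n < jump_time p (Suc n)"
proof -
  obtain t where "0 \<le> t" "p t = p 0 + n" using cpath_attains by blast
  then have "jump_time p n \<le> t" "\<not> jump_time p (Suc n) \<le> t"
    using jump_time_le_iff by auto
  then show ?thesis by simp
qed

lemma strict_mono_jump_time: "strict_mono (jump_time p)"
  by (intro strict_monoI_Suc jump_time_less_Suc)

lemma gaps_pos: "0 < gaps p n"
  using jump_time_less_Suc by (simp add: gaps_def)

lemma gaps_0: "gaps p 0 = jump_time p 1"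
  by (simp add: gaps_def)

lemma jump_time_1_pos: "0 < jump_time p 1"
  using gaps_pos[of 0] by (simp add: gaps_0)

lemma count_eq_iff: "0 \<le> t \<Longrightarrow> jump_time p n \<le> t \<and> t < jump_time p (Suc n) \<longleftrightarrow> p t - p 0 = n"
  using jump_time_le_iff[of t n] jump_time_le_iff[of t "Suc n"] cpath_mono[of 0 t] by auto

lemma less_jump_time_iff: "0 \<le> t \<Longrightarrow> t < jump_time p n \<longleftrightarrow> p t - p 0 < n"
  using jump_time_le_iff[of t n] cpath_mono[of 0 t] by auto

lemma count_jump_time: "p (jump_time p n) = p 0 + n"
  using count_eq_iff[of "jump_time p n" n] jump_time_less_Suc[of n] cpath_mono[of 0 "jump_time p n"] by auto

lemma shift_at: "shift s p t = p (s + t)" by (simp add: shift_def)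

lemma cpath_shift:
  assumes s: "0 \<le> s"
  shows "cpath (shift s p)"
  unfolding cpath_def counting_path_def
proof (intro conjI allI impI)
  show "shift s p 0 - shift s p 0 = 0" by simp
  show "mono_on {0..} (\<lambda>t. shift s p t - shift s p 0)"
    using s by (intro mono_onI diff_le_mono) (simp add: shift_at cpath_mono)
  show "shift s p 0 \<le> shift s p t" if "0 \<le> t" for t
  proof -
    have "p (s + 0) \<le> p (s + t)" using s that by (intro cpath_mono) auto
    then show ?thesis by (simp only: shift_at)
  qed
  show "continuous (at_right t) (\<lambda>t. shift s p t - shift s p 0)" if t: "0 \<le> t" for t
  proof -
    obtain b where b: "b > s + t" "\<And>y. s + t \<le> y \<Longrightarrow> y < b \<Longrightarrow> p y = p (s + t)"
      using cpath_right_const[OF add_nonneg_nonneg[OF s t]] by blast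
    have eq: "shift s p y - shift s p 0 = shift s p t - shift s p 0" if "t < y" "y < b - s" for y
      using b(2)[of "s + y"] that by (simp add: shift_at)
    have "\<forall>\<^sub>F y in at_right t. shift s p y - shift s p 0 = shift s p t - shift s p 0"
      unfolding eventually_at_right_field
      using b(1) eq by (intro exI[of _ "b - s"] conjI allI impI) (linarith, blast)
    then show ?thesis unfolding continuous_within by (rule tendsto_eventually)
  qed
  show "(\<lambda>t. shift s p t - shift s p 0) ` {0..} = UNIV"
  proof (intro equalityI subsetI UNIV_I)
    fix n :: nat
    show "n \<in> (\<lambda>t. shift s p t - shift s p 0) ` {0..}"
    proof (cases "n = 0")
      case True
      then show ?thesis by (auto simp: shift_at intro!: image_eqI[of _ _ 0])
    next
      case False
      obtain t where t: "0 \<le> t" "p t = p 0 + ((p s - p 0) + n)" using cpath_attains by blast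
      have "p 0 \<le> p s" using cpath_mono s by simp
      with t have pt: "p t = p s + n" by simp
      have "s \<le> t" using cpath_mono[of t s] t(1) pt False by (cases "s \<le> t") auto
      with pt show ?thesis by (intro image_eqI[of _ _ "t - s"]) (auto simp: shift_at)
    qed
  qed
qed

end

text \<open>The maximum with 0 matters for \<open>n = 0\<close> only: jump number
  \<open>p s - p 0\<close> has already happened by time s, the next ones have not.\<close>

lemma jump_time_shift:
  assumes p: "cpath p" and s: "0 \<le> s"
  shows "jump_time (shift s p) n = max 0 (jump_time p (p s - p 0 + n) - s)"
proof -
  note p' = cpath_shift[OF p s]
  have *: "jump_time (shift s p) n \<le> t \<longleftrightarrow> max 0 (jump_time p (p s - p 0 + n) - s) \<le> t" if "0 \<le> t" for t
    using jump_time_le_iff[OF p' that, of n] jump_time_le_iff[OF p, of "s + t" "p s - p 0 + n"] s that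
      cpath_mono[OF p, of 0 s] by (auto simp: shift_at[OF p])
  from *[of "jump_time (shift s p) n"] *[of "max 0 (jump_time p (p s - p 0 + n) - s)"]
  show ?thesis using jump_time_nonneg[OF p', of n] by (intro antisym) auto
qed

lemma jump_time_shift_pos:
  assumes p: "cpath p" and s: "0 \<le> s" and n: "p s - p 0 < n"
  shows "jump_time (shift s p) (n - (p s - p 0)) = jump_time p n - s"
  using jump_time_shift[OF p s, of "n - (p s - p 0)"] less_jump_time_iff[OF p s, of n] n by simp

lemma jump_time_shift_first:
  assumes p: "cpath p"
  shows "jump_time (shift (jump_time p 1) p) n = jump_time p (Suc n) - jump_time p 1"
  using jump_time_shift[OF p jump_time_nonneg[OF p], of 1 n] count_jump_time[OF p, of 1]
    strict_mono_less_eq[OF strict_mono_jump_time[OF p], of 1 "Suc n"] by simp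

lemma gaps_shift_first: "cpath p \<Longrightarrow> gaps (shift (jump_time p 1) p) = tail (gaps p)"
  by (simp add: fun_eq_iff gaps_def[abs_def] tail_def jump_time_shift_first del: One_nat_def)

text \<open>Lets \<open>shift s p\<close> be exchanged for the path of increments after s, which
  starts at 0 and is again the path of a Poisson process.\<close>

lemma jump_time_zeroed:
  assumes p: "cpath p"
  shows "jump_time (\<lambda>t. p t - p 0) n = jump_time p n"
proof -
  have "n \<le> p t - p 0 \<longleftrightarrow> p 0 + n \<le> p t" if "0 \<le> t" for t
    using cpath_mono[OF p, of 0 t] that by auto
  then have "{t. 0 \<le> t \<and> n \<le> p t - p 0} = {t. 0 \<le> t \<and> p 0 + n \<le> p t}" by auto
  then show ?thesis by (simp add: jump_time_def)
qed

section \<open>The process and its cost along one counting path\<close>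

context pdmp begin

abbreviation PJ where "PJ \<equiv> Phi_jump lam \<mu> m"
abbreviation Ph where "Ph \<equiv> Phi lam \<mu> m"

lemma Ph_eq:
  assumes "cpath p" "0 \<le> t"
  shows "Ph p \<phi> t = fl (t - jump_time p (p t - p 0)) (PJ p \<phi> (p t - p 0))"
  unfolding Phi_def Let_def count_eq_iff[OF assms] by simp

lemma PJ_Quad: "cpath p \<Longrightarrow> \<phi> \<in> Quad \<Longrightarrow> PJ p \<phi> n \<in> Quad"
proof (induction n)
  case (Suc n)
  then show ?case using jump_time_less_Suc[of p n] by (auto intro!: nxt_Quad simp del: mem_Times_iff)
qed simp

lemma Ph_Quad: "cpath p \<Longrightarrow> \<phi> \<in> Quad \<Longrightarrow> 0 \<le> t \<Longrightarrow> Ph p \<phi> t \<in> Quad"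
  using count_eq_iff[of p t "p t - p 0"]
  by (auto simp: Ph_eq simp del: mem_Times_iff intro!: fl_Quad PJ_Quad)

lemma Ph_before: "cpath p \<Longrightarrow> 0 \<le> t \<Longrightarrow> t < jump_time p 1 \<Longrightarrow> Ph p \<phi> t = fl t \<phi>"
  using less_jump_time_iff[of p t 1] by (simp add: Ph_eq)

lemma Ph_first: "cpath p \<Longrightarrow> Ph p \<phi> (jump_time p 1) = nxt \<phi> (jump_time p 1)"
  using count_jump_time[of p 1] by (simp add: Ph_eq)

text \<open>Up to the next jump this is the semigroup property of the flow; from that jump on, the
  states at the jumps of both processes coincide.\<close>

lemma Ph_shift:
  assumes p: "cpath p" and s: "0 \<le> s" and t: "0 \<le> t"
  shows "Ph (shift s p) (Ph p \<phi> s) t = Ph p \<phi> (s + t)"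
proof -
  define k where "k = p s - p 0"
  define \<psi> where "\<psi> = Ph p \<phi> s"
  note p' = cpath_shift[OF p s]
  have ps: "p s = p 0 + k" using cpath_mono[OF p, of 0 s] s by (simp add: k_def)
  have \<psi>: "\<psi> = fl (s - jump_time p k) (PJ p \<phi> k)" unfolding \<psi>_def k_def by (rule Ph_eq[OF p s])
  have jt: "jump_time (shift s p) (Suc j) = jump_time p (k + Suc j) - s" for j
    using jump_time_shift_pos[OF p s, of "k + Suc j"] by (simp add: k_def[symmetric])
  \<comment> \<open>Only indices from 1 on match: the state at index 0 of the shifted path is the
    current state, which generally lies between two jumps.\<close>
  have PJ: "PJ (shift s p) \<psi> (Suc j) = PJ p \<phi> (k + Suc j)" for j
  proof (induction j)
    case 0
    have "PJ (shift s p) \<psi> (Suc 0) = jm (fl (jump_time (shift s p) (Suc 0)) \<psi>)"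
      using p' by simp
    then show ?case by (simp add: jt \<psi> flow_flow)
  next
    case (Suc j)
    have "PJ (shift s p) \<psi> (Suc (Suc j)) =
       jm (fl (jump_time (shift s p) (Suc (Suc j)) - jump_time (shift s p) (Suc j)) (PJ (shift s p) \<psi> (Suc j)))"
      by simp
    then show ?case unfolding Suc.IH jt by simp
  qed
  define k' where "k' = p (s + t) - p s"
  have pst: "p (s + t) = p s + k'" using cpath_mono[OF p, of s "s + t"] s t by (simp add: k'_def)
  have st: "Ph p \<phi> (s + t) = fl (s + t - jump_time p (k + k')) (PJ p \<phi> (k + k'))"
    using Ph_eq[OF p, of "s + t" \<phi>] s t by (simp add: pst ps add.assoc)
  have "Ph (shift s p) \<psi> t = fl (t - jump_time (shift s p) k') (PJ (shift s p) \<psi> k')"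
    using Ph_eq[OF p' t, of \<psi>] by (simp add: shift_at[OF p] k'_def)
  also have "\<dots> = Ph p \<phi> (s + t)"
  proof (cases k')
    case 0
    then show ?thesis using p' by (simp add: st \<psi> flow_flow algebra_simps)
  next
    case (Suc j)
    then show ?thesis unfolding st Suc jt PJ by (simp add: algebra_simps)
  qed
  finally show ?thesis by (simp add: \<psi>_def)
qed

definition cost_rate :: "(real \<Rightarrow> nat) \<Rightarrow> real \<times> real \<Rightarrow> real \<Rightarrow> real" where
  "cost_rate p \<phi> t = exp (- lam * t) * g lam c (Ph p \<phi> t)"

lemma cost_rate_before: "cpath p \<Longrightarrow> 0 \<le> t \<Longrightarrow> t < jump_time p 1 \<Longrightarrow> cost_rate p \<phi> t = rate \<phi> t"
  by (simp add: cost_rate_def rate_def Ph_before)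

lemma cost_rate_shift:
  assumes "cpath p" "0 \<le> s" "0 \<le> t"
  shows "cost_rate p \<phi> (s + t) = exp (- lam * s) * cost_rate (shift s p) (Ph p \<phi> s) t"
proof -
  have "exp (- lam * (s + t)) = exp (- lam * s) * exp (- lam * t)"
    by (simp only: exp_add[symmetric] distrib_left)
  then show ?thesis by (simp add: cost_rate_def Ph_shift[OF assms])
qed

text \<open>Splits off the stage before the first jump and applies the induction hypothesis to the
  path shifted to that jump; measurability of the piecewise defined rate comes out along the
  way.\<close>

lemma cost_rate_integrable_jump:
  "cpath p \<Longrightarrow> \<phi> \<in> Quad \<Longrightarrow> integrable lborel (\<lambda>t. indicator {0..jump_time p n} t * cost_rate p \<phi> t)"
proof (induction n arbitrary: p \<phi>)
  case 0
  then have "(\<lambda>t. indicator {0..jump_time p 0} t * cost_rate p \<phi> t) = (\<lambda>t. indicator {0} t * cost_rate p \<phi> 0)"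
    by (auto simp: fun_eq_iff split: split_indicator)
  moreover have "integrable lborel (\<lambda>t::real. indicator {0} t * cost_rate p \<phi> 0)"
    by (intro integrable_mult_left integrable_real_indicator) auto
  ultimately show ?case by simp
next
  case (Suc n)
  note p = Suc.prems(1) and \<phi> = Suc.prems(2)
  define \<sigma> where "\<sigma> = jump_time p 1"
  define p' where "p' = shift \<sigma> p"
  have \<sigma>: "0 < \<sigma>" using jump_time_1_pos[OF p] by (simp add: \<sigma>_def)
  have jt: "jump_time p' n = jump_time p (Suc n) - \<sigma>"
    unfolding p'_def \<sigma>_def by (rule jump_time_shift_first[OF p])
  have p': "cpath p'" unfolding p'_def using \<sigma> by (intro cpath_shift p) simp
  have \<phi>': "Ph p \<phi> \<sigma> \<in> Quad" using \<sigma> by (intro Ph_Quad p \<phi>) simp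
  have "integrable lborel (\<lambda>t. indicator {0..<\<sigma>} t * rate \<phi> t)"
    using \<sigma> by (intro rate_integrable[OF \<phi>, of \<sigma>]) auto
  \<comment> \<open>The argument \<open>- \<sigma> + 1 * t\<close> is t - \<sigma> in the shape of
    an affine substitution.\<close>
  moreover have "integrable lborel (\<lambda>t. exp (- lam * \<sigma>) * (indicator {0..jump_time p' n} (- \<sigma> + 1 * t) * cost_rate p' (Ph p \<phi> \<sigma>) (- \<sigma> + 1 * t)))"
    using Suc.IH[OF p' \<phi>'] by (intro integrable_mult_right lborel_integrable_real_affine) auto
  ultimately have "integrable lborel (\<lambda>t. indicator {0..<\<sigma>} t * rate \<phi> t +
     exp (- lam * \<sigma>) * (indicator {0..jump_time p' n} (- \<sigma> + 1 * t) * cost_rate p' (Ph p \<phi> \<sigma>) (- \<sigma> + 1 * t)))"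
    by (rule Bochner_Integration.integrable_add)
  also have "(\<lambda>t. indicator {0..<\<sigma>} t * rate \<phi> t +
     exp (- lam * \<sigma>) * (indicator {0..jump_time p' n} (- \<sigma> + 1 * t) * cost_rate p' (Ph p \<phi> \<sigma>) (- \<sigma> + 1 * t))) =
     (\<lambda>t. indicator {0..jump_time p (Suc n)} t * cost_rate p \<phi> t)"
  proof
    fix t
    have "jump_time p 1 \<le> jump_time p (Suc n)"
      using strict_mono_less_eq[OF strict_mono_jump_time[OF p], of 1 "Suc n"] by simp
    then have \<sigma>le: "\<sigma> \<le> jump_time p (Suc n)" by (simp add: \<sigma>_def)
    consider "t < 0" | "0 \<le> t" "t < \<sigma>" | "\<sigma> \<le> t" by linarith
    then show "indicator {0..<\<sigma>} t * rate \<phi> t +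
     exp (- lam * \<sigma>) * (indicator {0..jump_time p' n} (- \<sigma> + 1 * t) * cost_rate p' (Ph p \<phi> \<sigma>) (- \<sigma> + 1 * t)) =
     indicator {0..jump_time p (Suc n)} t * cost_rate p \<phi> t"
    proof cases
      case 1
      with \<sigma> show ?thesis by simp
    next
      case 2
      with \<sigma>le cost_rate_before[OF p, of t \<phi>] show ?thesis by (simp add: \<sigma>_def)
    next
      case 3
      have "cost_rate p \<phi> t = exp (- lam * \<sigma>) * cost_rate p' (Ph p \<phi> \<sigma>) (t - \<sigma>)"
        using cost_rate_shift[OF p, of \<sigma> "t - \<sigma>" \<phi>] 3 \<sigma> by (simp add: p'_def)
      with 3 \<sigma> show ?thesis by (auto simp: jt split: split_indicator)
    qed
  qed
  finally show ?case .
qed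

lemma cost_rate_integrable:
  assumes p: "cpath p" and \<phi>: "\<phi> \<in> Quad" and A: "A \<in> sets borel" "A \<subseteq> {0..T}"
  shows "integrable lborel (\<lambda>t. indicator A t * cost_rate p \<phi> t)"
proof (cases "0 \<le> T")
  case True
  define n where "n = Suc (p T - p 0)"
  have "T < jump_time p n" using less_jump_time_iff[OF p True, of n] by (simp add: n_def)
  then have "A \<subseteq> {0..jump_time p n}" using A(2) by auto
  then have "t \<in> A \<Longrightarrow> t \<in> {0..jump_time p n}" for t by blast
  then have "(\<lambda>t. indicator A t * cost_rate p \<phi> t) = (\<lambda>t. indicator A t *\<^sub>R (indicator {0..jump_time p n} t * cost_rate p \<phi> t))"
    by (auto simp: indicator_def)
  moreover have "integrable lborel \<dots>"
    using A(1) by (intro integrable_mult_indicator cost_rate_integrable_jump p \<phi>) simp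
  ultimately show ?thesis by simp
next
  case False
  with A have "A = {}" by auto
  then show ?thesis by simp
qed

definition cost_upto :: "(real \<Rightarrow> nat) \<Rightarrow> real \<times> real \<Rightarrow> real \<Rightarrow> real" where
  "cost_upto p \<phi> t = (\<integral>s. indicator {0..t} s * cost_rate p \<phi> s \<partial>lborel)"

lemma running_cost_eq: "0 \<le> t \<Longrightarrow> running_cost lam \<mu> c m p \<phi> (ennreal t) = cost_upto p \<phi> t"
  unfolding running_cost_def set_lebesgue_integral_def cost_upto_def cost_rate_def
  by (intro Bochner_Integration.integral_cong) (auto simp: ennreal_le_iff split: split_indicator)

lemma cost_upto_0 [simp]: "cost_upto p \<phi> 0 = 0"
proof -
  have "(\<lambda>u. indicator {0..0} u * cost_rate p \<phi> u) = (\<lambda>u. indicator {0} u * cost_rate p \<phi> 0)"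
    by (auto split: split_indicator)
  then show ?thesis by (simp add: cost_upto_def)
qed

lemma cost_upto_before:
  assumes p: "cpath p" and \<phi>: "\<phi> \<in> Quad" and t: "0 \<le> t" "t \<le> jump_time p 1"
  shows "cost_upto p \<phi> t = flow_cost \<phi> t"
  unfolding cost_upto_def flow_cost_def
proof (rule integral_cong_AE)
  show "AE s in lborel. indicator {0..t} s * cost_rate p \<phi> s = indicator {0..t} s * rate \<phi> s"
    \<comment> \<open>The two rates may differ at the jump time itself, a null set; this is why
      \<open>t = jump_time p 1\<close> is allowed.\<close>
    using AE_lborel_singleton[of "jump_time p 1"]
    by eventually_elim (use t cost_rate_before[OF p] in \<open>auto split: split_indicator\<close>)
  show "(\<lambda>s. indicator {0..t} s * cost_rate p \<phi> s) \<in> borel_measurable lborel"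
    using cost_rate_integrable[OF p \<phi>, of "{0..t}" t] by (intro borel_measurable_integrable) auto
qed measurable

lemma cost_upto_add:
  assumes p: "cpath p" and \<phi>: "\<phi> \<in> Quad" and s: "0 \<le> s" and t: "0 \<le> t"
  shows "cost_upto p \<phi> (s + t) = cost_upto p \<phi> s + exp (- lam * s) * cost_upto (shift s p) (Ph p \<phi> s) t"
proof -
  note p' = cpath_shift[OF p s] and \<phi>' = Ph_Quad[OF p \<phi> s]
  have "cost_upto p \<phi> (s + t) = (\<integral>u. indicator {0..s} u * cost_rate p \<phi> u + indicator {s<..s+t} u * cost_rate p \<phi> u \<partial>lborel)"
    unfolding cost_upto_def using s t
    by (intro Bochner_Integration.integral_cong) (auto split: split_indicator)
  also have "\<dots> = cost_upto p \<phi> s + (\<integral>u. indicator {s<..s+t} u * cost_rate p \<phi> u \<partial>lborel)"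
    unfolding cost_upto_def using s t
    by (intro Bochner_Integration.integral_add cost_rate_integrable[OF p \<phi>, of _ "s + t"]) auto
  also have "(\<integral>u. indicator {s<..s+t} u * cost_rate p \<phi> u \<partial>lborel) = (\<integral>u. indicator {s<..s+t} (s + u) * cost_rate p \<phi> (s + u) \<partial>lborel)"
    using lborel_integral_real_affine[of 1 "\<lambda>u. indicator {s<..s+t} u * cost_rate p \<phi> u" s] by simp
  also have "\<dots> = (\<integral>u. exp (- lam * s) * (indicator {0..t} u * cost_rate (shift s p) (Ph p \<phi> s) u) \<partial>lborel)"
  proof (rule integral_cong_AE)
    have 1: "(\<lambda>u. indicator {s<..s+t} u * cost_rate p \<phi> u) \<in> borel_measurable borel"
    proof -
      have "{s<..s+t} \<subseteq> {0..s+t}" using s by auto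
      from borel_measurable_integrable[OF cost_rate_integrable[OF p \<phi> _ this]] show ?thesis by simp
    qed
    from measurable_compose[OF _ this, of "\<lambda>u. s + u" lborel]
    show "(\<lambda>u. indicator {s<..s+t} (s + u) * cost_rate p \<phi> (s + u)) \<in> borel_measurable lborel" by simp
    show "(\<lambda>u. exp (- lam * s) * (indicator {0..t} u * cost_rate (shift s p) (Ph p \<phi> s) u)) \<in> borel_measurable lborel"
      using cost_rate_integrable[OF p' \<phi>', of "{0..t}" t]
      by (intro borel_measurable_times borel_measurable_const borel_measurable_integrable) auto
    show "AE u in lborel. indicator {s<..s+t} (s + u) * cost_rate p \<phi> (s + u) =
        exp (- lam * s) * (indicator {0..t} u * cost_rate (shift s p) (Ph p \<phi> s) u)"
      using AE_lborel_singleton[of "0::real"]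
    proof eventually_elim
      case (elim u)
      show ?case
        using elim cost_rate_shift[OF p s, of u \<phi>] by (auto split: split_indicator)
    qed
  qed
  also have "\<dots> = exp (- lam * s) * cost_upto (shift s p) (Ph p \<phi> s) t" by (simp add: cost_upto_def)
  finally show ?thesis .
qed

lemma running_cost_min:
  assumes p: "cpath p"
  shows "running_cost lam \<mu> c m p \<phi> (min T (ennreal (jump_time p n))) =
    cost_upto p \<phi> (if T < ennreal (jump_time p n) then enn2real T else jump_time p n)"
proof -
  have "min T (ennreal (jump_time p n)) = ennreal (if T < ennreal (jump_time p n) then enn2real T else jump_time p n)"
    by (cases "T < ennreal (jump_time p n)")
       (auto simp: min_def not_less intro: antisym dest: less_trans[OF _ ennreal_less_top])
  then show ?thesis using jump_time_nonneg[OF p] by (simp add: running_cost_eq)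
qed

text \<open>Solves the recursion of \<open>pathcost\<close> in terms of calendar time. In the
  induction step the path is shifted to its first jump, where the gaps lose their first entry and
  the remaining budget of jumps drops by one.\<close>

lemma pathcost_path:
  "cpath p \<Longrightarrow> \<phi> \<in> Quad \<Longrightarrow>
   pathcost e n (gaps p) \<phi> T =
     (if T < ennreal (jump_time p n)
      then cost_upto p \<phi> (enn2real T) + exp (- lam * enn2real T) * e (n - (p (enn2real T) - p 0)) (Ph p \<phi> (enn2real T))
      else cost_upto p \<phi> (jump_time p n))"
proof (induction n arbitrary: p \<phi> T)
  case 0
  then show ?case by simp
next
  case (Suc n)
  note p = Suc.prems(1) and \<phi> = Suc.prems(2)
  define \<sigma> where "\<sigma> = jump_time p 1"
  define p' where "p' = shift \<sigma> p"
  define \<phi>' where "\<phi>' = nxt \<phi> \<sigma>"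
  have \<sigma>: "0 < \<sigma>" using jump_time_1_pos[OF p] by (simp add: \<sigma>_def)
  have g0: "gaps p 0 = \<sigma>" by (simp add: \<sigma>_def gaps_0[OF p])
  have "jump_time p 1 \<le> jump_time p (Suc n)"
    using strict_mono_less_eq[OF strict_mono_jump_time[OF p], of 1 "Suc n"] by simp
  then have \<sigma>le: "\<sigma> \<le> jump_time p (Suc n)" by (simp add: \<sigma>_def)
  have Ph\<sigma>: "Ph p \<phi> \<sigma> = \<phi>'" unfolding \<phi>'_def \<sigma>_def by (rule Ph_first[OF p])
  have p\<sigma>: "p \<sigma> = Suc (p 0)" using count_jump_time[OF p, of 1] by (simp add: \<sigma>_def)
  show ?case
  proof (cases "T < ennreal \<sigma>")
    case True
    then obtain t where T: "T = ennreal t" "0 \<le> t" "t < \<sigma>"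
      by (cases T) (auto simp: ennreal_less_iff)
    have cost_upto: "cost_upto p \<phi> t = flow_cost \<phi> t" using T by (intro cost_upto_before p \<phi>) (auto simp: \<sigma>_def)
    have Ph: "Ph p \<phi> t = fl t \<phi>" using T by (intro Ph_before p) (auto simp: \<sigma>_def)
    have "p t - p 0 = 0" using less_jump_time_iff[OF p, of t 1] T by (simp add: \<sigma>_def)
    then show ?thesis
      using T \<sigma>le cost_upto Ph fl_Quad[OF \<phi>, of t] by (simp add: g0 ennreal_less_iff)
  next
    case False
    have p': "cpath p'" unfolding p'_def using \<sigma> by (intro cpath_shift p) simp
    have \<phi>': "\<phi>' \<in> Quad" unfolding \<phi>'_def using \<sigma> by (intro nxt_Quad \<phi>) simp
    have jt: "jump_time p' n = jump_time p (Suc n) - \<sigma>"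
      unfolding p'_def \<sigma>_def by (rule jump_time_shift_first[OF p])
    have gt: "tail (gaps p) = gaps p'" unfolding p'_def \<sigma>_def by (rule gaps_shift_first[OF p, symmetric])
    have cost_upto\<sigma>: "cost_upto p \<phi> \<sigma> = flow_cost \<phi> \<sigma>"
      using \<sigma> by (intro cost_upto_before[OF p \<phi>]) (auto simp: \<sigma>_def)
    have cost_upto: "cost_upto p \<phi> u = flow_cost \<phi> \<sigma> + exp (- lam * \<sigma>) * cost_upto p' \<phi>' (u - \<sigma>)" if "\<sigma> \<le> u" for u
      using cost_upto_add[OF p \<phi>, of \<sigma> "u - \<sigma>"] that \<sigma> by (simp add: cost_upto\<sigma> Ph\<sigma> p'_def)
    have lhs: "pathcost e (Suc n) (gaps p) \<phi> T = flow_cost \<phi> \<sigma> + exp (- lam * \<sigma>) * pathcost e n (gaps p') \<phi>' (T - ennreal \<sigma>)"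
      using False by (simp add: g0 gt \<phi>'_def)
    show ?thesis
    proof (cases "T < ennreal (jump_time p (Suc n))")
      case True
      then obtain t where T: "T = ennreal t" "0 \<le> t" "t < jump_time p (Suc n)"
        by (cases T) (auto simp: ennreal_less_iff)
      have t: "\<sigma> \<le> t" using False T by (auto simp: ennreal_less_iff)
      have T': "T - ennreal \<sigma> = ennreal (t - \<sigma>)" using T \<sigma> by (simp add: ennreal_minus)
      have "t - \<sigma> < jump_time p' n" using T jt by simp
      then have "pathcost e n (gaps p') \<phi>' (T - ennreal \<sigma>) = cost_upto p' \<phi>' (t - \<sigma>) +
         exp (- lam * (t - \<sigma>)) * e (n - (p' (t - \<sigma>) - p' 0)) (Ph p' \<phi>' (t - \<sigma>))"
        unfolding Suc.IH[OF p' \<phi>'] T' using t by (simp add: ennreal_less_iff)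
      moreover have "Ph p' \<phi>' (t - \<sigma>) = Ph p \<phi> t"
        using Ph_shift[OF p, of \<sigma> "t - \<sigma>" \<phi>] \<sigma> t by (simp add: Ph\<sigma> p'_def)
      moreover have "n - (p' (t - \<sigma>) - p' 0) = Suc n - (p t - p 0)"
        using cpath_mono[OF p, of \<sigma> t] \<sigma> t p\<sigma> by (simp add: p'_def shift_at[OF p])
      moreover have "exp (- lam * \<sigma>) * exp (- lam * (t - \<sigma>)) = exp (- lam * t)"
        by (simp add: exp_add[symmetric] algebra_simps)
      ultimately show ?thesis
        using True T(1,2) cost_upto[OF t] unfolding lhs
        by (simp add: distrib_left mult.assoc[symmetric])
    next
      case F2: False
      have "\<not> T - ennreal \<sigma> < ennreal (jump_time p' n)"
      proof (cases T)
        case (real t)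
        then have "jump_time p (Suc n) \<le> t" using F2 by (auto simp: ennreal_less_iff)
        with real \<sigma> show ?thesis using jt jump_time_nonneg[OF p', of n] by (simp add: ennreal_minus ennreal_less_iff)
      qed (simp add: ennreal_top_minus)
      then have "pathcost e n (gaps p') \<phi>' (T - ennreal \<sigma>) = cost_upto p' \<phi>' (jump_time p' n)"
        unfolding Suc.IH[OF p' \<phi>'] by simp
      with F2 show ?thesis unfolding lhs by (simp add: cost_upto[OF \<sigma>le] jt)
    qed
  qed
qed

lemma pathcost_path_real:
  "cpath p \<Longrightarrow> \<phi> \<in> Quad \<Longrightarrow> 0 \<le> t \<Longrightarrow>
   pathcost e n (gaps p) \<phi> (ennreal t) =
     (if t < jump_time p n then cost_upto p \<phi> t + exp (- lam * t) * e (n - (p t - p 0)) (Ph p \<phi> t)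
      else cost_upto p \<phi> (jump_time p n))"
  by (simp add: pathcost_path ennreal_less_iff)

lemma pathcost_running_cost:
  assumes "cpath p" "\<phi> \<in> Quad"
  shows "running_cost lam \<mu> c m p \<phi> (min T (ennreal (jump_time p n))) = pathcost zero_payoff n (gaps p) \<phi> T"
  unfolding pathcost_path[OF assms] running_cost_min[OF assms(1)] by simp

text \<open>The pathwise form of the Markov property: while fewer than n jumps have occurred, the
  increment over h is the same functional of the path after s, started at the current state with the
  remaining number of jumps. Afterwards the cost is frozen.\<close>

lemma pathcost_increment:
  assumes p: "cpath p" and \<phi>: "\<phi> \<in> Quad" and s: "0 \<le> s" and h: "0 \<le> h"
  shows "pathcost e n (gaps p) \<phi> (ennreal (s + h)) - pathcost e n (gaps p) \<phi> (ennreal s) =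
    (if p s - p 0 < n
     then exp (- lam * s) * (pathcost e (n - (p s - p 0)) (gaps (shift s p)) (Ph p \<phi> s) (ennreal h)
            - e (n - (p s - p 0)) (Ph p \<phi> s))
     else 0)"
proof (cases "p s - p 0 < n")
  case False
  then have "jump_time p n \<le> s" using less_jump_time_iff[OF p s, of n] by simp
  then show ?thesis using False h s by (simp add: pathcost_path_real[OF p \<phi>] del: ennreal_plus)
next
  case True
  define k where "k = p s - p 0"
  have sn: "s < jump_time p n" using less_jump_time_iff[OF p s, of n] True by simp
  note p' = cpath_shift[OF p s] and \<phi>' = Ph_Quad[OF p \<phi> s]
  have jt: "jump_time (shift s p) (n - k) = jump_time p n - s"
    using jump_time_shift_pos[OF p s True] by (simp add: k_def)
  have "pathcost e n (gaps p) \<phi> (ennreal (s + h)) = cost_upto p \<phi> s + exp (- lam * s) * pathcost e (n - k) (gaps (shift s p)) (Ph p \<phi> s) (ennreal h)"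
  proof (cases "s + h < jump_time p n")
    case True
    have "n - (p (s + h) - p 0) = n - k - (shift s p h - shift s p 0)"
      using cpath_mono[OF p, of s "s + h"] cpath_mono[OF p, of 0 s] s h by (simp add: shift_at[OF p] k_def)
    moreover have "exp (- lam * (s + h)) = exp (- lam * s) * exp (- lam * h)"
      by (simp only: exp_add[symmetric] distrib_left)
    ultimately show ?thesis
      using True s h jt Ph_shift[OF p s h, of \<phi>] cost_upto_add[OF p \<phi> s h]
      by (simp add: pathcost_path_real[OF p \<phi>] pathcost_path_real[OF p' \<phi>'] distrib_left del: ennreal_plus)
  next
    case False
    have "cost_upto p \<phi> (s + (jump_time p n - s)) = cost_upto p \<phi> s + exp (- lam * s) * cost_upto (shift s p) (Ph p \<phi> s) (jump_time p n - s)"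
      using sn by (intro cost_upto_add p \<phi> s) simp
    with False show ?thesis
      using s h jt by (simp add: pathcost_path_real[OF p \<phi>] pathcost_path_real[OF p' \<phi>'] del: ennreal_plus)
  qed
  moreover have "pathcost e n (gaps p) \<phi> (ennreal s) = cost_upto p \<phi> s + exp (- lam * s) * e (n - k) (Ph p \<phi> s)"
    using sn s by (simp add: pathcost_path_real[OF p \<phi>] k_def)
  ultimately show ?thesis using True by (simp add: k_def[symmetric] algebra_simps)
qed

text \<open>Makes the truncation at the n-th jump in \<open>V\<close> harmless for the rule.\<close>

lemma rule_time_le_jump: "cpath p \<Longrightarrow> rule_time n \<epsilon> (gaps p) \<phi> \<le> ennreal (jump_time p n)"
proof (induction n arbitrary: p \<phi> \<epsilon>)
  case (Suc n)
  note p = Suc.prems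
  define \<sigma> where "\<sigma> = jump_time p 1"
  have \<sigma>: "0 < \<sigma>" using jump_time_1_pos[OF p] by (simp add: \<sigma>_def)
  have g0: "gaps p 0 = \<sigma>" by (simp add: \<sigma>_def gaps_0[OF p])
  have "jump_time p 1 \<le> jump_time p (Suc n)"
    using strict_mono_less_eq[OF strict_mono_jump_time[OF p], of 1 "Suc n"] by simp
  then have \<sigma>le: "\<sigma> \<le> jump_time p (Suc n)" by (simp add: \<sigma>_def)
  have p': "cpath (shift \<sigma> p)" using \<sigma> by (intro cpath_shift p) simp
  have jt: "jump_time (shift \<sigma> p) n = jump_time p (Suc n) - \<sigma>"
    unfolding \<sigma>_def by (rule jump_time_shift_first[OF p])
  have gt: "tail (gaps p) = gaps (shift \<sigma> p)" unfolding \<sigma>_def by (rule gaps_shift_first[OF p, symmetric])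
  define \<rho> where "\<rho> = opt_time (val n) (if n = 0 then \<epsilon> else \<epsilon> / 2) (clip \<phi>)"
  have rule_time_eq: "rule_time (Suc n) \<epsilon> (gaps p) \<phi> = (if \<rho> < ennreal \<sigma> then \<rho> else ennreal \<sigma> + rule_time n (\<epsilon> / 2) (gaps (shift \<sigma> p)) (nxt \<phi> \<sigma>))"
    by (simp add: g0 gt \<rho>_def)
  show ?case
  proof (cases "\<rho> < ennreal \<sigma>")
    case True
    then have "\<rho> \<le> ennreal (jump_time p (Suc n))"
      using \<sigma>le by (meson ennreal_leI less_imp_le order_trans)
    with True show ?thesis unfolding rule_time_eq by simp
  next
    case False
    have "ennreal \<sigma> + rule_time n (\<epsilon> / 2) (gaps (shift \<sigma> p)) (nxt \<phi> \<sigma>) \<le> ennreal \<sigma> + ennreal (jump_time (shift \<sigma> p) n)"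
      by (intro add_left_mono Suc.IH p')
    also have "\<dots> = ennreal (jump_time p (Suc n))"
      using \<sigma> \<sigma>le by (simp add: jt flip: ennreal_plus)
    finally show ?thesis unfolding rule_time_eq using False by simp
  qed
qed simp

end

section \<open>The gaps of a Poisson process\<close>

lemma sum_increments_nat:
  fixes f :: "nat \<Rightarrow> nat"
  shows "k \<le> j \<Longrightarrow> (\<And>i. i < j \<Longrightarrow> f i \<le> f (Suc i)) \<Longrightarrow> f k + (\<Sum>i=k..<j. f (Suc i) - f i) = f j"
proof (induction j)
  case (Suc j)
  show ?case
  proof (cases "k = Suc j")
    case False
    then have "f k + (\<Sum>i=k..<j. f (Suc i) - f i) = f j" using Suc by simp
    with Suc.prems(2)[of j] False Suc.prems(1) show ?thesis by simp
  qed simp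
qed simp

lemma nat_sum_measurable:
  fixes f :: "'i \<Rightarrow> 'a \<Rightarrow> nat"
  assumes "\<And>i. i \<in> I \<Longrightarrow> f i \<in> measurable M (count_space UNIV)"
  shows "(\<lambda>x. \<Sum>i\<in>I. f i x) \<in> measurable M (count_space UNIV)"
proof -
  have eq: "measurable M (count_space UNIV) = (borel_measurable M :: ('a \<Rightarrow> nat) set)"
    by (rule measurable_cong_sets) (simp_all add: sets_borel_eq_count_space)
  show ?thesis using assms unfolding eq by (rule borel_measurable_sum)
qed

lemma nat_diff_measurable:
  fixes f g :: "'a \<Rightarrow> nat"
  assumes f: "f \<in> measurable M (count_space UNIV)" and g: "g \<in> measurable M (count_space UNIV)"
  shows "(\<lambda>x. f x - g x) \<in> measurable M (count_space UNIV)"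
proof -
  have "(\<lambda>x. f x - j) \<in> measurable M (count_space UNIV)" for j
    by (rule measurable_compose[OF f]) simp
  then show ?thesis by (rule measurable_compose_countable[OF _ g])
qed

lemma jump_time_measurable:
  assumes "\<And>\<omega>. \<omega> \<in> space K \<Longrightarrow> cpath (\<lambda>t. P t \<omega>)"
    and P: "\<And>t. 0 \<le> t \<Longrightarrow> P t \<in> measurable K (count_space UNIV)"
  shows "(\<lambda>\<omega>. jump_time (\<lambda>t. P t \<omega>) n) \<in> borel_measurable K"
proof (rule borel_measurableI_le)
  fix y
  show "{\<omega> \<in> space K. jump_time (\<lambda>t. P t \<omega>) n \<le> y} \<in> sets K"
  proof (cases "0 \<le> y")
    case True
    have "(\<lambda>\<omega>. P 0 \<omega> + n) \<in> measurable K (count_space UNIV)"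
      by (rule measurable_compose[OF P[OF order_refl]]) simp
    from measurable_sets[OF nat_diff_measurable[OF this P[OF True]], of "{0}"]
    have "{\<omega> \<in> space K. P 0 \<omega> + n \<le> P y \<omega>} \<in> sets K"
      by (simp add: vimage_def Int_def conj_commute)
    also have "{\<omega> \<in> space K. P 0 \<omega> + n \<le> P y \<omega>} = {\<omega> \<in> space K. jump_time (\<lambda>t. P t \<omega>) n \<le> y}"
      using jump_time_le_iff[OF assms(1) True] by blast
    finally show ?thesis .
  next
    case False
    then have "{\<omega> \<in> space K. jump_time (\<lambda>t. P t \<omega>) n \<le> y} = {}"
      using jump_time_nonneg[OF assms(1)] by (auto simp: not_le) (meson less_le_trans not_le)
    then show ?thesis by (simp only: sets.empty_sets)
  qed
qed

text \<open>Stated for an arbitrary space so that it also applies to the sigma-algebra generated by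
  the increments after a fixed time.\<close>

lemma gaps_measurable:
  assumes "\<And>\<omega>. \<omega> \<in> space K \<Longrightarrow> cpath (\<lambda>t. P t \<omega>)"
    and "\<And>t. 0 \<le> t \<Longrightarrow> P t \<in> measurable K (count_space UNIV)"
  shows "(\<lambda>\<omega>. gaps (\<lambda>t. P t \<omega>)) \<in> measurable K borel_seq"
  by (rule measurable_PiM_single')
     (auto simp: gaps_def intro!: borel_measurable_diff jump_time_measurable assms)

text \<open>Needed because subtraction on \<open>nat\<close> truncates: the increments of a shifted
  process agree with the original ones only where the path is monotone, that is on
  \<open>space M\<close>.\<close>

lemma (in prob_space) indep_vars_eq_on_space:
  assumes X: "indep_vars K X I" and eq: "\<And>i \<omega>. i \<in> I \<Longrightarrow> \<omega> \<in> space M \<Longrightarrow> X i \<omega> = Y i \<omega>"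
  shows "indep_vars K Y I"
proof -
  have "Y i \<in> measurable M (K i) \<longleftrightarrow> X i \<in> measurable M (K i)" if "i \<in> I" for i
    using eq[OF that] by (intro measurable_cong) simp
  moreover have "Y i -` A \<inter> space M = X i -` A \<inter> space M" if "i \<in> I" for i A
    using eq[OF that] by auto
  then have "indep_sets (\<lambda>i. {Y i -` A \<inter> space M | A. A \<in> sets (K i)}) I \<longleftrightarrow>
      indep_sets (\<lambda>i. {X i -` A \<inter> space M | A. A \<in> sets (K i)}) I"
    by (intro indep_sets_cong) auto
  ultimately show ?thesis using X unfolding indep_vars_def2 by auto
qed

section \<open>Independence of the past from the increments to come\<close>

context poisson_process begin

definition past :: "real \<Rightarrow> 'a measure" where
  "past t = sigma (space M) {N s -` A \<inter> space M | s A. 0 \<le> s \<and> s \<le> t}"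

lemma space_past [simp]: "space (past t) = space M"
  unfolding past_def by (rule space_measure_of) auto

lemma sets_past: "sets (past t) = sigma_sets (space M) {N s -` A \<inter> space M | s A. 0 \<le> s \<and> s \<le> t}"
  unfolding past_def by (rule sets_measure_of) auto

lemma N_past:
  assumes "0 \<le> s" "s \<le> t"
  shows "N s \<in> measurable (past t) (count_space UNIV)"
proof (rule measurableI)
  fix A :: "nat set"
  have "N s -` A \<inter> space M \<in> sigma_sets (space M) {N s -` A \<inter> space M | s A. 0 \<le> s \<and> s \<le> t}"
    using assms by (intro sigma_sets.Basic) blast
  then show "N s -` A \<inter> space (past t) \<in> sets (past t)" by (simp only: sets_past space_past)
qed simp

lemma N_vimage: "0 \<le> s \<Longrightarrow> N s -` A \<inter> space M \<in> sets M"
  using measurable_N[of s] by (rule measurable_sets) auto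

lemma past_subset: "sets (past t) \<subseteq> sets M"
  unfolding sets_past by (rule sets.sigma_sets_subset, clarify) (rule N_vimage)

lemma measurable_past: "f \<in> measurable (past t) K \<Longrightarrow> f \<in> measurable M K"
  by (rule measurable_from_subalg[of M "past t"]) (simp_all add: subalgebra_def past_subset)

lemma cpaths: "\<omega> \<in> space M \<Longrightarrow> cpath (\<lambda>t. N t \<omega>)"
  by (intro counting_path_cpath paths)

lemma N_0: "\<omega> \<in> space M \<Longrightarrow> N 0 \<omega> = 0"
  using paths by (auto simp: counting_path_def)

lemma N_mono: "\<omega> \<in> space M \<Longrightarrow> 0 \<le> s \<Longrightarrow> s \<le> t \<Longrightarrow> N s \<omega> \<le> N t \<omega>"
  using cpath_mono[OF cpaths] .

lemma increments_measurable: "0 \<le> s \<Longrightarrow> 0 \<le> t \<Longrightarrow> (\<lambda>\<omega>. N t \<omega> - N s \<omega>) \<in> measurable M (count_space UNIV)"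
  by (intro nat_diff_measurable measurable_N)

lemma shifted_process:
  assumes s: "0 \<le> s"
  shows "poisson_process M (\<lambda>t \<omega>. N (s + t) \<omega> - N s \<omega>) \<mu>"
proof unfold_locales
  show "0 < \<mu>" by (rule rate_pos)
  show "(\<lambda>\<omega>. N (s + t) \<omega> - N s \<omega>) \<in> measurable M (count_space UNIV)" if "0 \<le> t" for t
    using s that by (intro increments_measurable) auto
  show "counting_path (\<lambda>t. N (s + t) \<omega> - N s \<omega>)" if "\<omega> \<in> space M" for \<omega>
    using cpath_shift[OF cpaths[OF that] s] by (simp add: cpath_def shift_def)
  have diff: "N (s + t2) \<omega> - N s \<omega> - (N (s + t1) \<omega> - N s \<omega>) = N (s + t2) \<omega> - N (s + t1) \<omega>"
    if "\<omega> \<in> space M" "0 \<le> t1" "t1 < t2" for t1 t2 \<omega>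
    using N_mono[OF that(1), of s "s + t1"] that s by simp
  show "distr M (count_space UNIV) (\<lambda>\<omega>. N (s + t2) \<omega> - N s \<omega> - (N (s + t1) \<omega> - N s \<omega>)) = measure_pmf (poisson_pmf (\<mu> * (t2 - t1)))"
    if "0 \<le> t1" "t1 < t2" for t1 t2
  proof -
    have "distr M (count_space UNIV) (\<lambda>\<omega>. N (s + t2) \<omega> - N s \<omega> - (N (s + t1) \<omega> - N s \<omega>)) =
        distr M (count_space UNIV) (\<lambda>\<omega>. N (s + t2) \<omega> - N (s + t1) \<omega>)"
      by (rule distr_cong) (use diff that in auto)
    then show ?thesis using increments[of "s + t1" "s + t2"] s that by simp
  qed
  show "indep_vars (\<lambda>_. count_space UNIV) (\<lambda>i \<omega>. N (s + ts (Suc i)) \<omega> - N s \<omega> - (N (s + ts i) \<omega> - N s \<omega>)) {..<k}"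
    if "0 \<le> ts 0" "\<forall>i<k. ts i < ts (Suc i)" for ts :: "nat \<Rightarrow> real" and k
  proof -
    have ts0: "0 \<le> ts i" if "i \<le> k" for i
      using that
    proof (induction i)
      case (Suc i)
      then have "0 \<le> ts i" "ts i < ts (Suc i)" using \<open>\<forall>i<k. ts i < ts (Suc i)\<close> by auto
      then show ?case by simp
    qed (use \<open>0 \<le> ts 0\<close> in simp)
    have "indep_vars (\<lambda>_. count_space UNIV) (\<lambda>i \<omega>. N (s + ts (Suc i)) \<omega> - N (s + ts i) \<omega>) {..<k}"
      using independent_increments[of "\<lambda>i. s + ts i" k] s that by simp
    then show ?thesis
      by (rule indep_vars_eq_on_space) (use diff ts0 that in auto)
  qed
qed

text \<open>All times involved are put on one increasing grid. Values up to t are sums of grid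
  increments before t, and increments after t are sums of later ones; disjoint blocks of independent
  increments are independent.\<close>

lemma past_future_prob:
  assumes t: "0 \<le> t" and F: "finite F" "F \<subseteq> {0..t}" and F': "finite F'" "F' \<subseteq> {0..}"
  shows "prob ({\<omega> \<in> space M. \<forall>s\<in>F. N s \<omega> \<in> A s} \<inter> {\<omega> \<in> space M. \<forall>s\<in>F'. N (t + s) \<omega> - N t \<omega> \<in> B s}) =
    prob {\<omega> \<in> space M. \<forall>s\<in>F. N s \<omega> \<in> A s} * prob {\<omega> \<in> space M. \<forall>s\<in>F'. N (t + s) \<omega> - N t \<omega> \<in> B s}"
proof -
  \<comment> \<open>The point 0 makes each past value a sum of increments, and t separates the two
    blocks.\<close>
  define G where "G = insert 0 (insert t (F \<union> (\<lambda>s. t + s) ` F'))"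
  have G: "finite G" "0 \<in> G" "t \<in> G" "F \<subseteq> G" "\<And>s. s \<in> F' \<Longrightarrow> t + s \<in> G" "\<And>s. s \<in> G \<Longrightarrow> 0 \<le> s"
    using F F' t by (auto simp: G_def)
  define xs where "xs = sorted_list_of_set G"
  define ts where "ts i = xs ! i" for i
  define n where "n = length xs - 1"
  have set_xs: "set xs = G" using G(1) by (simp add: xs_def)
  have len: "length xs = Suc n" using G(1,2) by (simp add: n_def xs_def) (metis Suc_pred card_gt_0_iff empty_iff)
  have ts_less: "ts i < ts j" if "i < j" "j \<le> n" for i j
    using strict_sorted_list_of_set[of G] that len unfolding ts_def xs_def[symmetric]
    by (auto simp: sorted_wrt_iff_nth_less)
  have ts_le: "ts i \<le> ts j \<longleftrightarrow> i \<le> j" if "i \<le> n" "j \<le> n" for i j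
    using ts_less[of i j] ts_less[of j i] that by (cases i j rule: linorder_cases) auto
  have ex: "\<exists>i\<le>n. ts i = s" if "s \<in> G" for s
    using that set_xs len by (metis in_set_conv_nth less_Suc_eq_le ts_def)
  then obtain idx where idx: "\<And>s. s \<in> G \<Longrightarrow> idx s \<le> n" "\<And>s. s \<in> G \<Longrightarrow> ts (idx s) = s" by metis
  have tsG: "ts i \<in> G" if "i \<le> n" for i using that len set_xs by (metis less_Suc_eq_le nth_mem ts_def)
  have ts_0: "ts 0 = 0"
    using ts_le[of 0 "idx 0"] idx[OF G(2)] G(6)[OF tsG[of 0]] by simp
  define \<kappa> where "\<kappa> = idx t"
  have \<kappa>: "\<kappa> \<le> n" "ts \<kappa> = t" using idx[OF G(3)] by (auto simp: \<kappa>_def)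
  define X where "X i \<omega> = N (ts (Suc i)) \<omega> - N (ts i) \<omega>" for i \<omega>
  have indep: "indep_vars (\<lambda>_. count_space UNIV) X {..<n}"
    using independent_increments[of ts n] ts_less ts_0 unfolding X_def by simp
  have sum: "N (ts i) \<omega> + (\<Sum>l=i..<j. X l \<omega>) = N (ts j) \<omega>" if "\<omega> \<in> space M" "i \<le> j" "j \<le> n" for i j \<omega>
    unfolding X_def using that G(6) tsG ts_less
    by (intro sum_increments_nat N_mono) (auto intro: less_imp_le)
  let ?P = "Pi\<^sub>M {..<\<kappa>} (\<lambda>_. count_space (UNIV::nat set))" and ?Q = "Pi\<^sub>M {\<kappa>..<n} (\<lambda>_. count_space (UNIV::nat set))"
  let ?U = "\<lambda>\<omega>. restrict (\<lambda>i. X i \<omega>) {..<\<kappa>}" and ?W = "\<lambda>\<omega>. restrict (\<lambda>i. X i \<omega>) {\<kappa>..<n}"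
  have UW: "indep_var ?P ?U ?Q ?W"
    using \<kappa> by (intro indep_var_restrict[OF indep]) auto
  define Xa where "Xa = {u \<in> space ?P. \<forall>s\<in>F. (\<Sum>l=0..<idx s. u l) \<in> A s}"
  define Xb where "Xb = {u \<in> space ?Q. \<forall>s\<in>F'. (\<Sum>l=\<kappa>..<idx (t + s). u l) \<in> B s}"
  have idxF: "idx s \<le> \<kappa>" if "s \<in> F" for s
  proof -
    have "s \<in> G" "s \<le> t" using that F(2) G(4) by auto
    then show ?thesis using idx[of s] \<kappa> ts_le[of "idx s" \<kappa>] by simp
  qed
  have idxF': "\<kappa> \<le> idx (t + s)" "idx (t + s) \<le> n" if "s \<in> F'" for s
    using that F'(2) G(5)[OF that] idx[of "t + s"] \<kappa> ts_le[of \<kappa> "idx (t + s)"] by auto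
  have "{u \<in> space ?P. (\<Sum>l=0..<idx s. u l) \<in> A s} \<in> sets ?P" if "s \<in> F" for s
  proof -
    have "(\<lambda>u. \<Sum>l=0..<idx s. u l) \<in> measurable ?P (count_space UNIV)"
      using idxF[OF that] by (intro nat_sum_measurable measurable_component_singleton) auto
    from measurable_sets[OF this, of "A s"] show ?thesis by (simp add: vimage_def Int_def conj_commute)
  qed
  then have Xa: "Xa \<in> sets ?P"
    unfolding Xa_def using F(1) by (intro sets.sets_Collect_finite_All) auto
  have "{u \<in> space ?Q. (\<Sum>l=\<kappa>..<idx (t + s). u l) \<in> B s} \<in> sets ?Q" if "s \<in> F'" for s
  proof -
    have "(\<lambda>u. \<Sum>l=\<kappa>..<idx (t + s). u l) \<in> measurable ?Q (count_space UNIV)"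
      using idxF'[OF that] by (intro nat_sum_measurable measurable_component_singleton) auto
    from measurable_sets[OF this, of "B s"] show ?thesis by (simp add: vimage_def Int_def conj_commute)
  qed
  then have Xb: "Xb \<in> sets ?Q"
    unfolding Xb_def using F'(1) by (intro sets.sets_Collect_finite_All) auto
  have sp: "?U \<omega> \<in> space ?P" "?W \<omega> \<in> space ?Q" for \<omega> by (auto simp: space_PiM)
  have "(\<Sum>l=0..<idx s. ?U \<omega> l) = N s \<omega>" if "\<omega> \<in> space M" "s \<in> F" for \<omega> s
  proof -
    have "(\<Sum>l=0..<idx s. ?U \<omega> l) = (\<Sum>l=0..<idx s. X l \<omega>)"
      using idxF[OF that(2)] by (intro sum.cong) auto
    then show ?thesis
      using sum[OF that(1), of 0 "idx s"] N_0[OF that(1)] ts_0 idx[of s] that(2) G(4) by auto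
  qed
  then have Ua: "?U -` Xa \<inter> space M = {\<omega> \<in> space M. \<forall>s\<in>F. N s \<omega> \<in> A s}"
    using sp(1) by (auto simp: Xa_def)
  have "(\<Sum>l=\<kappa>..<idx (t + s). ?W \<omega> l) = N (t + s) \<omega> - N t \<omega>" if "\<omega> \<in> space M" "s \<in> F'" for \<omega> s
  proof -
    have "(\<Sum>l=\<kappa>..<idx (t + s). ?W \<omega> l) = (\<Sum>l=\<kappa>..<idx (t + s). X l \<omega>)"
      using idxF'[OF that(2)] by (intro sum.cong) auto
    then show ?thesis
      using sum[OF that(1) idxF'[OF that(2)]] \<kappa>(2) idx(2)[OF G(5)[OF that(2)]] by simp
  qed
  then have Wb: "?W -` Xb \<inter> space M = {\<omega> \<in> space M. \<forall>s\<in>F'. N (t + s) \<omega> - N t \<omega> \<in> B s}"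
    using sp(2) by (auto simp: Xb_def)
  have "(\<lambda>\<omega>. (?U \<omega>, ?W \<omega>)) -` (Xa \<times> Xb) \<inter> space M = (?U -` Xa \<inter> space M) \<inter> (?W -` Xb \<inter> space M)" by auto
  then show ?thesis
    using indep_varD[OF UW Xa Xb] unfolding Ua Wb by simp
qed

text \<open>Cylinder events are stable under intersection and generate both sigma-algebras, so the
  product formula for cylinders extends.\<close>

lemma past_future_indep:
  assumes t: "0 \<le> t"
  shows "indep_set (sets (past t)) (sigma_sets (space M) {(\<lambda>\<omega>. N (t + s) \<omega> - N t \<omega>) -` B \<inter> space M | s B. 0 \<le> s})"
proof -
  define PA where "PA = {{\<omega> \<in> space M. \<forall>s\<in>F. N s \<omega> \<in> A s} | F A. finite F \<and> F \<subseteq> {0..t}}"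
  define PB where "PB = {{\<omega> \<in> space M. \<forall>s\<in>F. N (t + s) \<omega> - N t \<omega> \<in> A s} | F A. finite F \<and> F \<subseteq> {0..}}"
  have Int_stable: "Int_stable {{\<omega> \<in> space M. \<forall>s\<in>F. P s \<omega> \<in> A s} | F A. finite F \<and> F \<subseteq> U}"
    for P :: "real \<Rightarrow> 'a \<Rightarrow> nat" and U
  proof (rule Int_stableI)
    fix a b
    assume "a \<in> {{\<omega> \<in> space M. \<forall>s\<in>F. P s \<omega> \<in> A s} | F A. finite F \<and> F \<subseteq> U}"
      "b \<in> {{\<omega> \<in> space M. \<forall>s\<in>F. P s \<omega> \<in> A s} | F A. finite F \<and> F \<subseteq> U}"
    then obtain F A F' A' where *: "finite F" "F \<subseteq> U" "finite F'" "F' \<subseteq> U"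
      "a = {\<omega> \<in> space M. \<forall>s\<in>F. P s \<omega> \<in> A s}" "b = {\<omega> \<in> space M. \<forall>s\<in>F'. P s \<omega> \<in> A' s}" by blast
    \<comment> \<open>A time that occurs in only one of the two cylinders is constrained by that one
      alone.\<close>
    define A'' where "A'' s = (if s \<in> F then A s else UNIV) \<inter> (if s \<in> F' then A' s else UNIV)" for s
    have "a \<inter> b = {\<omega> \<in> space M. \<forall>s\<in>F \<union> F'. P s \<omega> \<in> A'' s}"
      using *(5,6) by (auto simp: A''_def)
    with * show "a \<inter> b \<in> {{\<omega> \<in> space M. \<forall>s\<in>F. P s \<omega> \<in> A s} | F A. finite F \<and> F \<subseteq> U}"
      by (intro CollectI exI[of _ "F \<union> F'"] exI[of _ A'']) auto
  qed
  have fin_meas: "{\<omega> \<in> space M. \<forall>s\<in>F. P s \<omega> \<in> A s} \<in> sets M"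
    if "finite F" "\<And>s. s \<in> F \<Longrightarrow> P s \<in> measurable M (count_space UNIV)" for F A and P :: "real \<Rightarrow> 'a \<Rightarrow> nat"
  proof (rule sets.sets_Collect_finite_All)
    fix s assume "s \<in> F"
    from measurable_sets[OF that(2)[OF this], of "A s"]
    show "{\<omega> \<in> space M. P s \<omega> \<in> A s} \<in> sets M" by (simp add: vimage_def Int_def conj_commute)
  qed fact
  have "indep_set PA PB"
    unfolding indep_sets2_eq
  proof (intro conjI ballI)
    show "PA \<subseteq> events"
      unfolding PA_def by (auto intro!: fin_meas measurable_N simp: subset_eq)
    show "PB \<subseteq> events"
      unfolding PB_def using t by (auto intro!: fin_meas increments_measurable simp: subset_eq)
    fix a b assume "a \<in> PA" "b \<in> PB"
    then show "prob (a \<inter> b) = prob a * prob b"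
      unfolding PA_def PB_def using past_future_prob[OF t] by blast
  qed
  then have *: "indep_set (sigma_sets (space M) PA) (sigma_sets (space M) PB)"
  proof (rule indep_set_sigma_sets)
    show "Int_stable PA" unfolding PA_def by (rule Int_stable)
    show "Int_stable PB" unfolding PB_def by (rule Int_stable[of "\<lambda>s \<omega>. N (t + s) \<omega> - N t \<omega>"])
  qed
  have subA: "sets (past t) \<subseteq> sigma_sets (space M) PA"
    unfolding sets_past
  proof (rule sigma_sets_mono, safe)
    fix s A assume "0 \<le> s" "s \<le> t"
    then have "{\<omega> \<in> space M. \<forall>s\<in>{s}. N s \<omega> \<in> A} \<in> PA"
      unfolding PA_def by (intro CollectI exI[of _ "{s}"] exI[of _ "\<lambda>_. A"]) auto
    then show "N s -` A \<inter> space M \<in> sigma_sets (space M) PA"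
      by (intro sigma_sets.Basic) (simp add: vimage_def Int_def conj_commute)
  qed
  have subB: "sigma_sets (space M) {(\<lambda>\<omega>. N (t + s) \<omega> - N t \<omega>) -` B \<inter> space M | s B. 0 \<le> s} \<subseteq> sigma_sets (space M) PB"
  proof (rule sigma_sets_mono, safe)
    fix s :: real and B :: "nat set" assume "0 \<le> s"
    then have "{\<omega> \<in> space M. \<forall>s\<in>{s}. N (t + s) \<omega> - N t \<omega> \<in> B} \<in> PB"
      unfolding PB_def by (intro CollectI exI[of _ "{s}"] exI[of _ "\<lambda>_. B"]) auto
    then show "(\<lambda>\<omega>. N (t + s) \<omega> - N t \<omega>) -` B \<inter> space M \<in> sigma_sets (space M) PB"
      by (intro sigma_sets.Basic) (simp add: vimage_def Int_def conj_commute)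
  qed
  from * subA subB show ?thesis unfolding indep_sets2_eq by blast
qed

lemma gaps_shift_eq:
  assumes "0 \<le> t" "\<omega> \<in> space M"
  shows "gaps (\<lambda>s. N (t + s) \<omega> - N t \<omega>) = gaps (shift t (\<lambda>s. N s \<omega>))"
  using jump_time_zeroed[OF cpath_shift[OF cpaths[OF assms(2)] assms(1)]]
  by (simp add: gaps_def[abs_def] shift_def)

lemma gaps_N_measurable: "(\<lambda>\<omega>. gaps (\<lambda>t. N t \<omega>)) \<in> measurable M borel_seq"
  by (intro gaps_measurable cpaths measurable_N)

text \<open>The gaps after time t are functionals of the increments after t only.\<close>

lemma past_gaps_indep:
  assumes t: "0 \<le> t" and D: "D \<in> sets (past t)" and C: "C \<in> sets borel_seq"
  shows "prob (D \<inter> {\<omega> \<in> space M. gaps (shift t (\<lambda>s. N s \<omega>)) \<in> C}) =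
    prob D * prob {\<omega> \<in> space M. gaps (shift t (\<lambda>s. N s \<omega>)) \<in> C}"
proof -
  interpret N': poisson_process M "\<lambda>s \<omega>. N (t + s) \<omega> - N t \<omega>" \<mu> by (rule shifted_process[OF t])
  let ?FG = "{(\<lambda>\<omega>. N (t + s) \<omega> - N t \<omega>) -` B \<inter> space M | s B. 0 \<le> s}"
  define Fu where "Fu = sigma (space M) ?FG"
  have space_Fu: "space Fu = space M" unfolding Fu_def by (rule space_measure_of) auto
  have sets_Fu: "sets Fu = sigma_sets (space M) ?FG" unfolding Fu_def by (rule sets_measure_of) auto
  have Y: "(\<lambda>\<omega>. gaps (\<lambda>s. N (t + s) \<omega> - N t \<omega>)) \<in> measurable Fu borel_seq"
  proof (rule gaps_measurable)
    show "(\<lambda>\<omega>. N (t + s) \<omega> - N t \<omega>) \<in> measurable Fu (count_space UNIV)" if "0 \<le> s" for s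
    proof (rule measurableI)
      fix A :: "nat set"
      have "(\<lambda>\<omega>. N (t + s) \<omega> - N t \<omega>) -` A \<inter> space M \<in> sigma_sets (space M) ?FG"
        using that by (intro sigma_sets.Basic) blast
      then show "(\<lambda>\<omega>. N (t + s) \<omega> - N t \<omega>) -` A \<inter> space Fu \<in> sets Fu" by (simp only: sets_Fu space_Fu)
    qed simp
  qed (simp add: space_Fu N'.cpaths)
  have "{\<omega> \<in> space M. gaps (shift t (\<lambda>s. N s \<omega>)) \<in> C} = (\<lambda>\<omega>. gaps (\<lambda>s. N (t + s) \<omega> - N t \<omega>)) -` C \<inter> space Fu"
    using gaps_shift_eq[OF t] by (auto simp: space_Fu)
  also have "\<dots> \<in> sigma_sets (space M) ?FG"
    using measurable_sets[OF Y C] by (simp only: sets_Fu)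
  finally show ?thesis
    using past_future_indep[OF t] D unfolding indep_sets2_eq by blast
qed

end

section \<open>The gaps are independent and exponential\<close>

lemma gaps_shift:
  assumes p: "cpath p" and s: "0 \<le> s"
  defines "k \<equiv> p s - p 0"
  shows "gaps (shift s p) 0 = jump_time p (Suc k) - s"
    and "gaps (shift s p) (Suc i) = gaps p (k + Suc i)"
proof -
  have "jump_time (shift s p) (Suc j) = jump_time p (k + Suc j) - s" for j
    using jump_time_shift_pos[OF p s, of "k + Suc j"] by (simp add: k_def)
  then show "gaps (shift s p) 0 = jump_time p (Suc k) - s" "gaps (shift s p) (Suc i) = gaps p (k + Suc i)"
    using jump_time_0[OF cpath_shift[OF p s]] by (simp_all add: gaps_def)
qed

text \<open>The law of \<open>Y\<close> on the event \<open>B\<close> is a finite measure with the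
  tails of c times the exponential law, and tails determine it. Since \<open>Y\<close> is positive,
  c is the probability of \<open>B\<close>, so this is independence as well as
  exponentiality.\<close>

lemma (in prob_space) exponential_independent_of_event:
  assumes a: "0 < a" and Y [measurable]: "Y \<in> borel_measurable M" and B [measurable]: "B \<in> events"
    and pos: "\<And>\<omega>. \<omega> \<in> space M \<Longrightarrow> 0 < Y \<omega>" and c: "0 \<le> c"
    and gt: "\<And>t. 0 \<le> t \<Longrightarrow> prob {\<omega> \<in> space M. t < Y \<omega> \<and> \<omega> \<in> B} = exp (- a * t) * c"
    and A [measurable]: "A \<in> sets borel"
  shows "prob {\<omega> \<in> space M. Y \<omega> \<in> A \<and> \<omega> \<in> B} = measure (expo a) A * c"
proof -
  let ?E = "expo a"
  interpret E: prob_space ?E using a by (rule prob_space_exponential_density)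
  define K1 where "K1 = distr (density M (indicator B)) borel Y"
  define K2 where "K2 = scale_measure (ennreal c) ?E"
  have K1: "emeasure K1 C = ennreal (prob {\<omega> \<in> space M. Y \<omega> \<in> C \<and> \<omega> \<in> B})" if [measurable]: "C \<in> sets borel" for C
  proof -
    have "emeasure K1 C = emeasure (density M (indicator B)) (Y -` C \<inter> space M)"
      unfolding K1_def by (subst emeasure_distr) (auto simp: measurable_density_eq2)
    also have "\<dots> = (\<integral>\<^sup>+\<omega>. indicator B \<omega> * indicator (Y -` C \<inter> space M) \<omega> \<partial>M)"
      by (rule emeasure_density) auto
    also have "\<dots> = (\<integral>\<^sup>+\<omega>. indicator {\<omega> \<in> space M. Y \<omega> \<in> C \<and> \<omega> \<in> B} \<omega> \<partial>M)"
      by (rule nn_integral_cong) (auto split: split_indicator)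
    also have "\<dots> = emeasure M {\<omega> \<in> space M. Y \<omega> \<in> C \<and> \<omega> \<in> B}"
      by (rule nn_integral_indicator) measurable
    finally show ?thesis by (simp add: emeasure_eq_measure)
  qed
  have K2: "emeasure K2 C = ennreal (c * measure ?E C)" for C
    using c by (simp add: K2_def E.emeasure_eq_measure ennreal_mult)
  have "K1 = K2"
  proof (rule measure_eqI_lessThan)
    fix t
    show "emeasure K1 {t<..} < \<infinity>" by (simp add: K1)
    show "emeasure K1 {t<..} = emeasure K2 {t<..}"
    proof (cases "0 \<le> t")
      case True
      then show ?thesis
        using gt[OF True] exponential_measure_gt[OF a True] by (simp add: K1 K2 mult.commute)
    next
      case False
      have "measure ?E {t<..} \<ge> measure ?E {0<..}"
        using False by (intro E.finite_measure_mono) auto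
      moreover have "measure ?E {0<..} = 1" using exponential_measure_gt[OF a, of 0] by simp
      ultimately have 1: "measure ?E {t<..} = 1" using E.prob_le_1[of "{t<..}"] by simp
      have "{\<omega> \<in> space M. t < Y \<omega> \<and> \<omega> \<in> B} = {\<omega> \<in> space M. 0 < Y \<omega> \<and> \<omega> \<in> B}"
        using pos False by (auto intro: less_trans[of t 0])
      with gt[of 0] 1 show ?thesis by (simp add: K1 K2)
    qed
  qed (simp_all add: K1_def K2_def)
  then have "ennreal (prob {\<omega> \<in> space M. Y \<omega> \<in> A \<and> \<omega> \<in> B}) = ennreal (c * measure ?E A)"
    using K1[OF A] K2[of A] by simp
  then show ?thesis using c by (simp add: mult.commute)
qed

context poisson_process begin

abbreviation path :: "'a \<Rightarrow> real \<Rightarrow> nat" where "path \<omega> \<equiv> (\<lambda>t. N t \<omega>)"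

lemma gaps_shift_measurable: "0 \<le> t \<Longrightarrow> (\<lambda>\<omega>. gaps (shift t (path \<omega>))) \<in> measurable M borel_seq"
  using poisson_process.gaps_N_measurable[OF shifted_process, of t] gaps_shift_eq[of t]
  by (simp cong: measurable_cong)

lemma no_jump_prob:
  assumes t: "0 \<le> t"
  shows "prob {\<omega> \<in> space M. N t \<omega> = 0} = exp (- \<mu> * t)"
proof (cases "t = 0")
  case True
  then have "{\<omega> \<in> space M. N t \<omega> = 0} = space M" using N_0 by auto
  with True show ?thesis by (simp add: prob_space)
next
  case False
  then have t: "0 < t" using t by simp
  have "prob {\<omega> \<in> space M. N t \<omega> = 0} = measure (distr M (count_space UNIV) (\<lambda>\<omega>. N t \<omega> - N 0 \<omega>)) {0}"
    using increments_measurable[of 0 t] t N_0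
    by (subst measure_distr) (auto intro!: arg_cong[where f=prob])
  also have "\<dots> = pmf (poisson_pmf (\<mu> * (t - 0))) 0"
    unfolding increments[OF order_refl t] by (simp add: measure_pmf_single)
  also have "\<dots> = exp (- \<mu> * t)" using rate_pos t by simp
  finally show ?thesis .
qed

lemma gap_component_measurable [measurable]: "(\<lambda>\<omega>. gaps (path \<omega>) i) \<in> borel_measurable M"
  by (rule component_measurable[OF gaps_N_measurable])

lemma no_jump_past: "0 \<le> s \<Longrightarrow> s \<le> t \<Longrightarrow> {\<omega> \<in> space M. N s \<omega> \<in> A} \<in> sets (past t)"
  using measurable_sets[OF N_past, of s t A] by (simp add: vimage_def Int_def conj_commute)

lemma first_jump_past:
  assumes "0 \<le> a" "a \<le> b"
  shows "{\<omega> \<in> space M. a < jump_time (path \<omega>) 1 \<and> jump_time (path \<omega>) 1 \<le> b} \<in> sets (past b)"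
proof -
  have "{\<omega> \<in> space M. a < jump_time (path \<omega>) 1 \<and> jump_time (path \<omega>) 1 \<le> b} =
     {\<omega> \<in> space M. N a \<omega> \<in> {0}} \<inter> {\<omega> \<in> space M. N b \<omega> \<in> {1..}}"
  proof (intro set_eqI)
    fix \<omega>
    show "\<omega> \<in> {\<omega> \<in> space M. a < jump_time (path \<omega>) 1 \<and> jump_time (path \<omega>) 1 \<le> b} \<longleftrightarrow>
       \<omega> \<in> {\<omega> \<in> space M. N a \<omega> \<in> {0}} \<inter> {\<omega> \<in> space M. N b \<omega> \<in> {1..}}"
    proof (cases "\<omega> \<in> space M")
      case True
      then show ?thesis
        using less_jump_time_iff[OF cpaths[OF True], of a 1] jump_time_le_iff[OF cpaths[OF True], of b 1] N_0[OF True] assms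
        by simp
    qed simp
  qed
  also have "\<dots> \<in> sets (past b)" using assms by (intro sets.Int no_jump_past) auto
  finally show ?thesis .
qed

text \<open>Discretising the first jump time upwards to the grid \<open>h \<int>\<close> turns the strong Markov
  property at that time into the Markov property at the deterministic grid times; the gap that
  follows is then shortened by at most \<open>h\<close>.\<close>

lemma second_gap_sandwich:
  assumes t: "0 \<le> t" and h: "0 < h" and C: "C \<in> sets borel_seq"
    and q: "\<And>s. 0 \<le> s \<Longrightarrow> prob {\<omega> \<in> space M. t < gaps (shift s (path \<omega>)) 0 \<and> tail (gaps (shift s (path \<omega>))) \<in> C} = q"
  defines "B \<equiv> {\<omega> \<in> space M. tail (tail (gaps (path \<omega>))) \<in> C}"
  shows "prob {\<omega> \<in> space M. t + h < gaps (path \<omega>) 1 \<and> \<omega> \<in> B} \<le> q"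
    and "q \<le> prob {\<omega> \<in> space M. t < gaps (path \<omega>) 1 \<and> \<omega> \<in> B} + prob {\<omega> \<in> space M. gaps (path \<omega>) 1 \<le> h}"
proof -
  have B [measurable]: "B \<in> events"
    using measurable_sets[OF tail_measurable[OF tail_measurable[OF gaps_N_measurable]] C]
    by (simp add: B_def vimage_def Int_def conj_commute)
  define D where "D j = {\<omega> \<in> space M. real j * h < jump_time (path \<omega>) 1 \<and> jump_time (path \<omega>) 1 \<le> real (Suc j) * h}" for j
  define Ct where "Ct = {x \<in> space borel_seq. t < x 0 \<and> tail x \<in> C}"
  have Ct: "Ct \<in> sets borel_seq"
  proof -
    have 1: "(\<lambda>x. x 0) \<in> borel_measurable borel_seq"
      by (rule component_measurable) simp
    have 2: "tail \<in> measurable borel_seq borel_seq"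
      by (rule tail_measurable) simp
    have "Ct = ((\<lambda>x. x 0) -` {t<..} \<inter> space borel_seq) \<inter> (tail -` C \<inter> space borel_seq)"
      by (auto simp: Ct_def)
    then show ?thesis using measurable_sets[OF 1, of "{t<..}"] measurable_sets[OF 2 C] by auto
  qed
  define F where "F j = {\<omega> \<in> space M. gaps (shift (real (Suc j) * h) (path \<omega>)) \<in> Ct}" for j
  have F_eq: "F j = {\<omega> \<in> space M. t < gaps (shift (real (Suc j) * h) (path \<omega>)) 0 \<and> tail (gaps (shift (real (Suc j) * h) (path \<omega>))) \<in> C}" for j
    by (auto simp: F_def Ct_def space_PiM)
  have Dp: "D j \<in> sets (past (real (Suc j) * h))" for j
    unfolding D_def using h by (intro first_jump_past mult_right_mono) auto
  then have D: "D j \<in> events" for j using past_subset by blast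
  have F: "F j \<in> events" for j
    using measurable_sets[OF gaps_shift_measurable Ct, of "real (Suc j) * h"] h
    by (simp add: F_def vimage_def Int_def conj_commute)
  \<comment> \<open>\<open>D j\<close> is decided by the grid time that ends the cell, and
    \<open>F j\<close> by the gaps after it. The value q is the same at all grid times, so summing
    over the cells yields q.\<close>
  have DF: "prob (D j \<inter> F j) = prob (D j) * q" for j
    using past_gaps_indep[OF _ Dp Ct, of j] q[of "real (Suc j) * h"] h unfolding F_eq[symmetric] by (simp add: F_def)
  have D_ex: "\<exists>j. \<omega> \<in> D j" if \<omega>: "\<omega> \<in> space M" for \<omega>
  proof -
    define \<sigma> where "\<sigma> = jump_time (path \<omega>) 1"
    have \<sigma>: "0 < \<sigma>" unfolding \<sigma>_def by (rule jump_time_1_pos[OF cpaths[OF \<omega>]])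
    define j where "j = nat (\<lceil>\<sigma> / h\<rceil> - 1)"
    have "0 < \<sigma> / h" using \<sigma> h by simp
    then have "1 \<le> \<lceil>\<sigma> / h\<rceil>" by linarith
    then have "real j = real_of_int \<lceil>\<sigma> / h\<rceil> - 1" by (simp add: j_def)
    then have "real j < \<sigma> / h" "\<sigma> / h \<le> real (Suc j)" by linarith+
    then have "real j * h < \<sigma>" "\<sigma> \<le> real (Suc j) * h" using h by (simp_all add: field_simps)
    then show ?thesis using \<omega> by (auto simp: D_def \<sigma>_def)
  qed
  have disj: "disjoint_family D"
    unfolding disjoint_family_on_def
  proof (intro ballI impI, rule ccontr)
    fix i j assume ij: "i \<noteq> (j::nat)" and "D i \<inter> D j \<noteq> {}"
    then obtain \<omega> where "\<omega> \<in> D i" "\<omega> \<in> D j" by blast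
    then have "real i * h < real (Suc j) * h" "real j * h < real (Suc i) * h"
      by (auto simp: D_def simp del: of_nat_Suc)
    then have "real i < real (Suc j)" "real j < real (Suc i)" using h by (auto simp del: of_nat_Suc)
    with ij show False by linarith
  qed
  have "(\<lambda>j. prob (D j)) sums prob (\<Union>j. D j)"
    using D disj by (intro finite_measure_UNION) auto
  moreover have "(\<Union>j. D j) = space M" using D_ex by (auto simp: D_def)
  ultimately have "(\<lambda>j. prob (D j)) sums 1" by (simp add: prob_space)
  then have "(\<lambda>j. prob (D j \<inter> F j)) sums (1 * q)" unfolding DF by (rule sums_mult2)
  moreover have "(\<lambda>j. prob (D j \<inter> F j)) sums prob (\<Union>j. D j \<inter> F j)"
    using D F disj by (intro finite_measure_UNION) (auto simp: disjoint_family_on_def, blast)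
  ultimately have U: "prob (\<Union>j. D j \<inter> F j) = q" using sums_unique2 by fastforce
  have Um: "(\<Union>j. D j \<inter> F j) \<in> events" using D F by auto
  \<comment> \<open>If the second gap is at least h, the grid time s lies before the second jump.
    The first gap seen from s is then the second gap minus the overshoot of s over the first jump,
    which is less than h.\<close>
  have key: "gaps (shift s (path \<omega>)) 0 = jump_time (path \<omega>) 1 + gaps (path \<omega>) 1 - s"
      "tail (gaps (shift s (path \<omega>))) = tail (tail (gaps (path \<omega>)))"
    if "\<omega> \<in> D j" "s = real (Suc j) * h" "h \<le> gaps (path \<omega>) 1" for \<omega> j s
  proof -
    note p = cpaths[of \<omega>]
    have \<omega>: "\<omega> \<in> space M" and \<sigma>: "real j * h < jump_time (path \<omega>) 1" "jump_time (path \<omega>) 1 \<le> s"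
      using that by (auto simp: D_def)
    have s: "0 \<le> s" using that h by simp
    have s2: "s < jump_time (path \<omega>) 2"
      using \<sigma> that(2,3) by (simp add: gaps_def algebra_simps numeral_2_eq_2)
    have k: "N s \<omega> - N 0 \<omega> = 1"
      using count_eq_iff[OF p[OF \<omega>] s, of 1] \<sigma>(2) s2 by (simp add: numeral_2_eq_2)
    show "gaps (shift s (path \<omega>)) 0 = jump_time (path \<omega>) 1 + gaps (path \<omega>) 1 - s"
      using gaps_shift(1)[OF p[OF \<omega>] s] k by (simp add: gaps_def)
    show "tail (gaps (shift s (path \<omega>))) = tail (tail (gaps (path \<omega>)))"
      using gaps_shift(2)[OF p[OF \<omega>] s] k by (simp add: tail_def fun_eq_iff)
  qed
  have D_h: "real (Suc j) * h < jump_time (path \<omega>) 1 + h" "jump_time (path \<omega>) 1 \<le> real (Suc j) * h" if "\<omega> \<in> D j" for \<omega> j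
    using that by (auto simp: D_def algebra_simps)
  have "{\<omega> \<in> space M. t + h < gaps (path \<omega>) 1 \<and> \<omega> \<in> B} \<subseteq> (\<Union>j. D j \<inter> F j)"
  proof safe
    fix \<omega> assume \<omega>: "\<omega> \<in> space M" "t + h < gaps (path \<omega>) 1" "\<omega> \<in> B"
    obtain j where j: "\<omega> \<in> D j" using D_ex[OF \<omega>(1)] ..
    have "h \<le> gaps (path \<omega>) 1" using \<omega> t by simp
    from key[OF j refl this] D_h[OF j] \<omega> have "\<omega> \<in> F j" unfolding F_eq by (simp add: B_def del: of_nat_Suc)
    with j show "\<omega> \<in> (\<Union>j. D j \<inter> F j)" by blast
  qed
  with finite_measure_mono[OF this Um] U
  show "prob {\<omega> \<in> space M. t + h < gaps (path \<omega>) 1 \<and> \<omega> \<in> B} \<le> q" by simp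
  have "(\<Union>j. D j \<inter> F j) \<subseteq> {\<omega> \<in> space M. t < gaps (path \<omega>) 1 \<and> \<omega> \<in> B} \<union> {\<omega> \<in> space M. gaps (path \<omega>) 1 \<le> h}"
  proof
    fix \<omega> assume "\<omega> \<in> (\<Union>j. D j \<inter> F j)"
    then obtain j where j: "\<omega> \<in> D j" "\<omega> \<in> F j" by blast
    have \<omega>: "\<omega> \<in> space M" using j(1) by (simp add: D_def)
    show "\<omega> \<in> {\<omega> \<in> space M. t < gaps (path \<omega>) 1 \<and> \<omega> \<in> B} \<union> {\<omega> \<in> space M. gaps (path \<omega>) 1 \<le> h}"
    proof (cases "gaps (path \<omega>) 1 \<le> h")
      case False
      then have "h \<le> gaps (path \<omega>) 1" by simp
      from key[OF j(1) refl this] D_h[OF j(1)] j(2) \<omega> show ?thesis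
        unfolding F_eq by (simp add: B_def del: of_nat_Suc)
    qed (use \<omega> in simp)
  qed
  then have "q \<le> prob ({\<omega> \<in> space M. t < gaps (path \<omega>) 1 \<and> \<omega> \<in> B} \<union> {\<omega> \<in> space M. gaps (path \<omega>) 1 \<le> h})"
    unfolding U[symmetric] by (rule finite_measure_mono) measurable
  also have "\<dots> \<le> prob {\<omega> \<in> space M. t < gaps (path \<omega>) 1 \<and> \<omega> \<in> B} + prob {\<omega> \<in> space M. gaps (path \<omega>) 1 \<le> h}"
    by (rule measure_Un_le) measurable
  finally show "q \<le> prob {\<omega> \<in> space M. t < gaps (path \<omega>) 1 \<and> \<omega> \<in> B} + prob {\<omega> \<in> space M. gaps (path \<omega>) 1 \<le> h}" .
qed

text \<open>Letting h tend to 0 closes the sandwich: the events on the left increase to the wanted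
  one, and those with second gap at most h decrease to the empty set because gaps are
  positive.\<close>

lemma second_gap_prob:
  assumes t: "0 \<le> t" and C: "C \<in> sets borel_seq"
    and q: "\<And>s. 0 \<le> s \<Longrightarrow> prob {\<omega> \<in> space M. t < gaps (shift s (path \<omega>)) 0 \<and> tail (gaps (shift s (path \<omega>))) \<in> C} = q"
  shows "prob {\<omega> \<in> space M. t < gaps (path \<omega>) 1 \<and> tail (tail (gaps (path \<omega>))) \<in> C} = q"
proof -
  define B where "B = {\<omega> \<in> space M. tail (tail (gaps (path \<omega>))) \<in> C}"
  have B [measurable]: "B \<in> events"
    using measurable_sets[OF tail_measurable[OF tail_measurable[OF gaps_N_measurable]] C]
    by (simp add: B_def vimage_def Int_def conj_commute)
  define h where "h k = 1 / real (Suc k)" for k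
  have h: "0 < h k" for k by (simp add: h_def)
  have h0: "h \<longlonglongrightarrow> 0" unfolding h_def using LIMSEQ_inverse_real_of_nat by (simp add: inverse_eq_divide)
  have h_anti: "h (Suc k) \<le> h k" for k by (simp add: h_def frac_le)
  note sandwich = second_gap_sandwich[OF t h C q, folded B_def]
  have pos: "0 < gaps (path \<omega>) 1" if "\<omega> \<in> space M" for \<omega> by (rule gaps_pos[OF cpaths[OF that]])
  have small: "\<exists>k. h k < e" if "0 < e" for e
    using order_tendstoD(2)[OF h0 that] by (auto simp: eventually_sequentially)
  have "(\<lambda>k. prob {\<omega> \<in> space M. t + h k < gaps (path \<omega>) 1 \<and> \<omega> \<in> B}) \<longlonglongrightarrow>
      prob (\<Union>k. {\<omega> \<in> space M. t + h k < gaps (path \<omega>) 1 \<and> \<omega> \<in> B})"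
  proof (rule finite_Lim_measure_incseq)
    show "incseq (\<lambda>k. {\<omega> \<in> space M. t + h k < gaps (path \<omega>) 1 \<and> \<omega> \<in> B})"
      using h_anti by (intro incseq_SucI) (auto intro: le_less_trans[OF add_left_mono])
  qed auto
  moreover have "(\<Union>k. {\<omega> \<in> space M. t + h k < gaps (path \<omega>) 1 \<and> \<omega> \<in> B}) = {\<omega> \<in> space M. t < gaps (path \<omega>) 1 \<and> \<omega> \<in> B}"
  proof (intro equalityI subsetI)
    fix \<omega> assume "\<omega> \<in> {\<omega> \<in> space M. t < gaps (path \<omega>) 1 \<and> \<omega> \<in> B}"
    with small[of "gaps (path \<omega>) 1 - t"] show "\<omega> \<in> (\<Union>k. {\<omega> \<in> space M. t + h k < gaps (path \<omega>) 1 \<and> \<omega> \<in> B})"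
      by (auto simp: less_diff_eq add.commute)
  next
    fix \<omega> assume "\<omega> \<in> (\<Union>k. {\<omega> \<in> space M. t + h k < gaps (path \<omega>) 1 \<and> \<omega> \<in> B})"
    then obtain k where "\<omega> \<in> space M" "t + h k < gaps (path \<omega>) 1" "\<omega> \<in> B" by blast
    with h[of k] show "\<omega> \<in> {\<omega> \<in> space M. t < gaps (path \<omega>) 1 \<and> \<omega> \<in> B}" by simp
  qed
  ultimately have "prob {\<omega> \<in> space M. t < gaps (path \<omega>) 1 \<and> \<omega> \<in> B} \<le> q"
    using sandwich(1) by (intro LIMSEQ_le_const2) auto
  moreover have "(\<lambda>k. prob {\<omega> \<in> space M. gaps (path \<omega>) 1 \<le> h k}) \<longlonglongrightarrow> prob (\<Inter>k. {\<omega> \<in> space M. gaps (path \<omega>) 1 \<le> h k})"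
  proof (rule finite_Lim_measure_decseq)
    show "decseq (\<lambda>k. {\<omega> \<in> space M. gaps (path \<omega>) 1 \<le> h k})"
      using h_anti by (intro decseq_SucI) (auto intro: order_trans)
  qed auto
  moreover have "(\<Inter>k. {\<omega> \<in> space M. gaps (path \<omega>) 1 \<le> h k}) = {}"
    using small pos by (auto simp: not_le) (meson not_le)
  ultimately have "(\<lambda>k. prob {\<omega> \<in> space M. t < gaps (path \<omega>) 1 \<and> \<omega> \<in> B} + prob {\<omega> \<in> space M. gaps (path \<omega>) 1 \<le> h k}) \<longlonglongrightarrow>
      prob {\<omega> \<in> space M. t < gaps (path \<omega>) 1 \<and> \<omega> \<in> B} + 0" by (intro tendsto_intros) simp
  then have "q \<le> prob {\<omega> \<in> space M. t < gaps (path \<omega>) 1 \<and> \<omega> \<in> B}"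
    using sandwich(2) by (intro LIMSEQ_le_const[where a=q]) auto
  with \<open>prob {\<omega> \<in> space M. t < gaps (path \<omega>) 1 \<and> \<omega> \<in> B} \<le> q\<close>
  have "prob {\<omega> \<in> space M. t < gaps (path \<omega>) 1 \<and> \<omega> \<in> B} = q" by simp
  moreover have "{\<omega> \<in> space M. t < gaps (path \<omega>) 1 \<and> \<omega> \<in> B} = {\<omega> \<in> space M. t < gaps (path \<omega>) 1 \<and> tail (tail (gaps (path \<omega>))) \<in> C}"
    by (auto simp: B_def)
  ultimately show ?thesis by simp
qed

end

lemma cylinder_sets:
  fixes n :: nat
  assumes "\<And>i. A i \<in> sets (borel :: real measure)"
  shows "{x \<in> space borel_seq. \<forall>i<n. x (f i) \<in> A i} \<in> sets borel_seq"
proof -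
  have "{x \<in> space borel_seq. x (f i) \<in> A i} \<in> sets borel_seq" for i
    using measurable_sets[OF component_measurable[of "\<lambda>x. x" "borel_seq" "f i"] assms[of i]]
    by (simp add: vimage_def Int_def conj_commute)
  then have "{x \<in> space borel_seq. \<forall>i\<in>{..<n}. x (f i) \<in> A i} \<in> sets borel_seq"
    by (intro sets.sets_Collect_finite_All) auto
  then show ?thesis unfolding Ball_def lessThan_iff .
qed

text \<open>Induction over all Poisson processes of the given rate at once, because the hypothesis
  is applied to the process restarted at arbitrary times. Both the first and the second gap are
  handled by \<open>exponential_independent_of_event\<close>, which reduces them to tail
  events.\<close>

lemma gaps_cylinder_prob:
  fixes N :: "real \<Rightarrow> 'a \<Rightarrow> nat" and A :: "nat \<Rightarrow> real set"
  shows "poisson_process M N \<mu> \<Longrightarrow> (\<And>i. A i \<in> sets borel) \<Longrightarrow>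
    measure M {\<omega> \<in> space M. \<forall>i<n. gaps (\<lambda>t. N t \<omega>) i \<in> A i} =
    (\<Prod>i<n. measure (expo \<mu>) (A i))"
proof (induction n arbitrary: N A)
  case 0
  then interpret poisson_process M N \<mu> by simp
  show ?case by (simp add: prob_space)
next
  case (Suc n)
  let ?E = "expo \<mu>"
  let ?B = "borel_seq"
  \<comment> \<open>The gaps from the second one on already have the product law. The hypothesis for
    n gaps of a restarted process gives the same tail probability at every restart time, as
    \<open>second_gap_prob\<close> demands.\<close>
  have tail_prob: "measure M {\<omega> \<in> space M. \<forall>i<n. gaps (\<lambda>t. N' t \<omega>) (Suc i) \<in> A i} = (\<Prod>i<n. measure ?E (A i))"
    if N': "poisson_process M N' \<mu>" and A: "\<And>i. A i \<in> sets borel" for N' :: "real \<Rightarrow> 'a \<Rightarrow> nat" and A :: "nat \<Rightarrow> real set"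
  proof (cases n)
    case 0
    interpret N': poisson_process M N' \<mu> by (rule N')
    show ?thesis using 0 by (simp add: N'.prob_space)
  next
    case (Suc m)
    interpret N': poisson_process M N' \<mu> by (rule N')
    define P where "P = (\<Prod>i<m. measure ?E (A (Suc i)))"
    define C where "C = {x \<in> space ?B. \<forall>i<m. x i \<in> A (Suc i)}"
    have C: "C \<in> sets ?B" unfolding C_def by (rule cylinder_sets) (rule A)
    have CB: "x \<in> C \<longleftrightarrow> (\<forall>i<m. x i \<in> A (Suc i))" for x by (simp add: C_def space_PiM)
    define B where "B = {\<omega> \<in> space M. tail (tail (gaps (\<lambda>t. N' t \<omega>))) \<in> C}"
    have B: "B \<in> sets M"
      using measurable_sets[OF tail_measurable[OF tail_measurable[OF N'.gaps_N_measurable]] C]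
      by (simp add: B_def vimage_def Int_def conj_commute)
    have gt: "measure M {\<omega> \<in> space M. t < gaps (\<lambda>t. N' t \<omega>) 1 \<and> \<omega> \<in> B} = exp (- \<mu> * t) * P" if t: "0 \<le> t" for t
    proof -
      have "measure M {\<omega> \<in> space M. t < gaps (shift s (\<lambda>t. N' t \<omega>)) 0 \<and> tail (gaps (shift s (\<lambda>t. N' t \<omega>))) \<in> C} = exp (- \<mu> * t) * P"
        if s: "0 \<le> s" for s
      proof -
        \<comment> \<open>The first gap after the restart is constrained to exceed t, the later ones
          as in \<open>C\<close>.\<close>
        define A' where "A' = case_nat {t<..} (\<lambda>i. A (Suc i))"
        have A': "A' i \<in> sets borel" for i using A by (cases i) (auto simp: A'_def)
        have "measure M {\<omega> \<in> space M. t < gaps (shift s (\<lambda>t. N' t \<omega>)) 0 \<and> tail (gaps (shift s (\<lambda>t. N' t \<omega>))) \<in> C} =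
          measure M {\<omega> \<in> space M. \<forall>i<n. gaps (\<lambda>t. N' (s + t) \<omega> - N' s \<omega>) i \<in> A' i}"
          using N'.gaps_shift_eq[OF s] unfolding Suc All_less_Suc2 CB
          by (intro arg_cong[where f="measure M"] Collect_cong) (auto simp: A'_def tail_def)
        also have "\<dots> = (\<Prod>i<n. measure ?E (A' i))"
          by (rule Suc.IH[OF N'.shifted_process[OF s] A'])
        also have "\<dots> = measure ?E {t<..} * P"
          unfolding Suc prod.lessThan_Suc_shift P_def by (simp add: A'_def)
        finally show ?thesis using exponential_measure_gt[OF N'.rate_pos t] by simp
      qed
      from N'.second_gap_prob[OF t C this] show ?thesis
        by (simp add: B_def conj_commute cong: conj_cong)
    qed
    have "measure M {\<omega> \<in> space M. \<forall>i<n. gaps (\<lambda>t. N' t \<omega>) (Suc i) \<in> A i} =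
      measure M {\<omega> \<in> space M. gaps (\<lambda>t. N' t \<omega>) 1 \<in> A 0 \<and> \<omega> \<in> B}"
      unfolding Suc All_less_Suc2 B_def CB
      by (intro arg_cong[where f="measure M"] Collect_cong) (auto simp: tail_def)
    also have "\<dots> = measure ?E (A 0) * P"
      using B gt A
      by (intro N'.exponential_independent_of_event N'.rate_pos N'.gap_component_measurable gaps_pos N'.cpaths)
         (auto simp: P_def intro: prod_nonneg)
    also have "\<dots> = (\<Prod>i<n. measure ?E (A i))"
      unfolding Suc prod.lessThan_Suc_shift P_def by simp
    finally show ?thesis .
  qed
  interpret poisson_process M N \<mu> by (rule Suc.prems(1))
  note A = Suc.prems(2)
  define P where "P = (\<Prod>i<n. measure ?E (A (Suc i)))"
  define C where "C = {x \<in> space ?B. \<forall>i<n. x (Suc i) \<in> A (Suc i)}"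
  have C: "C \<in> sets ?B" unfolding C_def by (rule cylinder_sets) (rule A)
  have CB: "x \<in> C \<longleftrightarrow> (\<forall>i<n. x (Suc i) \<in> A (Suc i))" for x by (simp add: C_def space_PiM)
  define B where "B = {\<omega> \<in> space M. gaps (path \<omega>) \<in> C}"
  have B: "B \<in> sets M"
    using measurable_sets[OF gaps_N_measurable C] by (simp add: B_def vimage_def Int_def conj_commute)
  have gt: "prob {\<omega> \<in> space M. t < gaps (path \<omega>) 0 \<and> \<omega> \<in> B} = exp (- \<mu> * t) * P" if t: "0 \<le> t" for t
  proof -
    \<comment> \<open>Without a jump up to t, restarting at t shortens the first gap only; the event
      on the later gaps can therefore be read off the future of t.\<close>
    have "{\<omega> \<in> space M. t < gaps (path \<omega>) 0 \<and> \<omega> \<in> B} = {\<omega> \<in> space M. N t \<omega> \<in> {0}} \<inter> {\<omega> \<in> space M. gaps (shift t (path \<omega>)) \<in> C}"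
    proof (rule set_eqI)
      fix \<omega>
      show "\<omega> \<in> {\<omega> \<in> space M. t < gaps (path \<omega>) 0 \<and> \<omega> \<in> B} \<longleftrightarrow>
        \<omega> \<in> {\<omega> \<in> space M. N t \<omega> \<in> {0}} \<inter> {\<omega> \<in> space M. gaps (shift t (path \<omega>)) \<in> C}"
      proof (cases "\<omega> \<in> space M")
        case True
        note p = cpaths[OF True]
        have "t < gaps (path \<omega>) 0 \<longleftrightarrow> N t \<omega> = 0"
          using less_jump_time_iff[OF p t, of 1] N_0[OF True] by (simp add: gaps_0[OF p])
        moreover have "gaps (shift t (path \<omega>)) (Suc i) = gaps (path \<omega>) (Suc i)" if "N t \<omega> = 0" for i
          using gaps_shift(2)[OF p t, of i] that by simp
        ultimately show ?thesis using True by (auto simp: B_def CB)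
      qed simp
    qed
    then have "prob {\<omega> \<in> space M. t < gaps (path \<omega>) 0 \<and> \<omega> \<in> B} =
        prob {\<omega> \<in> space M. N t \<omega> \<in> {0}} * prob {\<omega> \<in> space M. gaps (shift t (path \<omega>)) \<in> C}"
      using past_gaps_indep[OF t no_jump_past[OF t order_refl, of "{0}"] C] by simp
    \<comment> \<open>\<open>C\<close> leaves the entry 0 free, so the residual first gap does not
      matter and \<open>tail_prob\<close> applies to the restarted process.\<close>
    also have "prob {\<omega> \<in> space M. gaps (shift t (path \<omega>)) \<in> C} =
        prob {\<omega> \<in> space M. \<forall>i<n. gaps (\<lambda>s. N (t + s) \<omega> - N t \<omega>) (Suc i) \<in> A (Suc i)}"
      using gaps_shift_eq[OF t] unfolding CB by (intro arg_cong[where f=prob] Collect_cong) auto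
    also have "\<dots> = P" unfolding P_def by (rule tail_prob[OF shifted_process[OF t]]) (rule A)
    finally show ?thesis using no_jump_prob[OF t] by simp
  qed
  have "prob {\<omega> \<in> space M. \<forall>i<Suc n. gaps (path \<omega>) i \<in> A i} = prob {\<omega> \<in> space M. gaps (path \<omega>) 0 \<in> A 0 \<and> \<omega> \<in> B}"
    unfolding All_less_Suc2 B_def CB by (intro arg_cong[where f=prob] Collect_cong) auto
  also have "\<dots> = measure ?E (A 0) * P"
    using B gt A
    by (intro exponential_independent_of_event rate_pos gap_component_measurable gaps_pos cpaths)
       (auto simp: P_def intro: prod_nonneg)
  also have "\<dots> = (\<Prod>i<Suc n. measure ?E (A i))"
    unfolding prod.lessThan_Suc_shift P_def by simp
  finally show ?case .
qed

lemma gaps_distr: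
  assumes N: "poisson_process M N \<mu>"
  shows "distr M borel_seq (\<lambda>\<omega>. gaps (\<lambda>t. N t \<omega>)) = Pi\<^sub>M UNIV (\<lambda>_. expo \<mu>)"
proof -
  interpret poisson_process M N \<mu> by (rule N)
  let ?E = "expo \<mu>"
  have E: "prob_space ?E" using rate_pos by (rule prob_space_exponential_density)
  interpret E: prob_space ?E by (rule E)
  let ?D = "distr M borel_seq (\<lambda>\<omega>. gaps (path \<omega>))"
  show ?thesis
  proof (rule measure_eqI_PiM_infinite)
    show "sets ?D = sets (Pi\<^sub>M UNIV (\<lambda>_. ?E))" by (simp cong: sets_PiM_cong)
    show "sets (Pi\<^sub>M UNIV (\<lambda>_. ?E)) = sets (Pi\<^sub>M UNIV (\<lambda>_. ?E))" ..
    show "finite_measure ?D"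
      using gaps_N_measurable by (intro prob_space.finite_measure prob_space_distr)
    fix A and J :: "nat set"
    assume J: "finite J" and A: "\<And>i. i \<in> J \<Longrightarrow> A i \<in> sets ?E"
    define A' where "A' i = (if i \<in> J then A i else UNIV)" for i
    have A': "A' i \<in> sets borel" for i using A by (simp add: A'_def)
    define n where "n = Suc (Max (insert 0 J))"
    have n: "i < n" if "i \<in> J" for i using that J by (auto simp: n_def less_Suc_eq_le)
    have emb: "prod_emb UNIV (\<lambda>_. ?E) J (Pi\<^sub>E J A) = {x. \<forall>i<n. x i \<in> A' i}"
      using n by (auto simp: prod_emb_def space_PiM A'_def PiE_iff)
    have "emeasure ?D (prod_emb UNIV (\<lambda>_. ?E) J (Pi\<^sub>E J A)) = emeasure M ((\<lambda>\<omega>. gaps (path \<omega>)) -` {x. \<forall>i<n. x i \<in> A' i} \<inter> space M)"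
      unfolding emb using cylinder_sets[of A' n "\<lambda>i. i"] A'
      by (intro emeasure_distr gaps_N_measurable) (simp add: space_PiM)
    also have "(\<lambda>\<omega>. gaps (path \<omega>)) -` {x. \<forall>i<n. x i \<in> A' i} \<inter> space M = {\<omega> \<in> space M. \<forall>i<n. gaps (path \<omega>) i \<in> A' i}"
      by auto
    also have "emeasure M \<dots> = ennreal (\<Prod>i<n. measure ?E (A' i))"
      using gaps_cylinder_prob[OF N A', of n] by (simp add: emeasure_eq_measure)
    also have "(\<Prod>i<n. measure ?E (A' i)) = (\<Prod>i\<in>J. measure ?E (A i))"
      using n E.prob_space by (intro prod.mono_neutral_cong_right) (auto simp: A'_def)
    also have "ennreal \<dots> = (\<Prod>i\<in>J. emeasure ?E (A i))"
      by (simp add: E.emeasure_eq_measure prod_ennreal)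
    also have "\<dots> = emeasure (Pi\<^sub>M UNIV (\<lambda>_. ?E)) (prod_emb UNIV (\<lambda>_. ?E) J (Pi\<^sub>E J A))"
      using J A E by (intro emeasure_PiM_emb[symmetric]) auto
    finally show "emeasure ?D (prod_emb UNIV (\<lambda>_. ?E) J (Pi\<^sub>E J A)) = emeasure (Pi\<^sub>M UNIV (\<lambda>_. ?E)) (prod_emb UNIV (\<lambda>_. ?E) J (Pi\<^sub>E J A))" .
  qed
qed

context poisson_process begin

text \<open>The Markov property at a deterministic time, in the form Fubini needs: past data and
  future gaps have a product law, with the future factor not depending on t.\<close>

lemma past_gaps_distr:
  assumes t: "0 \<le> t" and X: "X \<in> measurable (past t) K"
  shows "distr M K X \<Otimes>\<^sub>M Pi\<^sub>M UNIV (\<lambda>_. expo \<mu>) =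
    distr M (K \<Otimes>\<^sub>M borel_seq) (\<lambda>\<omega>. (X \<omega>, gaps (shift t (path \<omega>))))"
    (is "?DX \<Otimes>\<^sub>M ?Q = ?D")
proof (rule pair_measure_eqI)
  have XM: "X \<in> measurable M K" by (rule measurable_past[OF X])
  note Y = gaps_shift_measurable[OF t]
  have E: "prob_space (expo \<mu>)" using rate_pos by (rule prob_space_exponential_density)
  show "sigma_finite_measure ?DX"
    by (intro prob_space_imp_sigma_finite prob_space_distr XM)
  show "sigma_finite_measure ?Q"
    by (intro prob_space_imp_sigma_finite prob_space_PiM E)
  have sQ: "sets ?Q = sets borel_seq" by (rule sets_PiM_cong) simp_all
  show "sets (?DX \<Otimes>\<^sub>M ?Q) = sets ?D"
    by (simp add: sQ cong: sets_pair_measure_cong)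
  fix A B assume A: "A \<in> sets ?DX" and B: "B \<in> sets ?Q"
  then have A': "A \<in> sets K" and B': "B \<in> sets borel_seq" by (simp_all only: sQ sets_distr)
  have "?Q = distr M borel_seq (\<lambda>\<omega>. gaps (shift t (path \<omega>)))"
    unfolding gaps_distr[OF shifted_process[OF t], symmetric]
    by (rule distr_cong) (simp_all add: gaps_shift_eq[OF t])
  then have "emeasure ?Q B = prob {\<omega> \<in> space M. gaps (shift t (path \<omega>)) \<in> B}"
    using B' Y by (simp add: emeasure_distr emeasure_eq_measure vimage_def Int_def conj_commute)
  moreover have "emeasure ?DX A = prob (X -` A \<inter> space M)"
    using A' XM by (simp add: emeasure_distr emeasure_eq_measure)
  moreover have "emeasure ?D (A \<times> B) = prob ((X -` A \<inter> space M) \<inter> {\<omega> \<in> space M. gaps (shift t (path \<omega>)) \<in> B})"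
    using A' B' XM Y by (subst emeasure_distr) (auto simp: emeasure_eq_measure intro!: arg_cong[where f=prob])
  moreover have "X -` A \<inter> space M \<in> sets (past t)" using measurable_sets[OF X A'] by simp
  ultimately show "emeasure ?DX A * emeasure ?Q B = emeasure ?D (A \<times> B)"
    using past_gaps_indep[OF t _ B'] by (simp add: ennreal_mult)
qed

end

section \<open>Stopping times and the value functions\<close>

context poisson_process begin

abbreviation history :: "ennreal \<Rightarrow> 'a set set" where
  "history u \<equiv> sigma_sets (space M) ({N s -` A \<inter> space M | s A. 0 \<le> s \<and> ennreal s \<le> u} \<union> null_sets M)"

lemma augmented_sets: "sets (augmented_filtration M N t) = sigma_sets (space M) (\<Inter>u\<in>insert \<infinity> {t<..}. history u)"
proof -
  have "{N s -` A \<inter> space M | s A. 0 \<le> s \<and> ennreal s \<le> \<infinity>} \<union> null_sets M \<subseteq> Pow (space M)"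
    using sets.sets_into_space by fastforce
  then have "history \<infinity> \<subseteq> Pow (space M)" using sigma_sets_into_sp by blast
  then show ?thesis unfolding augmented_filtration_def by (intro sets_measure_of) auto
qed

lemma space_augmented [simp]: "space (augmented_filtration M N t) = space M"
  unfolding augmented_filtration_def space_measure_of_conv ..

lemma augmented_subset_history: "t < u \<Longrightarrow> sets (augmented_filtration M N t) \<subseteq> history u"
  "sets (augmented_filtration M N t) \<subseteq> history \<infinity>"
  unfolding augmented_sets by (rule sigma_sets_mono, blast)+

lemma past_subset_augmented:
  assumes "0 \<le> b"
  shows "sets (past b) \<subseteq> sets (augmented_filtration M N (ennreal b))"
proof -
  have hist: "sets (past b) \<subseteq> history u" if "ennreal b \<le> u" for u
    unfolding sets_past
  proof (rule sigma_sets_subseteq, safe)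
    fix s A assume "0 \<le> s" "s \<le> b"
    then have "ennreal s \<le> u" using that by (meson ennreal_leI order_trans)
    with \<open>0 \<le> s\<close> show "\<exists>s' A'. N s -` A \<inter> space M = N s' -` A' \<inter> space M \<and> 0 \<le> s' \<and> ennreal s' \<le> u" by blast
  qed
  have "sets (past b) \<subseteq> (\<Inter>u\<in>insert \<infinity> {ennreal b<..}. history u)"
  proof (rule INT_greatest)
    fix u :: ennreal assume "u \<in> insert \<infinity> {ennreal b<..}"
    then have "ennreal b \<le> u" by auto
    then show "sets (past b) \<subseteq> history u" by (rule hist)
  qed
  then show ?thesis unfolding augmented_sets by auto
qed

text \<open>Completion adds events only up to null sets, so in expectations every event of the
  completed history may be replaced by one generated by the path alone.\<close>

lemma history_approx:
  assumes b: "0 \<le> b" and A: "A \<in> history (ennreal b)"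
  shows "A \<in> sets M \<and> (\<exists>A'\<in>sets (past b). AE \<omega> in M. \<omega> \<in> A \<longleftrightarrow> \<omega> \<in> A')"
  using A
proof (induction rule: sigma_sets.induct)
  case (Basic a)
  then show ?case
  proof
    assume "a \<in> {N s -` A \<inter> space M | s A. 0 \<le> s \<and> ennreal s \<le> ennreal b}"
    then have "a \<in> sets (past b)"
      using b unfolding sets_past by (intro sigma_sets.Basic) auto
    then show ?thesis using past_subset by auto
  next
    assume a: "a \<in> null_sets M"
    then have "AE \<omega> in M. \<omega> \<in> a \<longleftrightarrow> \<omega> \<in> {}" by (auto dest: AE_not_in)
    with a show ?thesis by (intro conjI bexI[of _ "{}"]) auto
  qed
next
  case Empty
  then show ?case by (intro conjI bexI[of _ "{}"]) auto
next
  case (Compl a)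
  then obtain a' where a': "a' \<in> sets (past b)" "AE \<omega> in M. \<omega> \<in> a \<longleftrightarrow> \<omega> \<in> a'" by blast
  have "AE \<omega> in M. \<omega> \<in> space M - a \<longleftrightarrow> \<omega> \<in> space M - a'"
    using a'(2) by eventually_elim auto
  moreover have "space M - a' \<in> sets (past b)" using sets.compl_sets[OF a'(1)] by simp
  ultimately show ?case using Compl by blast
next
  case (Union a)
  then obtain a' where a': "\<And>i. a' i \<in> sets (past b)" "\<And>i. AE \<omega> in M. \<omega> \<in> a i \<longleftrightarrow> \<omega> \<in> a' i" by metis
  have "AE \<omega> in M. \<forall>i. \<omega> \<in> a i \<longleftrightarrow> \<omega> \<in> a' i" using a'(2) by (simp add: AE_all_countable)
  then have "AE \<omega> in M. \<omega> \<in> (\<Union>i. a i) \<longleftrightarrow> \<omega> \<in> (\<Union>i. a' i)" by eventually_elim auto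
  moreover have "(\<Union>i. a' i) \<in> sets (past b)" using a'(1) by auto
  ultimately show ?case using Union by blast
qed

lemma history_infinity: "history \<infinity> \<subseteq> sets M"
proof (rule sets.sigma_sets_subset)
  show "{N s -` A \<inter> space M | s A. 0 \<le> s \<and> ennreal s \<le> \<infinity>} \<union> null_sets M \<subseteq> sets M"
    using N_vimage by auto
qed

context
  fixes \<tau> :: "'a \<Rightarrow> ennreal"
  assumes \<tau>: "stopping_time (augmented_filtration M N) \<tau>"
begin

lemma stopping_le: "{\<omega> \<in> space M. \<tau> \<omega> \<le> t} \<in> sets (augmented_filtration M N t)"
  using stopping_timeD[OF \<tau>, of t] by (simp add: pred_def)

lemma stopping_measurable: "\<tau> \<in> borel_measurable M"
proof (rule borel_measurableI_le)
  fix y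
  show "{\<omega> \<in> space M. \<tau> \<omega> \<le> y} \<in> sets M"
    using stopping_le[of y] augmented_subset_history(2) history_infinity by blast
qed

text \<open>The strict event {\<tau> < b} is a union of events {\<tau> \<le> q} over rational q < b.
  Each lies in the right-continuous filtration at q, hence in the history up to b, so the
  enlargement to the right costs nothing.\<close>

lemma stopping_before:
  assumes b: "0 \<le> b"
  shows "\<exists>A'\<in>sets (past b). AE \<omega> in M. ennreal b \<le> \<tau> \<omega> \<longleftrightarrow> \<omega> \<in> A'"
proof -
  let ?Q = "{q \<in> \<rat>. 0 \<le> q \<and> q < b}"
  have "{\<omega> \<in> space M. \<tau> \<omega> < ennreal b} = (\<Union>q\<in>?Q. {\<omega> \<in> space M. \<tau> \<omega> \<le> ennreal q})"
  proof safe
    fix \<omega> assume \<omega>: "\<omega> \<in> space M" "\<tau> \<omega> < ennreal b"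
    then obtain t where t: "\<tau> \<omega> = ennreal t" "0 \<le> t" "t < b"
      by (cases "\<tau> \<omega>") (auto simp: ennreal_less_iff)
    obtain q where "q \<in> \<rat>" "t < q" "q < b" using Rats_dense_in_real[OF t(3)] by blast
    with t \<omega> show "\<omega> \<in> (\<Union>q\<in>?Q. {\<omega> \<in> space M. \<tau> \<omega> \<le> ennreal q})"
      by (auto intro!: bexI[of _ q] ennreal_leI)
  next
    fix \<omega> q assume "\<tau> \<omega> \<le> ennreal q" "0 \<le> q" "q < b"
    then show "\<tau> \<omega> < ennreal b" by (meson ennreal_lessI le_less_trans)
  qed
  also have "\<dots> \<in> history (ennreal b)"
  proof (rule sigma_sets_UNION)
    show "countable ((\<lambda>q. {\<omega> \<in> space M. \<tau> \<omega> \<le> ennreal q}) ` ?Q)"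
      by (intro countable_image countable_subset[OF _ countable_rat]) auto
    fix B assume "B \<in> (\<lambda>q. {\<omega> \<in> space M. \<tau> \<omega> \<le> ennreal q}) ` ?Q"
    then obtain q where q: "0 \<le> q" "q < b" "B = {\<omega> \<in> space M. \<tau> \<omega> \<le> ennreal q}" by blast
    then have "ennreal q < ennreal b" by (simp add: ennreal_lessI)
    then show "B \<in> history (ennreal b)"
      using stopping_le[of "ennreal q"] augmented_subset_history(1) q(3) by blast
  qed
  finally obtain A' where A': "A' \<in> sets (past b)" "AE \<omega> in M. \<omega> \<in> {\<omega> \<in> space M. \<tau> \<omega> < ennreal b} \<longleftrightarrow> \<omega> \<in> A'"
    using history_approx[OF b] by blast
  have "AE \<omega> in M. ennreal b \<le> \<tau> \<omega> \<longleftrightarrow> \<omega> \<in> space M - A'"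
    using A'(2) AE_space by eventually_elim auto
  moreover have "space M - A' \<in> sets (past b)" using sets.compl_sets[OF A'(1)] by simp
  ultimately show ?thesis by blast
qed

end

lemma min_jump_time_past:
  assumes b: "0 \<le> b"
  shows "(\<lambda>\<omega>. min (jump_time (path \<omega>) i) b) \<in> borel_measurable (past b)"
proof (rule borel_measurableI_le)
  fix y
  consider "y < 0" | "0 \<le> y" "y < b" | "b \<le> y" by linarith
  then show "{\<omega> \<in> space (past b). min (jump_time (path \<omega>) i) b \<le> y} \<in> sets (past b)"
  proof cases
    case 1
    have "{\<omega> \<in> space (past b). min (jump_time (path \<omega>) i) b \<le> y} = {}"
    proof -
      have "\<not> min (jump_time (path \<omega>) i) b \<le> y" if "\<omega> \<in> space M" for \<omega>
        using jump_time_nonneg[OF cpaths[OF that], of i] 1 b by linarith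
      then show ?thesis by auto
    qed
    then show ?thesis by (simp only: sets.empty_sets)
  next
    case 2
    have "{\<omega> \<in> space (past b). min (jump_time (path \<omega>) i) b \<le> y} = {\<omega> \<in> space M. N y \<omega> \<in> {i..}}"
    proof -
      have "min (jump_time (path \<omega>) i) b \<le> y \<longleftrightarrow> i \<le> N y \<omega>" if "\<omega> \<in> space M" for \<omega>
        using jump_time_le_iff[OF cpaths[OF that] 2(1), of i] N_0[OF that] 2 by auto
      then show ?thesis by auto
    qed
    then show ?thesis using no_jump_past[of y b "{i..}"] 2 by simp
  next
    case 3
    then have "{\<omega> \<in> space (past b). min (jump_time (path \<omega>) i) b \<le> y} = space (past b)" by auto
    then show ?thesis by (simp only: sets.top)
  qed
qed

end

section \<open>Translation of J, v, r and S into gap coordinates; the submartingale property\<close>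

locale pdmp_poisson = pdmp lam \<mu> c m + poisson_process M N \<mu>
  for M :: "'a measure" and N :: "real \<Rightarrow> 'a \<Rightarrow> nat" and lam \<mu> c m :: real
begin

lemma gaps_distr_Seq: "distr M borel_seq (\<lambda>\<omega>. gaps (path \<omega>)) = Seq"
  using gaps_distr[OF poisson_process_axioms] by (simp add: Seq_def Expo_def)

lemma gaps_integral: "f \<in> borel_measurable borel_seq \<Longrightarrow> (\<integral>\<omega>. f (gaps (path \<omega>)) \<partial>M) = (\<integral>x. f x \<partial>Seq)"
  for f :: "_ \<Rightarrow> real"
  unfolding gaps_distr_Seq[symmetric] by (rule integral_distr[OF gaps_N_measurable, symmetric])

lemma gaps_integrable: "f \<in> borel_measurable borel_seq \<Longrightarrow> integrable M (\<lambda>\<omega>. f (gaps (path \<omega>))) \<longleftrightarrow> integrable Seq f"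
  for f :: "_ \<Rightarrow> real"
  unfolding gaps_distr_Seq[symmetric] by (rule integrable_distr_eq[OF gaps_N_measurable, symmetric])

lemma first_gap_integral:
  fixes f :: "real \<Rightarrow> real"
  assumes f: "f \<in> borel_measurable borel"
  shows "(\<integral>\<omega>. f (gaps (path \<omega>) 0) \<partial>M) = (\<integral>s. f s \<partial>Expo)"
proof -
  have f': "(\<lambda>x. f (x 0)) \<in> borel_measurable borel_seq"
    by (rule measurable_compose[OF component_measurable f]) simp
  have "(\<integral>\<omega>. f (gaps (path \<omega>) 0) \<partial>M) = (\<integral>x. f (x 0) \<partial>Seq)" by (rule gaps_integral[OF f'])
  also have "\<dots> = (\<integral>s. f s \<partial>distr Seq Expo (\<lambda>x. x 0))"
    using f by (subst integral_distr) (auto intro!: component_measurable)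
  also have "distr Seq Expo (\<lambda>x. x 0) = Expo"
    unfolding Seq_def by (rule distr_PiM_component) (auto intro: prob_space_Expo)
  finally show ?thesis .
qed

text \<open>Agreement of the two payoffs is asked on the quadrant only, because \<open>v\<close> is
  related to \<open>val\<close> there and nowhere else; the process started in the quadrant does not
  leave it.\<close>

lemma J_eq_H:
  assumes w: "admissible w" and \<phi>: "\<phi> \<in> Quad" and eq: "\<And>\<psi>. \<psi> \<in> Quad \<Longrightarrow> w' \<psi> = w \<psi>"
  shows "J M N lam \<mu> c m w' t \<phi> = H w t \<phi>"
proof -
  have first_cost: "first_cost w t \<phi> \<in> borel_measurable borel" "(\<integral>s. first_cost w t \<phi> s \<partial>Expo) = H w t \<phi>"
    using first_cost_integral[OF w \<phi>, of t] borel_measurable_integrable[of Expo "first_cost w t \<phi>"]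
    by (auto simp: has_bochner_integral_iff)
  have "J M N lam \<mu> c m w' t \<phi> = (\<integral>\<omega>. first_cost w t \<phi> (gaps (path \<omega>) 0) \<partial>M)"
    unfolding J_def Let_def
  proof (rule Bochner_Integration.integral_cong[OF refl])
    fix \<omega> assume "\<omega> \<in> space M"
    then have p: "cpath (path \<omega>)" by (rule cpaths)
    define \<sigma> where "\<sigma> = jump_time (path \<omega>) 1"
    have \<sigma>: "0 < \<sigma>" using jump_time_1_pos[OF p] by (simp add: \<sigma>_def)
    have T: "0 \<le> (if t < ennreal \<sigma> then enn2real t else \<sigma>)" "(if t < ennreal \<sigma> then enn2real t else \<sigma>) \<le> \<sigma>"
      using \<sigma> by (auto intro!: enn2real_leI)
    have "running_cost lam \<mu> c m (path \<omega>) \<phi> (min t (ennreal \<sigma>)) = cost_upto (path \<omega>) \<phi> (if t < ennreal \<sigma> then enn2real t else \<sigma>)"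
      unfolding \<sigma>_def by (rule running_cost_min[OF p])
    also have "\<dots> = flow_cost \<phi> (if t < ennreal \<sigma> then enn2real t else \<sigma>)"
      using T unfolding \<sigma>_def by (intro cost_upto_before[OF p \<phi>])
    finally have 1: "running_cost lam \<mu> c m (path \<omega>) \<phi> (min t (ennreal \<sigma>)) = flow_cost \<phi> (if t < ennreal \<sigma> then enn2real t else \<sigma>)" .
    have nx: "nxt \<phi> \<sigma> \<in> Quad" using \<sigma> by (intro nxt_Quad[OF \<phi>]) simp
    have 2: "w' (Phi lam \<mu> m (path \<omega>) \<phi> \<sigma>) = w (nxt \<phi> \<sigma>)"
      using eq[OF nx] Ph_first[OF p, of \<phi>] by (simp add: \<sigma>_def)
    have "running_cost lam \<mu> c m (path \<omega>) \<phi> (min t (ennreal \<sigma>)) +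
        of_bool (ennreal \<sigma> \<le> t) * exp (- lam * \<sigma>) * w' (Phi lam \<mu> m (path \<omega>) \<phi> \<sigma>) = first_cost w t \<phi> (gaps (path \<omega>) 0)"
      unfolding 1 2 gaps_0[OF p] \<sigma>_def[symmetric] using nx
      by (cases "ennreal \<sigma> \<le> t") (simp_all add: first_cost_def not_le leD)
    then show "running_cost lam \<mu> c m (path \<omega>) \<phi> (min t (ennreal (jump_time (path \<omega>) 1))) +
        of_bool (ennreal (jump_time (path \<omega>) 1) \<le> t) * exp (- lam * jump_time (path \<omega>) 1) * w' (Phi lam \<mu> m (path \<omega>) \<phi> (jump_time (path \<omega>) 1)) = first_cost w t \<phi> (gaps (path \<omega>) 0)"
      by (simp only: \<sigma>_def)
  qed
  also have "\<dots> = H w t \<phi>" using first_gap_integral[OF first_cost(1)] first_cost(2) by simp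
  finally show ?thesis .
qed

lemma J_inf_eq_Hinf:
  assumes "admissible w" "\<phi> \<in> Quad" "\<And>\<psi>. \<psi> \<in> Quad \<Longrightarrow> w' \<psi> = w \<psi>"
  shows "J_inf M N lam \<mu> c m 0 w' \<phi> = Hinf w \<phi>"
proof -
  have "{0..\<infinity>} = (UNIV :: ennreal set)" by auto
  then show ?thesis unfolding J_inf_def Hinf_def using J_eq_H[OF assms] by simp
qed

lemma v_eq_val: "\<phi> \<in> Quad \<Longrightarrow> v M N lam \<mu> c m n \<phi> = val n \<phi>"
proof (induction n arbitrary: \<phi>)
  case (Suc n)
  then show ?case using J_inf_eq_Hinf[OF admissible_val Suc.prems Suc.IH] by simp
qed simp

lemma r_eq_opt_time:
  assumes \<phi>: "\<phi> \<in> Quad"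
  shows "r M N lam \<mu> c m n \<epsilon> \<phi> = opt_time (val n) \<epsilon> \<phi>"
proof -
  have "r_set M N lam \<mu> c m n \<epsilon> \<phi> = rset (val n) \<epsilon> \<phi>"
    unfolding r_set_def rset_def
    using J_eq_H[OF admissible_val \<phi> v_eq_val] J_inf_eq_Hinf[OF admissible_val \<phi> v_eq_val] by simp
  then show ?thesis unfolding r_def opt_time_def by (simp only:)
qed

text \<open>The separate clause for index 1 of \<open>S\<close> fits the recursion of
  \<open>rule_time\<close>, whose value at 0 is 0.\<close>

lemma S_eq_rule_time: "cpath p \<Longrightarrow> \<phi> \<in> Quad \<Longrightarrow> S M N lam \<mu> c m n \<epsilon> p \<phi> = rule_time n \<epsilon> (gaps p) \<phi>"
proof (induction n arbitrary: p \<phi> \<epsilon>)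
  case (Suc n)
  note p = Suc.prems(1) and \<phi> = Suc.prems(2)
  define \<sigma> where "\<sigma> = jump_time p 1"
  have \<sigma>: "0 < \<sigma>" using jump_time_1_pos[OF p] by (simp add: \<sigma>_def)
  have g0: "gaps p 0 = \<sigma>" by (simp add: \<sigma>_def gaps_0[OF p])
  show ?case
  proof (cases n)
    case 0
    have "S M N lam \<mu> c m (Suc 0) \<epsilon> p \<phi> = min (opt_time (val 0) \<epsilon> \<phi>) (ennreal \<sigma>)"
      by (simp only: S.simps r_eq_opt_time[OF \<phi>] \<sigma>_def)
    moreover have "rule_time (Suc 0) \<epsilon> (gaps p) \<phi> = (if opt_time (val 0) \<epsilon> \<phi> < ennreal \<sigma> then opt_time (val 0) \<epsilon> \<phi> else ennreal \<sigma>)"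
      using \<phi> by (simp add: g0)
    ultimately show ?thesis using 0 by (auto simp: min_def not_less)
  next
    case (Suc n')
    have gt: "tail (gaps p) = gaps (shift \<sigma> p)" unfolding \<sigma>_def by (rule gaps_shift_first[OF p, symmetric])
    have p': "cpath (shift \<sigma> p)" using \<sigma> by (intro cpath_shift p) simp
    have nx: "nxt \<phi> \<sigma> \<in> Quad" using \<sigma> by (intro nxt_Quad[OF \<phi>]) simp
    have "Phi lam \<mu> m p \<phi> \<sigma> = nxt \<phi> \<sigma>" unfolding \<sigma>_def by (rule Ph_first[OF p])
    moreover have "S M N lam \<mu> c m n (\<epsilon> / 2) (shift \<sigma> p) (nxt \<phi> \<sigma>) = rule_time n (\<epsilon> / 2) (gaps (shift \<sigma> p)) (nxt \<phi> \<sigma>)"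
      by (rule Suc.IH[OF p' nx])
    ultimately show ?thesis
      using \<phi> by (simp add: Suc r_eq_opt_time[OF \<phi>] g0 gt Let_def \<sigma>_def[symmetric] del: rule_time.simps(1) flip: One_nat_def)
  qed
qed simp

lemma rule_time_meas: "(\<lambda>x. rule_time n \<epsilon> x \<phi>) \<in> borel_measurable borel_seq"
  by (rule rule_time_measurable) auto

lemma cost_S_le:
  assumes \<phi>: "\<phi> \<in> Quad" and \<epsilon>: "0 \<le> \<epsilon>"
  shows "(\<integral>\<omega>. running_cost lam \<mu> c m (path \<omega>) \<phi> (S M N lam \<mu> c m n \<epsilon> (path \<omega>) \<phi>) \<partial>M) \<le> val n \<phi> + \<epsilon>"
proof -
  have "(\<integral>\<omega>. running_cost lam \<mu> c m (path \<omega>) \<phi> (S M N lam \<mu> c m n \<epsilon> (path \<omega>) \<phi>) \<partial>M) =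
     (\<integral>\<omega>. (\<lambda>x. pathcost zero_payoff n x \<phi> (rule_time n \<epsilon> x \<phi>)) (gaps (path \<omega>)) \<partial>M)"
  proof (rule Bochner_Integration.integral_cong[OF refl])
    fix \<omega> assume "\<omega> \<in> space M"
    then have p: "cpath (path \<omega>)" by (rule cpaths)
    show "running_cost lam \<mu> c m (path \<omega>) \<phi> (S M N lam \<mu> c m n \<epsilon> (path \<omega>) \<phi>) =
       (\<lambda>x. pathcost zero_payoff n x \<phi> (rule_time n \<epsilon> x \<phi>)) (gaps (path \<omega>))"
      using pathcost_running_cost[OF p \<phi>, of "rule_time n \<epsilon> (gaps (path \<omega>)) \<phi>" n] rule_time_le_jump[OF p, of n \<epsilon> \<phi>]
      by (simp add: S_eq_rule_time[OF p \<phi>] min_absorb1)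
  qed
  also have "\<dots> = (\<integral>x. pathcost zero_payoff n x \<phi> (rule_time n \<epsilon> x \<phi>) \<partial>Seq)"
    by (intro gaps_integral pathcost_measurable rule_time_meas) auto
  also have "\<dots> \<le> val n \<phi> + \<epsilon>" by (rule rule_time_cost_le[OF \<phi> \<epsilon>])
  finally show ?thesis .
qed

text \<open>\<open>Phi_jump\<close> with the jump times as an explicit argument. Truncated jump
  times are known by time s, whereas the full ones are not; up to the current number of jumps the
  two give the same state.\<close>

primrec PJt :: "(nat \<Rightarrow> real) \<Rightarrow> real \<times> real \<Rightarrow> nat \<Rightarrow> real \<times> real" where
  "PJt T \<phi> 0 = \<phi>"
| "PJt T \<phi> (Suc n) = jm (fl (T (Suc n) - T n) (PJt T \<phi> n))"

lemma PJ_eq_PJt: "(\<And>i. i \<le> n \<Longrightarrow> T i = jump_time p i) \<Longrightarrow> PJ p \<phi> n = PJt T \<phi> n"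
  by (induction n) auto

lemma PJt_measurable:
  assumes [measurable]: "\<And>i. (\<lambda>\<omega>. T \<omega> i) \<in> borel_measurable K"
  shows "(\<lambda>\<omega>. PJt (T \<omega>) \<phi> n) \<in> borel_measurable K"
proof (induction n)
  case (Suc n)
  note [measurable] = Suc
  show ?case unfolding PJt.simps by measurable
qed simp

lemma Ph_past:
  assumes s: "0 \<le> s"
  shows "(\<lambda>\<omega>. Ph (path \<omega>) \<phi> s) \<in> borel_measurable (past s)"
proof -
  let ?T = "\<lambda>\<omega> i. min (jump_time (path \<omega>) i) s"
  have T [measurable]: "(\<lambda>\<omega>. ?T \<omega> i) \<in> borel_measurable (past s)" for i by (rule min_jump_time_past[OF s])
  have [measurable]: "(\<lambda>\<omega>. PJt (?T \<omega>) \<phi> k) \<in> borel_measurable (past s)" for k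
    by (rule PJt_measurable) (rule T)
  have "(\<lambda>\<omega>. fl (s - ?T \<omega> k) (PJt (?T \<omega>) \<phi> k)) \<in> borel_measurable (past s)" for k by measurable
  then have "(\<lambda>\<omega>. fl (s - ?T \<omega> (N s \<omega>)) (PJt (?T \<omega>) \<phi> (N s \<omega>))) \<in> borel_measurable (past s)"
    by (rule measurable_compose_countable[OF _ N_past[OF s order_refl]])
  moreover have "Ph (path \<omega>) \<phi> s = fl (s - ?T \<omega> (N s \<omega>)) (PJt (?T \<omega>) \<phi> (N s \<omega>))" if "\<omega> \<in> space M" for \<omega>
  proof -
    note p = cpaths[OF that]
    have "jump_time (path \<omega>) i \<le> s" if "i \<le> N s \<omega>" for i
      using jump_time_le_iff[OF p s, of i] that N_0[OF \<open>\<omega> \<in> space M\<close>] by simp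
    then have T: "?T \<omega> i = jump_time (path \<omega>) i" if "i \<le> N s \<omega>" for i using that by simp
    show ?thesis
      using Ph_eq[OF p s, of \<phi>] PJ_eq_PJt[of "N s \<omega>" "?T \<omega>" "path \<omega>" \<phi>] T N_0[OF that] by simp
  qed
  ultimately show ?thesis
    using measurable_cong[of "past s" "\<lambda>\<omega>. Ph (path \<omega>) \<phi> s" "\<lambda>\<omega>. fl (s - ?T \<omega> (N s \<omega>)) (PJt (?T \<omega>) \<phi> (N s \<omega>))" borel]
    by simp
qed

lemma val_measurable: "(\<lambda>\<phi>. val k (clip \<phi>)) \<in> borel_measurable borel"
  by (rule admissible_measurable[OF admissible_val])

lemma pathcost_val_meas: "(\<lambda>x. pathcost val n x \<phi> T) \<in> borel_measurable borel_seq"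
  by (intro pathcost_measurable val_measurable) auto

lemma pathcost_val_integrable: "\<phi> \<in> Quad \<Longrightarrow> integrable Seq (\<lambda>x. pathcost val n x \<phi> T)"
  by (intro pathcost_integrable val_measurable val_abs) auto

text \<open>By \<open>pathcost_increment\<close> the integrand is a function of past data and of the
  gaps after s. Integrating out the gaps first, with the past frozen, leaves a nonnegative number by
  \<open>val_le_pathcost\<close>.\<close>

lemma pathcost_val_submartingale:
  assumes \<phi>: "\<phi> \<in> Quad" and s: "0 \<le> s" and h: "0 \<le> h" and A: "A \<in> sets (past s)"
  shows "0 \<le> (\<integral>\<omega>. indicator A \<omega> * (pathcost val n (gaps (path \<omega>)) \<phi> (ennreal (s + h)) - pathcost val n (gaps (path \<omega>)) \<phi> (ennreal s)) \<partial>M)"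
    (is "0 \<le> (\<integral>\<omega>. ?Z \<omega> \<partial>M)")
proof -
  define K where "K = count_space (UNIV :: bool set) \<Otimes>\<^sub>M (count_space (UNIV :: nat set) \<Otimes>\<^sub>M (borel :: (real \<times> real) measure))"
  \<comment> \<open>Membership in \<open>A\<close> is carried as a component, so that the indicator
    becomes part of the function of past and future.\<close>
  define X where "X \<omega> = (\<omega> \<in> A, N s \<omega>, Ph (path \<omega>) \<phi> s)" for \<omega>
  define F where "F y x = (if fst y \<and> fst (snd y) < n then exp (- lam * s) *
      (pathcost val (n - fst (snd y)) x (clip (snd (snd y))) (ennreal h) - val (n - fst (snd y)) (clip (snd (snd y)))) else 0)"
    for y :: "bool \<times> nat \<times> real \<times> real" and x
  have [measurable]: "(\<lambda>\<omega>. \<omega> \<in> A) \<in> measurable (past s) (count_space UNIV)"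
  proof -
    have "{\<omega> \<in> space (past s). \<omega> \<in> A} = A" using sets.sets_into_space[OF A] by auto
    then show ?thesis using A by (simp add: pred_def)
  qed
  note [measurable] = N_past[OF s order_refl] Ph_past[OF s, of \<phi>]
  have X: "X \<in> measurable (past s) K" unfolding X_def K_def by measurable
  have Fm: "case_prod F \<in> borel_measurable (K \<Otimes>\<^sub>M borel_seq)"
  proof -
    \<comment> \<open>The number of stages is an index of a recursion, so measurability is shown for
      each fixed count k and then glued over countably many k.\<close>
    define G where "G k = (\<lambda>p::(bool \<times> nat \<times> real \<times> real) \<times> (nat \<Rightarrow> real). (if fst (fst p) \<and> k < n then exp (- lam * s) *
      (pathcost val (n - k) (snd p) (clip (snd (snd (fst p)))) (ennreal h) - val (n - k) (clip (snd (snd (fst p))))) else 0))" for k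
    have [measurable]: "(\<lambda>p. snd (snd (fst p))) \<in> borel_measurable (K \<Otimes>\<^sub>M borel_seq)" unfolding K_def by measurable
    have [measurable]: "(\<lambda>p. val k (clip (snd (snd (fst p))))) \<in> borel_measurable (K \<Otimes>\<^sub>M borel_seq)" for k
      by (rule measurable_compose[OF _ val_measurable]) measurable
    have [measurable]: "(\<lambda>p. pathcost val k (snd p) (clip (snd (snd (fst p)))) (ennreal h)) \<in> borel_measurable (K \<Otimes>\<^sub>M borel_seq)" for k
      by (intro pathcost_measurable val_measurable) measurable
    have [measurable]: "(\<lambda>p. fst (fst p)) \<in> measurable (K \<Otimes>\<^sub>M borel_seq) (count_space UNIV)"
      "(\<lambda>p. fst (snd (fst p))) \<in> measurable (K \<Otimes>\<^sub>M borel_seq) (count_space UNIV)" unfolding K_def by measurable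
    have "G k \<in> borel_measurable (K \<Otimes>\<^sub>M borel_seq)" for k unfolding G_def by measurable
    then have "(\<lambda>p. G (fst (snd (fst p))) p) \<in> borel_measurable (K \<Otimes>\<^sub>M borel_seq)"
      by (rule measurable_compose_countable) measurable
    also have "(\<lambda>p. G (fst (snd (fst p))) p) = case_prod F" by (auto simp: fun_eq_iff G_def F_def)
    finally show ?thesis .
  qed
  have XY: "(\<lambda>\<omega>. (X \<omega>, gaps (shift s (path \<omega>)))) \<in> measurable M (K \<Otimes>\<^sub>M borel_seq)"
    by (intro measurable_Pair measurable_past[OF X] gaps_shift_measurable[OF s])
  have ZF: "?Z \<omega> = F (X \<omega>) (gaps (shift s (path \<omega>)))" if "\<omega> \<in> space M" for \<omega>
    using pathcost_increment[OF cpaths[OF that] \<phi> s h, of val n] N_0[OF that] Ph_Quad[OF cpaths[OF that] \<phi> s]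
    by (auto simp: F_def X_def split: split_indicator)
  have Am: "A \<in> sets M" using A past_subset by blast
  have "integrable M (\<lambda>\<omega>. pathcost val n (gaps (path \<omega>)) \<phi> T)" for T
    using pathcost_val_integrable[OF \<phi>] gaps_integrable[OF pathcost_val_meas] by blast
  then have "integrable M (\<lambda>\<omega>. indicator A \<omega> *\<^sub>R (pathcost val n (gaps (path \<omega>)) \<phi> (ennreal (s + h)) - pathcost val n (gaps (path \<omega>)) \<phi> (ennreal s)))"
    by (intro integrable_mult_indicator Am Bochner_Integration.integrable_diff)
  then have "integrable M ?Z" by simp
  then have "integrable M (\<lambda>\<omega>. case_prod F (X \<omega>, gaps (shift s (path \<omega>))))"
    using ZF by (simp cong: Bochner_Integration.integrable_cong)
  then have int: "integrable (distr M (K \<Otimes>\<^sub>M borel_seq) (\<lambda>\<omega>. (X \<omega>, gaps (shift s (path \<omega>))))) (case_prod F)"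
    using integrable_distr_eq[OF XY Fm] by simp
  have D: "distr M (K \<Otimes>\<^sub>M borel_seq) (\<lambda>\<omega>. (X \<omega>, gaps (shift s (path \<omega>)))) = distr M K X \<Otimes>\<^sub>M Seq"
    using past_gaps_distr[OF s X] by (simp add: Seq_def Expo_def)
  interpret DX: prob_space "distr M K X" by (rule prob_space_distr[OF measurable_past[OF X]])
  interpret P: pair_prob_space "distr M K X" Seq by unfold_locales
  have inner: "0 \<le> (\<integral>x. F y x \<partial>Seq)" for y
  proof (cases "fst y \<and> fst (snd y) < n")
    case True
    let ?k = "n - fst (snd y)" and ?\<psi> = "clip (snd (snd y))"
    have "(\<integral>x. F y x \<partial>Seq) = (\<integral>x. exp (- lam * s) * (pathcost val ?k x ?\<psi> (ennreal h) - val ?k ?\<psi>) \<partial>Seq)"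
      using True by (simp add: F_def)
    also have "\<dots> = exp (- lam * s) * ((\<integral>x. pathcost val ?k x ?\<psi> (ennreal h) \<partial>Seq) - val ?k ?\<psi>)"
      using pathcost_val_integrable[OF clip_in] by (simp add: Seq.prob_space[simplified])
    finally show ?thesis using val_le_pathcost[OF clip_in h, of ?k] by simp
  next
    case False
    then have "F y = (\<lambda>x. 0)" by (auto simp: F_def fun_eq_iff)
    then show ?thesis by simp
  qed
  have "(\<integral>\<omega>. ?Z \<omega> \<partial>M) = (\<integral>\<omega>. case_prod F (X \<omega>, gaps (shift s (path \<omega>))) \<partial>M)"
    using ZF by (intro Bochner_Integration.integral_cong) auto
  also have "\<dots> = (\<integral>p. case_prod F p \<partial>(distr M K X \<Otimes>\<^sub>M Seq))"
    unfolding D[symmetric] by (rule integral_distr[OF XY Fm, symmetric])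
  also have "\<dots> = (\<integral>y. (\<integral>x. F y x \<partial>Seq) \<partial>distr M K X)"
    using P.integral_fst[OF int[unfolded D]] by simp
  also have "\<dots> \<ge> 0" by (intro Bochner_Integration.integral_nonneg inner)
  finally show ?thesis .
qed

end

section \<open>Lower bound for an arbitrary stopping time, by sampling on dyadic grids\<close>

context pdmp_poisson begin

lemma pathcost_val_le_zero:
  assumes p: "cpath p" and \<phi>: "\<phi> \<in> Quad" and t: "0 \<le> t"
  shows "pathcost val n (gaps p) \<phi> (ennreal t) \<le> pathcost zero_payoff n (gaps p) \<phi> (ennreal t)"
  using admissible_bounds(2)[OF admissible_val Ph_Quad[OF p \<phi> t]]
  by (auto simp: pathcost_path_real[OF p \<phi> t] mult_nonneg_nonpos)

lemma pathcost_val_0: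
  assumes p: "cpath p" and \<phi>: "\<phi> \<in> Quad"
  shows "pathcost val n (gaps p) \<phi> 0 = val n \<phi>"
proof (cases n)
  case (Suc n')
  then have "0 < jump_time p n" using jump_time_less_Suc[OF p, of n'] jump_time_nonneg[OF p, of n'] by simp
  then show ?thesis
    using pathcost_path_real[OF p \<phi> order_refl, of val n] Ph_before[OF p order_refl jump_time_1_pos[OF p], of \<phi>] by simp
qed simp

text \<open>Without terminal payoff the cost is an integral over an initial interval, hence
  continuous in its end point; the cost rate up to the n-th jump dominates.\<close>

lemma pathcost_zero_tendsto:
  assumes p: "cpath p" and \<phi>: "\<phi> \<in> Quad" and X: "X \<longlonglongrightarrow> T"
  shows "(\<lambda>j. pathcost zero_payoff n (gaps p) \<phi> (X j)) \<longlonglongrightarrow> pathcost zero_payoff n (gaps p) \<phi> T"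
proof -
  let ?s = "jump_time p n"
  let ?f = "\<lambda>T s. indicator {s. 0 \<le> s \<and> ennreal s \<le> min T (ennreal ?s)} s * cost_rate p \<phi> s"
  have sub: "{s. 0 \<le> s \<and> ennreal s \<le> min T (ennreal ?s)} \<subseteq> {0..?s}" for T
    using jump_time_nonneg[OF p, of n] by auto
  have eq: "pathcost zero_payoff n (gaps p) \<phi> T = (\<integral>s. ?f T s \<partial>lborel)" for T
    unfolding pathcost_running_cost[OF p \<phi>, symmetric] running_cost_def set_lebesgue_integral_def cost_rate_def by simp
  have int: "integrable lborel (?f T)" for T
    by (rule cost_rate_integrable[OF p \<phi> _ sub]) measurable
  have dom: "integrable lborel (\<lambda>s. \<bar>indicator {0..?s} s * cost_rate p \<phi> s\<bar>)"
    by (intro integrable_abs cost_rate_integrable_jump p \<phi>)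
  show ?thesis unfolding eq
  proof (rule integral_dominated_convergence[OF _ _ dom])
    show "AE s in lborel. norm (?f (X j) s) \<le> \<bar>indicator {0..?s} s * cost_rate p \<phi> s\<bar>" for j
      using sub[of "X j"] by (intro AE_I2) (auto split: split_indicator)
    show "AE s in lborel. (\<lambda>j. ?f (X j) s) \<longlonglongrightarrow> ?f T s"
      using AE_lborel_singleton[of "enn2real T"]
    proof eventually_elim
      case (elim s)
      consider "s < 0" | "0 \<le> s" "ennreal s < T" | "0 \<le> s" "T < ennreal s"
        using elim by (metis enn2real_ennreal linorder_cases not_le)
      then show ?case
      proof cases
        case 2
        from order_tendstoD(1)[OF X 2(2)] have "\<forall>\<^sub>F j in sequentially. ?f (X j) s = ?f T s"
          by eventually_elim (use 2 in \<open>auto split: split_indicator\<close>)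
        then show ?thesis by (rule tendsto_eventually)
      next
        case 3
        from order_tendstoD(2)[OF X 3(2)] have "\<forall>\<^sub>F j in sequentially. ?f (X j) s = ?f T s"
          by eventually_elim (use 3 in \<open>auto split: split_indicator\<close>)
        then show ?thesis by (rule tendsto_eventually)
      qed simp
    qed
  qed (use int borel_measurable_integrable in blast)+
qed

text \<open>The stopping time rounded up to the next point of the grid \<open>\<delta> \<nat>\<close>, and cut off at \<open>K \<delta>\<close>.\<close>

definition grid_index :: "real \<Rightarrow> nat \<Rightarrow> ennreal \<Rightarrow> nat" where
  "grid_index \<delta> K T = (LEAST k. k = K \<or> T < ennreal (real k * \<delta>))"

lemma grid_index:
  "grid_index \<delta> K T = K \<or> T < ennreal (real (grid_index \<delta> K T) * \<delta>)"
  "k < grid_index \<delta> K T \<Longrightarrow> k \<noteq> K \<and> ennreal (real k * \<delta>) \<le> T"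
  "grid_index \<delta> K T \<le> K"
proof -
  let ?P = "\<lambda>k. k = K \<or> T < ennreal (real k * \<delta>)"
  show "grid_index \<delta> K T = K \<or> T < ennreal (real (grid_index \<delta> K T) * \<delta>)"
    unfolding grid_index_def by (rule LeastI[of ?P K]) simp
  show "k < grid_index \<delta> K T \<Longrightarrow> k \<noteq> K \<and> ennreal (real k * \<delta>) \<le> T"
    unfolding grid_index_def using not_less_Least[of k ?P] by (auto simp: not_less)
  show "grid_index \<delta> K T \<le> K" unfolding grid_index_def by (rule Least_le) simp
qed

text \<open>Optional sampling written as a sum: the step from k to k + 1 is taken exactly when
  \<open>T\<close> is at least k \<delta>. Rounding strictly upwards makes this a non-strict
  condition at the grid time, which is the kind of event that \<open>stopping_before\<close> locates
  in the past.\<close>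

lemma grid_telescope:
  fixes f :: "nat \<Rightarrow> real"
  assumes "0 \<le> \<delta>"
  shows "f (grid_index \<delta> K T) = f 0 + (\<Sum>k<K. of_bool (ennreal (real k * \<delta>) \<le> T) * (f (Suc k) - f k))"
proof -
  let ?L = "grid_index \<delta> K T"
  have in_iff: "ennreal (real k * \<delta>) \<le> T \<longleftrightarrow> k < ?L" if "k < K" for k
  proof
    assume *: "ennreal (real k * \<delta>) \<le> T"
    show "k < ?L"
    proof (rule ccontr)
      assume "\<not> k < ?L"
      with that have L: "?L \<le> k" "?L \<noteq> K" by auto
      with grid_index(1)[of \<delta> K T] have "T < ennreal (real ?L * \<delta>)" by simp
      also have "\<dots> \<le> ennreal (real k * \<delta>)" using L(1) assms by (intro ennreal_leI mult_right_mono) auto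
      finally show False using * by simp
    qed
  qed (use grid_index(2) in blast)
  have "(\<Sum>k<K. of_bool (ennreal (real k * \<delta>) \<le> T) * (f (Suc k) - f k)) = (\<Sum>k<K. if k < ?L then f (Suc k) - f k else 0)"
    using in_iff by (intro sum.cong) auto
  also have "\<dots> = (\<Sum>k<?L. f (Suc k) - f k)"
    using grid_index(3)[of \<delta> K T] by (intro sum.mono_neutral_cong_right) auto
  also have "\<dots> = f ?L - f 0" by (rule sum_lessThan_telescope)
  finally show ?thesis by simp
qed

text \<open>Mesh 1 / 2^j and 4^j steps put the cut-off at 2^j, so the mesh vanishes while the
  cut-off tends to \<infinity>. This covers finite and infinite times together.\<close>

lemma grid_tendsto:
  "(\<lambda>j. ennreal (real (grid_index (1 / 2 ^ j) (4 ^ j) T) * (1 / 2 ^ j))) \<longlonglongrightarrow> T"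
proof -
  define \<rho> where "\<rho> j = real (grid_index (1 / 2 ^ j) (4 ^ j) T) * (1 / 2 ^ j)" for j
  have top: "real (4 ^ j) * (1 / 2 ^ j) = 2 ^ j" for j
  proof -
    have "(4::real) ^ j = 2 ^ j * 2 ^ j" by (simp add: power_mult_distrib[symmetric])
    then show ?thesis by simp
  qed
  have pow: "filterlim (\<lambda>j. 2 ^ j :: real) at_top sequentially"
  proof (rule filterlim_at_top_mono[OF filterlim_real_sequentially])
    show "\<forall>\<^sub>F j in sequentially. real j \<le> 2 ^ j"
      using of_nat_less_two_power[where 'a=real] by (intro always_eventually) (simp add: less_imp_le)
  qed
  show ?thesis
  proof (cases T)
    case (real t)
    have half: "(\<lambda>j. 1 / 2 ^ j :: real) \<longlonglongrightarrow> 0"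
      using LIMSEQ_realpow_zero[of "1 / 2 :: real"] by (simp add: power_one_over)
    have "\<forall>\<^sub>F j in sequentially. t < \<rho> j \<and> \<rho> j \<le> t + 1 / 2 ^ j"
      using filterlim_at_top_dense[THEN iffD1, OF pow, rule_format, of t]
    proof eventually_elim
      case (elim j)
      let ?L = "grid_index (1 / 2 ^ j) (4 ^ j) T"
      have lt: "t < \<rho> j"
        using grid_index(1)[of "1 / 2 ^ j" "4 ^ j" T]
      proof
        assume "?L = 4 ^ j"
        with top[of j] elim show ?thesis by (simp add: \<rho>_def)
      next
        assume "T < ennreal (real ?L * (1 / 2 ^ j))"
        then show ?thesis using real by (simp add: \<rho>_def ennreal_less_iff)
      qed
      have "0 < ?L"
      proof (rule ccontr)
        assume "\<not> 0 < ?L"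
        then have "\<rho> j = 0" by (simp add: \<rho>_def)
        with lt real show False by simp
      qed
      then have "ennreal (real (?L - 1) * (1 / 2 ^ j)) \<le> T"
        using grid_index(2)[of "?L - 1" "1 / 2 ^ j" "4 ^ j" T] by simp
      then have "real (?L - 1) * (1 / 2 ^ j) \<le> t" using real by simp
      moreover have "\<rho> j = real (?L - 1) * (1 / 2 ^ j) + 1 / 2 ^ j"
        using \<open>0 < ?L\<close> by (simp add: \<rho>_def field_simps of_nat_diff)
      ultimately show ?case using lt by simp
    qed
    then have "\<forall>\<^sub>F j in sequentially. t \<le> \<rho> j" "\<forall>\<^sub>F j in sequentially. \<rho> j \<le> t + 1 / 2 ^ j"
      by (auto elim: eventually_mono)
    moreover have "(\<lambda>j. t + 1 / 2 ^ j) \<longlonglongrightarrow> t"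
      using tendsto_add[OF tendsto_const half, of t] by simp
    ultimately have "\<rho> \<longlonglongrightarrow> t"
      by (intro tendsto_sandwich[of "\<lambda>_. t" \<rho> sequentially "\<lambda>j. t + 1 / 2 ^ j" t]) auto
    then have "(\<lambda>j. ennreal (\<rho> j)) \<longlonglongrightarrow> ennreal t" by (rule tendsto_ennrealI)
    then show ?thesis using real by (simp add: \<rho>_def)
  next
    case top'': top
    have L: "grid_index (1 / 2 ^ j) (4 ^ j) T = 4 ^ j" for j
      using grid_index(1)[of "1 / 2 ^ j" "4 ^ j" T] by (auto simp: top'')
    have "(\<lambda>j. ennreal (2 ^ j)) \<longlonglongrightarrow> \<infinity>"
      using pow by (simp add: ennreal_tendsto_top_eq_at_top)
    then show ?thesis unfolding L top by (simp add: top'')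
  qed
qed

lemma stopped_cost_integrable:
  assumes \<phi>: "\<phi> \<in> Quad" and T: "T \<in> borel_measurable M"
  shows "integrable M (\<lambda>\<omega>. pathcost zero_payoff n (gaps (path \<omega>)) \<phi> (T \<omega>))"
proof (rule Bochner_Integration.integrable_bound)
  show "integrable M (\<lambda>\<omega>. gap_bound n (gaps (path \<omega>)) \<phi>)"
    using gap_bound_integrable[OF \<phi>, of n]
    by (subst gaps_integrable) (auto intro!: gap_bound_measurable)
  show "(\<lambda>\<omega>. pathcost zero_payoff n (gaps (path \<omega>)) \<phi> (T \<omega>)) \<in> borel_measurable M"
    using T by (intro pathcost_measurable gaps_N_measurable) auto
  show "AE \<omega> in M. norm (pathcost zero_payoff n (gaps (path \<omega>)) \<phi> (T \<omega>)) \<le> norm (gap_bound n (gaps (path \<omega>)) \<phi>)"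
  proof (rule AE_I2)
    fix \<omega> assume "\<omega> \<in> space M"
    then have "\<bar>pathcost zero_payoff n (gaps (path \<omega>)) \<phi> (T \<omega>)\<bar> \<le> gap_bound n (gaps (path \<omega>)) \<phi>"
      using Lmin_pos by (intro pathcost_abs \<phi> gaps_pos cpaths) auto
    then show "norm (pathcost zero_payoff n (gaps (path \<omega>)) \<phi> (T \<omega>)) \<le> norm (gap_bound n (gaps (path \<omega>)) \<phi>)" by simp
  qed
qed

text \<open>Each term of the telescoped sum has nonnegative expectation by the submartingale
  property, so the sampled value is at least its start \<open>val n \<phi>\<close>. The terminal
  payoff is nonpositive, and removing it raises the cost.\<close>

lemma grid_cost_ge:
  assumes \<phi>: "\<phi> \<in> Quad" and \<tau>: "stopping_time (augmented_filtration M N) \<tau>" and \<delta>: "0 \<le> \<delta>"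
  shows "val n \<phi> \<le> (\<integral>\<omega>. pathcost zero_payoff n (gaps (path \<omega>)) \<phi> (ennreal (real (grid_index \<delta> K (\<tau> \<omega>)) * \<delta>)) \<partial>M)"
proof -
  note [measurable] = stopping_measurable[OF \<tau>]
  define Yv where "Yv \<omega> k = pathcost val n (gaps (path \<omega>)) \<phi> (ennreal (real k * \<delta>))" for \<omega> k
  have Y_int: "integrable M (\<lambda>\<omega>. Yv \<omega> k)" for k
    unfolding Yv_def using pathcost_val_integrable[OF \<phi>] gaps_integrable[OF pathcost_val_meas] by blast
  have ind_int: "integrable M (\<lambda>\<omega>. of_bool (ennreal (real k * \<delta>) \<le> \<tau> \<omega>) * (Yv \<omega> (Suc k) - Yv \<omega> k))" for k
  proof (rule Bochner_Integration.integrable_bound)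
    show "integrable M (\<lambda>\<omega>. Yv \<omega> (Suc k) - Yv \<omega> k)" by (intro Bochner_Integration.integrable_diff Y_int)
    have "(\<lambda>\<omega>. Yv \<omega> k) \<in> borel_measurable M" for k using Y_int by (rule borel_measurable_integrable)
    note [measurable] = this
    show "(\<lambda>\<omega>. of_bool (ennreal (real k * \<delta>) \<le> \<tau> \<omega>) * (Yv \<omega> (Suc k) - Yv \<omega> k)) \<in> borel_measurable M" by measurable
  qed auto
  have nonneg: "0 \<le> (\<integral>\<omega>. of_bool (ennreal (real k * \<delta>) \<le> \<tau> \<omega>) * (Yv \<omega> (Suc k) - Yv \<omega> k) \<partial>M)" for k
  proof -
    have s: "0 \<le> real k * \<delta>" using \<delta> by simp
    \<comment> \<open>The stopping event is replaced by an almost surely equal one of the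
      uncompleted past, to which the submartingale property applies.\<close>
    obtain A where A: "A \<in> sets (past (real k * \<delta>))" "AE \<omega> in M. ennreal (real k * \<delta>) \<le> \<tau> \<omega> \<longleftrightarrow> \<omega> \<in> A"
      using stopping_before[OF \<tau> s] by blast
    have Am: "A \<in> sets M" using A(1) past_subset by blast
    have step: "real k * \<delta> + \<delta> = real (Suc k) * \<delta>" by (simp add: algebra_simps)
    have "0 \<le> (\<integral>\<omega>. indicator A \<omega> * (Yv \<omega> (Suc k) - Yv \<omega> k) \<partial>M)"
      using pathcost_val_submartingale[OF \<phi> s \<delta> A(1), of n] unfolding step by (simp add: Yv_def)
    also have "\<dots> = (\<integral>\<omega>. of_bool (ennreal (real k * \<delta>) \<le> \<tau> \<omega>) * (Yv \<omega> (Suc k) - Yv \<omega> k) \<partial>M)"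
    proof (rule integral_cong_AE)
      show "(\<lambda>\<omega>. indicator A \<omega> * (Yv \<omega> (Suc k) - Yv \<omega> k)) \<in> borel_measurable M"
        using Am by (intro borel_measurable_times borel_measurable_diff borel_measurable_integrable[OF Y_int]) simp
      show "AE \<omega> in M. indicator A \<omega> * (Yv \<omega> (Suc k) - Yv \<omega> k) = of_bool (ennreal (real k * \<delta>) \<le> \<tau> \<omega>) * (Yv \<omega> (Suc k) - Yv \<omega> k)"
        using A(2) by eventually_elim (auto split: split_indicator)
    qed (rule borel_measurable_integrable[OF ind_int])
    finally show ?thesis .
  qed
  have tel: "Yv \<omega> (grid_index \<delta> K (\<tau> \<omega>)) = Yv \<omega> 0 + (\<Sum>k<K. of_bool (ennreal (real k * \<delta>) \<le> \<tau> \<omega>) * (Yv \<omega> (Suc k) - Yv \<omega> k))" for \<omega>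
    by (rule grid_telescope[OF \<delta>])
  have int_grid: "integrable M (\<lambda>\<omega>. Yv \<omega> (grid_index \<delta> K (\<tau> \<omega>)))"
    unfolding tel by (intro Bochner_Integration.integrable_add Bochner_Integration.integrable_sum Y_int ind_int)
  have "(\<integral>\<omega>. Yv \<omega> (grid_index \<delta> K (\<tau> \<omega>)) \<partial>M) =
      (\<integral>\<omega>. Yv \<omega> 0 \<partial>M) + (\<Sum>k<K. \<integral>\<omega>. of_bool (ennreal (real k * \<delta>) \<le> \<tau> \<omega>) * (Yv \<omega> (Suc k) - Yv \<omega> k) \<partial>M)"
    unfolding tel
    by (subst Bochner_Integration.integral_add[OF Y_int Bochner_Integration.integrable_sum[OF ind_int]])
       (simp only: Bochner_Integration.integral_sum[OF ind_int])
  also have "(\<integral>\<omega>. Yv \<omega> 0 \<partial>M) = (\<integral>\<omega>. val n \<phi> \<partial>M)"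
    using pathcost_val_0[OF cpaths \<phi>] by (intro Bochner_Integration.integral_cong) (simp_all add: Yv_def)
  also have "\<dots> = val n \<phi>" by (simp add: prob_space)
  finally have "val n \<phi> \<le> (\<integral>\<omega>. Yv \<omega> (grid_index \<delta> K (\<tau> \<omega>)) \<partial>M)"
    using sum_nonneg[of "{..<K}", OF nonneg] by simp
  also have "\<dots> \<le> (\<integral>\<omega>. pathcost zero_payoff n (gaps (path \<omega>)) \<phi> (ennreal (real (grid_index \<delta> K (\<tau> \<omega>)) * \<delta>)) \<partial>M)"
  proof (rule integral_mono[OF int_grid])
    fix \<omega> assume "\<omega> \<in> space M"
    then show "Yv \<omega> (grid_index \<delta> K (\<tau> \<omega>)) \<le> pathcost zero_payoff n (gaps (path \<omega>)) \<phi> (ennreal (real (grid_index \<delta> K (\<tau> \<omega>)) * \<delta>))"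
      unfolding Yv_def using \<delta> by (intro pathcost_val_le_zero cpaths \<phi>) auto
  next
    show "integrable M (\<lambda>\<omega>. pathcost zero_payoff n (gaps (path \<omega>)) \<phi> (ennreal (real (grid_index \<delta> K (\<tau> \<omega>)) * \<delta>)))"
      by (rule stopped_cost_integrable[OF \<phi>]) (unfold grid_index_def, measurable)
  qed
  finally show ?thesis .
qed

lemma cost_ge_val:
  assumes \<phi>: "\<phi> \<in> Quad" and \<tau>: "stopping_time (augmented_filtration M N) \<tau>"
  shows "val n \<phi> \<le> (\<integral>\<omega>. running_cost lam \<mu> c m (path \<omega>) \<phi> (min (\<tau> \<omega>) (ennreal (jump_time (path \<omega>) n))) \<partial>M)"
proof -
  note [measurable] = stopping_measurable[OF \<tau>]
  let ?\<rho> = "\<lambda>j \<omega>. ennreal (real (grid_index (1 / 2 ^ j) (4 ^ j) (\<tau> \<omega>)) * (1 / 2 ^ j))"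
  have \<rho>: "(\<lambda>\<omega>. ?\<rho> j \<omega>) \<in> borel_measurable M" for j
    unfolding grid_index_def by measurable
  have "(\<lambda>j. \<integral>\<omega>. pathcost zero_payoff n (gaps (path \<omega>)) \<phi> (?\<rho> j \<omega>) \<partial>M) \<longlonglongrightarrow>
      (\<integral>\<omega>. pathcost zero_payoff n (gaps (path \<omega>)) \<phi> (\<tau> \<omega>) \<partial>M)"
  proof (rule integral_dominated_convergence)
    show "integrable M (\<lambda>\<omega>. gap_bound n (gaps (path \<omega>)) \<phi>)"
      using gap_bound_integrable[OF \<phi>, of n]
      by (subst gaps_integrable) (auto intro!: gap_bound_measurable)
    show "(\<lambda>\<omega>. pathcost zero_payoff n (gaps (path \<omega>)) \<phi> (\<tau> \<omega>)) \<in> borel_measurable M"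
      by (rule borel_measurable_integrable[OF stopped_cost_integrable[OF \<phi>]]) measurable
    show "(\<lambda>\<omega>. pathcost zero_payoff n (gaps (path \<omega>)) \<phi> (?\<rho> j \<omega>)) \<in> borel_measurable M" for j
      by (rule borel_measurable_integrable[OF stopped_cost_integrable[OF \<phi> \<rho>]])
    show "AE \<omega> in M. (\<lambda>j. pathcost zero_payoff n (gaps (path \<omega>)) \<phi> (?\<rho> j \<omega>)) \<longlonglongrightarrow> pathcost zero_payoff n (gaps (path \<omega>)) \<phi> (\<tau> \<omega>)"
      by (intro AE_I2 pathcost_zero_tendsto cpaths \<phi> grid_tendsto)
    show "AE \<omega> in M. norm (pathcost zero_payoff n (gaps (path \<omega>)) \<phi> (?\<rho> j \<omega>)) \<le> gap_bound n (gaps (path \<omega>)) \<phi>" for j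
      unfolding real_norm_def using Lmin_pos
      by (intro AE_I2 pathcost_abs \<phi> gaps_pos cpaths) auto
  qed
  then have "val n \<phi> \<le> (\<integral>\<omega>. pathcost zero_payoff n (gaps (path \<omega>)) \<phi> (\<tau> \<omega>) \<partial>M)"
    by (rule LIMSEQ_le_const) (intro exI allI impI grid_cost_ge[OF \<phi> \<tau>], simp)
  also have "\<dots> = (\<integral>\<omega>. running_cost lam \<mu> c m (path \<omega>) \<phi> (min (\<tau> \<omega>) (ennreal (jump_time (path \<omega>) n))) \<partial>M)"
    using pathcost_running_cost[OF cpaths \<phi>] by (intro Bochner_Integration.integral_cong) simp_all
  finally show ?thesis .
qed

end

section \<open>The rule is a stopping time; identification of the value functions\<close>

definition psum :: "(nat \<Rightarrow> real) \<Rightarrow> nat \<Rightarrow> real" where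
  "psum x n = (\<Sum>i<n. x i)"

lemma psum_tail: "psum (tail x) n = psum x (Suc n) - x 0"
  unfolding psum_def tail_def sum.lessThan_Suc_shift by simp

context pdmp_poisson begin

text \<open>Whether the rule has stopped by time \<open>t\<close> depends only on the jumps up to time \<open>t\<close>.\<close>

lemma rule_time_le_agree:
  assumes "\<And>i. 0 \<le> x i" "\<And>i. 0 \<le> y i" "0 \<le> t"
    and "\<And>n. psum x n \<le> t \<or> psum y n \<le> t \<Longrightarrow> psum x n = psum y n"
  shows "rule_time n \<epsilon> x \<phi> \<le> ennreal t \<longleftrightarrow> rule_time n \<epsilon> y \<phi> \<le> ennreal t"
  using assms
proof (induction n arbitrary: x y t \<epsilon> \<phi>)
  case (Suc n)
  note x = Suc.prems(1) and y = Suc.prems(2) and t = Suc.prems(3) and agree = Suc.prems(4)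
  define \<rho> where "\<rho> = opt_time (val n) (if n = 0 then \<epsilon> else \<epsilon> / 2) (clip \<phi>)"
  have rule_time_eq: "rule_time (Suc n) \<epsilon> z \<phi> = (if \<rho> < ennreal (z 0) then \<rho> else ennreal (z 0) + rule_time n (\<epsilon> / 2) (tail z) (nxt \<phi> (z 0)))" for z
    by (simp add: \<rho>_def)
  have agree1: "x 0 \<le> t \<or> y 0 \<le> t \<Longrightarrow> x 0 = y 0" using agree[of 1] by (simp add: psum_def)
  show ?case
  proof (cases "x 0 \<le> t")
    case True
    then have y0: "y 0 = x 0" using agree1 by simp
    have rest: "rule_time n (\<epsilon> / 2) (tail x) (nxt \<phi> (x 0)) \<le> ennreal (t - x 0) \<longleftrightarrow> rule_time n (\<epsilon> / 2) (tail y) (nxt \<phi> (x 0)) \<le> ennreal (t - x 0)"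
    proof (rule Suc.IH)
      show "0 \<le> tail x i" "0 \<le> tail y i" for i using x y by (simp_all add: tail_def)
      show "0 \<le> t - x 0" using True by simp
      show "psum (tail x) k = psum (tail y) k" if "psum (tail x) k \<le> t - x 0 \<or> psum (tail y) k \<le> t - x 0" for k
        using that agree[of "Suc k"] by (simp add: psum_tail y0)
    qed
    have shift: "ennreal (x 0) + a \<le> ennreal t \<longleftrightarrow> a \<le> ennreal (t - x 0)" for a
    proof (cases a)
      case (real r)
      then show ?thesis using True x[of 0] by (simp flip: ennreal_plus) (auto simp: ennreal_le_iff)
    qed (simp add: top_unique)
    show ?thesis unfolding rule_time_eq y0 using rest by (simp add: shift)
  next
    case False
    \<comment> \<open>Neither sequence has a jump by time t, so both rules stop by t precisely if
      the common waiting time \<rho> is at most t.\<close>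
    then have "t < x 0" "t < y 0" using agree1 by (auto simp: not_le[symmetric])
    then have gt: "ennreal t < ennreal (x 0)" "ennreal t < ennreal (y 0)" using t by (auto simp: ennreal_less_iff)
    have "rule_time (Suc n) \<epsilon> z \<phi> \<le> ennreal t \<longleftrightarrow> \<rho> \<le> ennreal t" if z: "ennreal t < ennreal (z 0)" for z
    proof (cases "\<rho> < ennreal (z 0)")
      case True
      then show ?thesis unfolding rule_time_eq by simp
    next
      case False
      then have "\<not> \<rho> \<le> ennreal t" using z by (auto simp: not_le not_less intro: less_le_trans)
      have "ennreal t < ennreal (z 0) + rule_time n (\<epsilon> / 2) (tail z) (nxt \<phi> (z 0))"
        using z by (rule less_le_trans) simp
      then have "\<not> ennreal (z 0) + rule_time n (\<epsilon> / 2) (tail z) (nxt \<phi> (z 0)) \<le> ennreal t" by (simp only: not_le)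
      with \<open>\<not> \<rho> \<le> ennreal t\<close> show ?thesis unfolding rule_time_eq using False by simp
    qed
    then show ?thesis using gt by simp
  qed
qed simp

lemma psum_gaps: "cpath p \<Longrightarrow> psum (gaps p) n = jump_time p n"
  unfolding psum_def gaps_def by (simp add: sum_lessThan_telescope)

text \<open>To show that the event up to b belongs to the past of b, the gaps are replaced by a
  sequence that is measurable with respect to that past and has the same jumps up to b;
  \<open>rule_time_le_agree\<close> says that the event is unchanged.\<close>

lemma S_stopping_time:
  assumes \<phi>: "\<phi> \<in> Quad"
  shows "stopping_time (augmented_filtration M N) (\<lambda>\<omega>. S M N lam \<mu> c m n \<epsilon> (path \<omega>) \<phi>)"
proof (rule stopping_timeI)
  fix t
  have "{\<omega> \<in> space M. S M N lam \<mu> c m n \<epsilon> (path \<omega>) \<phi> \<le> t} \<in> sets (augmented_filtration M N t)"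
  proof (cases t)
    case top
    have "space (augmented_filtration M N t) \<in> sets (augmented_filtration M N t)" by (rule sets.top)
    with top show ?thesis by simp
  next
    case (real b)
    \<comment> \<open>Jumps up to b are kept, later ones are all moved to b + 1, a value beyond b.
      The resulting gaps may be 0, which is why \<open>rule_time_le_agree\<close> asks for
      nonnegative entries only.\<close>
    define \<theta> where "\<theta> \<omega> i = (if i \<le> N b \<omega> then min (jump_time (path \<omega>) i) b else b + 1)" for \<omega> i
    define \<eta> where "\<eta> \<omega> i = \<theta> \<omega> (Suc i) - \<theta> \<omega> i" for \<omega> i
    have [measurable]: "(\<lambda>\<omega>. min (jump_time (path \<omega>) i) b) \<in> borel_measurable (past b)" for i
      by (rule min_jump_time_past[OF real(1)])
    note [measurable] = N_past[OF real(1) order_refl]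
    have \<theta>m [measurable]: "(\<lambda>\<omega>. \<theta> \<omega> i) \<in> borel_measurable (past b)" for i
      unfolding \<theta>_def by measurable
    have \<eta>m: "\<eta> \<in> measurable (past b) borel_seq"
      by (rule measurable_PiM_single') (auto simp: \<eta>_def)
    have "(\<lambda>\<omega>. rule_time n \<epsilon> (\<eta> \<omega>) \<phi>) \<in> borel_measurable (past b)"
      by (rule rule_time_measurable[OF \<eta>m]) simp
    then have "{\<omega> \<in> space (past b). rule_time n \<epsilon> (\<eta> \<omega>) \<phi> \<le> t} \<in> sets (past b)" by measurable
    also have "{\<omega> \<in> space (past b). rule_time n \<epsilon> (\<eta> \<omega>) \<phi> \<le> t} = {\<omega> \<in> space M. S M N lam \<mu> c m n \<epsilon> (path \<omega>) \<phi> \<le> t}"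
    proof -
      have "S M N lam \<mu> c m n \<epsilon> (path \<omega>) \<phi> \<le> t \<longleftrightarrow> rule_time n \<epsilon> (\<eta> \<omega>) \<phi> \<le> t" if \<omega>: "\<omega> \<in> space M" for \<omega>
      proof -
        note p = cpaths[OF \<omega>]
        have le_iff: "jump_time (path \<omega>) i \<le> b \<longleftrightarrow> i \<le> N b \<omega>" for i
          using jump_time_le_iff[OF p real(1), of i] N_0[OF \<omega>] by simp
        have \<theta>_eq: "\<theta> \<omega> i = (if jump_time (path \<omega>) i \<le> b then jump_time (path \<omega>) i else b + 1)" for i
          unfolding \<theta>_def le_iff[symmetric] by simp
        have \<theta>_mono: "\<theta> \<omega> i \<le> \<theta> \<omega> (Suc i)" for i
          using jump_time_less_Suc[OF p, of i] by (auto simp: \<theta>_eq)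
        have psum_\<eta>: "psum (\<eta> \<omega>) k = \<theta> \<omega> k" for k
          using jump_time_0[OF p] real(1) by (simp add: psum_def \<eta>_def sum_lessThan_telescope \<theta>_eq[of 0])
        have "rule_time n \<epsilon> (gaps (path \<omega>)) \<phi> \<le> ennreal b \<longleftrightarrow> rule_time n \<epsilon> (\<eta> \<omega>) \<phi> \<le> ennreal b"
        proof (rule rule_time_le_agree)
          show "0 \<le> gaps (path \<omega>) i" for i using gaps_pos[OF p, of i] by simp
          show "0 \<le> \<eta> \<omega> i" for i using \<theta>_mono by (simp add: \<eta>_def)
          show "0 \<le> b" by (rule real(1))
          show "psum (gaps (path \<omega>)) k = psum (\<eta> \<omega>) k" if "psum (gaps (path \<omega>)) k \<le> b \<or> psum (\<eta> \<omega>) k \<le> b" for k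
            using that by (auto simp: psum_gaps[OF p] psum_\<eta> \<theta>_eq split: if_splits)
        qed
        then show ?thesis using real(2) by (simp add: S_eq_rule_time[OF p \<phi>])
      qed
      then show ?thesis by auto
    qed
    finally show ?thesis using past_subset_augmented[OF real(1)] real(2) by blast
  qed
  then show "Measurable.pred (augmented_filtration M N t) (\<lambda>\<omega>. S M N lam \<mu> c m n \<epsilon> (path \<omega>) \<phi> \<le> t)"
    by (simp add: pred_def)
qed

lemma V_eq_val:
  assumes \<phi>: "\<phi> \<in> Quad"
  shows "V M N lam \<mu> c m n \<phi> = val n \<phi>"
proof (rule antisym)
  let ?C = "\<lambda>\<tau>. \<integral>\<omega>. running_cost lam \<mu> c m (path \<omega>) \<phi> (min (\<tau> \<omega>) (ennreal (jump_time (path \<omega>) n))) \<partial>M"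
  let ?ST = "{\<tau>. stopping_time (augmented_filtration M N) \<tau>}"
  have ge: "val n \<phi> \<le> ?C \<tau>" if "\<tau> \<in> ?ST" for \<tau>
    using cost_ge_val[OF \<phi>, of \<tau> n] that by simp
  show "val n \<phi> \<le> V M N lam \<mu> c m n \<phi>"
    \<comment> \<open>The rule also witnesses that the infimum is taken over a nonempty set.\<close>
    unfolding V_def using S_stopping_time[OF \<phi>] by (intro cINF_greatest ge) auto
  show "V M N lam \<mu> c m n \<phi> \<le> val n \<phi>"
  proof (rule field_le_epsilon)
    fix \<epsilon> :: real assume "0 < \<epsilon>"
    let ?S = "\<lambda>\<omega>. S M N lam \<mu> c m n \<epsilon> (path \<omega>) \<phi>"
    have "V M N lam \<mu> c m n \<phi> \<le> ?C ?S"
      unfolding V_def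
    proof (rule cINF_lower)
      show "bdd_below (?C ` ?ST)" using ge by (intro bdd_belowI2[where m="val n \<phi>"])
      show "?S \<in> ?ST" using S_stopping_time[OF \<phi>] by simp
    qed
    also have "\<dots> = (\<integral>\<omega>. running_cost lam \<mu> c m (path \<omega>) \<phi> (?S \<omega>) \<partial>M)"
    proof (rule Bochner_Integration.integral_cong[OF refl])
      fix \<omega> assume "\<omega> \<in> space M"
      then have p: "cpath (path \<omega>)" by (rule cpaths)
      show "running_cost lam \<mu> c m (path \<omega>) \<phi> (min (?S \<omega>) (ennreal (jump_time (path \<omega>) n))) = running_cost lam \<mu> c m (path \<omega>) \<phi> (?S \<omega>)"
        using rule_time_le_jump[OF p, of n \<epsilon> \<phi>] by (simp add: S_eq_rule_time[OF p \<phi>] min_absorb1)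
    qed
    also have "\<dots> \<le> val n \<phi> + \<epsilon>" using \<open>0 < \<epsilon>\<close> by (intro cost_S_le[OF \<phi>]) simp
    finally show "V M N lam \<mu> c m n \<phi> \<le> val n \<phi> + \<epsilon>" .
  qed
qed

end

theorem proposition5p5:
  fixes M :: "'a measure" and N :: "real \<Rightarrow> 'a \<Rightarrow> nat" and lam \<mu> c m :: real
  assumes "lam > 0" and "\<mu> > 1" and "c > 0" and "-1 < m" and "m < 1"
    and "poisson_process M N \<mu>"
  shows "(\<forall>n\<ge>1. \<forall>\<phi>\<in>{0..} \<times> {0..}. v M N lam \<mu> c m n \<phi> = V M N lam \<mu> c m n \<phi>) \<and>
    (\<forall>\<epsilon>\<ge>0. \<forall>n\<ge>1. \<forall>\<phi>\<in>{0..} \<times> {0..}.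
       (LINT \<omega>|M. running_cost lam \<mu> c m (\<lambda>t. N t \<omega>) \<phi>
                    (S M N lam \<mu> c m n \<epsilon> (\<lambda>t. N t \<omega>) \<phi>))
       \<le> v M N lam \<mu> c m n \<phi> + \<epsilon>)"
proof -
  interpret pdmp_poisson M N lam \<mu> c m
    using assms by (intro pdmp_poisson.intro pdmp.intro)
  show ?thesis
    using V_eq_val v_eq_val cost_S_le by (intro conjI allI impI ballI) simp_all
qed

end
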